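(* Let $G$ be a finite group, $A$ a finite abelian group, $\rho:G\to\mathrm{Aut}(A)$ a homomorphism and $\pi:G\to A$ a bijective 1-cocycle. Let $A^*=\mathrm{Hom}(A,\mathbb{C}^* )$, $\tilde G=G\ltimes A^*$, and $$\bar J=|A|^{-1}\sum_{x\in A,\,y^*\in A^*}e^{(x,y^* )}\,\pi^{-1}(x)\otimes y^*\in\mathbb{C}[\tilde G]\otimes\mathbb{C}[\tilde G].$$ Then $\bar J$ is a twist for $\mathbb{C}[\tilde G]$, and it gives rise to a minimal triangular Hopf algebra $\mathbb{C}[\tilde G]^{\bar J}$, with universal R-matrix ($R=\bar J_{21}^{-1}\bar J$) $$R=|A|^{-2}\sum_{x,y\in A,\ x^*,y^*\in A^*}e^{(x,y^* )-(y,x^* )}\;x^*\pi^{-1}(x)\otimes\pi^{-1}(T(y))\,y^*,$$ where $T:A\to A$ is the bijective map determined by $\pi^{-1}(x^{-1})\,\pi^{-1}(T(x))=1$ in $G$ for all $x\in A$.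
   Context: Write $gx=\rho(g)(x)$. A 1-cocycle of $G$ with coefficients in $A$ is a map $\pi:G\to A$ with $\pi(gg')=\pi(g)\,(g\pi(g'))$ for all $g,g'\in G$. $(\cdot,\cdot):A\times A^*\to 2\pi i(\mathbb{R}/\mathbb{Z})$ is the standard pairing, so $e^{(x,\chi)}=\chi(x)$. The group $G$ acts on $A^*$ by $g\mapsto\rho^*(g)^{-1}$, where $\rho^*(g)$ is dual to $\rho(g)$ (i.e. $(\rho^*(g)^{-1}\chi)(x)=\chi(g^{-1}x)$), and $\tilde G=G\ltimes A^*$ is the semidirect product for this action, so $g\chi g^{-1}=\rho^*(g)^{-1}\chi$ in $\tilde G$. Both $G$ and $A^*$ are regarded as subgroups of $\tilde G$. Let $\mathcal{A}$ be a Hopf algebra with coproduct $\Delta$, counit $\varepsilon$ and identity map $I$. A twist for $\mathcal A$ is an invertible $J\in\mathcal A\otimes\mathcal A$ with $(\Delta\otimes I)(J)J_{12}=(I\otimes\Delta)(J)J_{23}$ and $(\varepsilon\otimes I)(J)=(I\otimes\varepsilon)(J)=1$. Then $\mathcal A^J$ denotes the Hopf algebra equal to $\mathcal A$ as an algebra, with coproduct $\Delta^J(x)=J^{-1}\Delta(x)J$. If $(\mathcal A,R)$ is triangular, so is $(\mathcal A^J,J_{21}^{-1}RJ)$, where $J_{21}$ is $J$ with its two tensor factors interchanged; a group algebra carries the R-matrix $1\otimes1$, so $\mathbb{C}[\tilde G]^{J}$ has R-matrix $J_{21}^{-1}J$. A quasitriangular Hopf algebra $(\mathcal A,R)$, with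 $R=\sum_i x_i\otimes y_i$ written in the shortest possible way, is called minimal if $\mathcal A$ is generated by its Hopf subalgebras $\mathrm{span}\{x_i\}$ and $\mathrm{span}\{y_i\}$. *)

theory Defs
  imports Complex_Main "HOL-Library.Poly_Mapping" "HOL-Algebra.Algebra"
begin

section \<open>Complex vector spaces with a basis, and their tensor products\<close>

text \<open>
  Every complex vector space has a basis, so up to isomorphism it is the space of finitely
  supported functions on a set \<open>B\<close>. The tensor product of the spaces on \<open>B\<close> and \<open>C\<close> is then
  the space on \<open>B \<times> C\<close>, with \<open>b \<otimes> c\<close> the basis vector at \<open>(b, c)\<close>.
\<close>

definition free_space :: "'b set \<Rightarrow> ('b \<Rightarrow>\<^sub>0 complex) set" where
  "free_space B = {u. Poly_Mapping.keys u \<subseteq> B}"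

definition smul :: "complex \<Rightarrow> ('b \<Rightarrow>\<^sub>0 complex) \<Rightarrow> ('b \<Rightarrow>\<^sub>0 complex)" where
  "smul c u = Poly_Mapping.map ((*) c) u"

lemma lookup_smul: "Poly_Mapping.lookup (smul c u) b = c * Poly_Mapping.lookup u b"
  by (simp add: smul_def Poly_Mapping.map.rep_eq when_def)

lemma vector_space_smul: "vector_space smul"
  by unfold_locales
    (auto intro!: poly_mapping_eqI simp: lookup_smul lookup_add algebra_simps)

definition bvec :: "'b \<Rightarrow> ('b \<Rightarrow>\<^sub>0 complex)" where
  "bvec b = Poly_Mapping.single b 1"

definition lin_ext :: "('b \<Rightarrow> ('c \<Rightarrow>\<^sub>0 complex)) \<Rightarrow> ('b \<Rightarrow>\<^sub>0 complex) \<Rightarrow> ('c \<Rightarrow>\<^sub>0 complex)" where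
  "lin_ext \<phi> u = (\<Sum>b\<in>Poly_Mapping.keys u. smul (Poly_Mapping.lookup u b) (\<phi> b))"

text \<open>\<open>linear_between B s f\<close>: the restriction of \<open>f\<close> to \<open>free_space B\<close> is linear, where \<open>s\<close> is
  the scalar multiplication of the target.\<close>

definition linear_between ::
    "'b set \<Rightarrow> (complex \<Rightarrow> 'v \<Rightarrow> 'v) \<Rightarrow> (('b \<Rightarrow>\<^sub>0 complex) \<Rightarrow> 'v::ab_group_add) \<Rightarrow> bool" where
  "linear_between B s f \<longleftrightarrow>
     (\<forall>u\<in>free_space B. \<forall>v\<in>free_space B. f (u + v) = f u + f v) \<and>
     (\<forall>c. \<forall>u\<in>free_space B. f (smul c u) = s c (f u))"

definition tensor ::
    "('b \<Rightarrow>\<^sub>0 complex) \<Rightarrow> ('c \<Rightarrow>\<^sub>0 complex) \<Rightarrow> ('b \<times> 'c \<Rightarrow>\<^sub>0 complex)" where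
  "tensor u v = lin_ext (\<lambda>b. lin_ext (\<lambda>c. bvec (b, c)) v) u"

definition tensor_map ::
    "(('b \<Rightarrow>\<^sub>0 complex) \<Rightarrow> ('d \<Rightarrow>\<^sub>0 complex)) \<Rightarrow> (('c \<Rightarrow>\<^sub>0 complex) \<Rightarrow> ('e \<Rightarrow>\<^sub>0 complex)) \<Rightarrow>
     ('b \<times> 'c \<Rightarrow>\<^sub>0 complex) \<Rightarrow> ('d \<times> 'e \<Rightarrow>\<^sub>0 complex)" where
  "tensor_map f g = lin_ext (\<lambda>(b, c). tensor (f (bvec b)) (g (bvec c)))"

definition tensor_flip :: "('b \<times> 'c \<Rightarrow>\<^sub>0 complex) \<Rightarrow> ('c \<times> 'b \<Rightarrow>\<^sub>0 complex)" where
  "tensor_flip = lin_ext (\<lambda>(b, c). bvec (c, b))"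

text \<open>Threefold tensors are bracketed to the right; this is the identification
  \<open>(U \<otimes> V) \<otimes> W = U \<otimes> (V \<otimes> W)\<close>.\<close>

definition tensor_assoc ::
    "(('b \<times> 'c) \<times> 'd \<Rightarrow>\<^sub>0 complex) \<Rightarrow> ('b \<times> 'c \<times> 'd \<Rightarrow>\<^sub>0 complex)" where
  "tensor_assoc = lin_ext (\<lambda>((b, c), d). bvec (b, c, d))"


section \<open>Algebras, bialgebras and Hopf algebras over the complex numbers\<close>

record 'b based_alg = "('b \<Rightarrow>\<^sub>0 complex) monoid" +
  basis :: "'b set"

record 'b bialg = "'b based_alg" +
  comult :: "('b \<Rightarrow>\<^sub>0 complex) \<Rightarrow> ('b \<times> 'b \<Rightarrow>\<^sub>0 complex)"
  counit :: "('b \<Rightarrow>\<^sub>0 complex) \<Rightarrow> complex"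

locale complex_algebra = monoid A for A :: "('b, 'm) based_alg_scheme" (structure) +
  assumes carrier_eq: "carrier A = free_space (basis A)"
    and mult_linear_right: "u \<in> carrier A \<Longrightarrow> linear_between (basis A) smul (\<lambda>v. u \<otimes> v)"
    and mult_linear_left: "v \<in> carrier A \<Longrightarrow> linear_between (basis A) smul (\<lambda>u. u \<otimes> v)"

definition tensor_alg ::
    "('b, 'm) based_alg_scheme \<Rightarrow> ('c, 'n) based_alg_scheme \<Rightarrow> ('b \<times> 'c) based_alg" where
  "tensor_alg A C =
     \<lparr>carrier = free_space (basis A \<times> basis C),
      monoid.mult = (\<lambda>s t. lin_ext (\<lambda>(a, c). lin_ext (\<lambda>(a', c').
                tensor (bvec a \<otimes>\<^bsub>A\<^esub> bvec a') (bvec c \<otimes>\<^bsub>C\<^esub> bvec c')) t) s),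
      one = tensor \<one>\<^bsub>A\<^esub> \<one>\<^bsub>C\<^esub>,
      basis = basis A \<times> basis C\<rparr>"

abbreviation tensor_sq :: "('b, 'm) based_alg_scheme \<Rightarrow> ('b \<times> 'b) based_alg" where
  "tensor_sq A \<equiv> tensor_alg A A"

abbreviation tensor_cube :: "('b, 'm) based_alg_scheme \<Rightarrow> ('b \<times> 'b \<times> 'b) based_alg" where
  "tensor_cube A \<equiv> tensor_alg A (tensor_alg A A)"

definition leg12 :: "('b, 'm) based_alg_scheme \<Rightarrow> ('b \<times> 'b \<Rightarrow>\<^sub>0 complex) \<Rightarrow> ('b \<times> 'b \<times> 'b \<Rightarrow>\<^sub>0 complex)"
  where "leg12 A t = tensor_assoc (tensor t \<one>\<^bsub>A\<^esub>)"

definition leg23 :: "('b, 'm) based_alg_scheme \<Rightarrow> ('b \<times> 'b \<Rightarrow>\<^sub>0 complex) \<Rightarrow> ('b \<times> 'b \<times> 'b \<Rightarrow>\<^sub>0 complex)"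
  where "leg23 A t = tensor \<one>\<^bsub>A\<^esub> t"

definition leg13 :: "('b, 'm) based_alg_scheme \<Rightarrow> ('b \<times> 'b \<Rightarrow>\<^sub>0 complex) \<Rightarrow> ('b \<times> 'b \<times> 'b \<Rightarrow>\<^sub>0 complex)"
  where "leg13 A = lin_ext (\<lambda>(a, b). tensor (bvec a) (tensor \<one>\<^bsub>A\<^esub> (bvec b)))"

definition comult_left :: "('b, 'm) bialg_scheme \<Rightarrow> ('b \<times> 'b \<Rightarrow>\<^sub>0 complex) \<Rightarrow> ('b \<times> 'b \<times> 'b \<Rightarrow>\<^sub>0 complex)"
  where "comult_left H t = tensor_assoc (tensor_map (comult H) id t)"

definition comult_right :: "('b, 'm) bialg_scheme \<Rightarrow> ('b \<times> 'b \<Rightarrow>\<^sub>0 complex) \<Rightarrow> ('b \<times> 'b \<times> 'b \<Rightarrow>\<^sub>0 complex)"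
  where "comult_right H t = tensor_map id (comult H) t"

text \<open>\<open>\<epsilon> \<otimes> I\<close> and \<open>I \<otimes> \<epsilon>\<close>, with \<open>\<complex> \<otimes> A\<close> and \<open>A \<otimes> \<complex>\<close> identified with \<open>A\<close>.\<close>

definition counit_left :: "('b, 'm) bialg_scheme \<Rightarrow> ('b \<times> 'b \<Rightarrow>\<^sub>0 complex) \<Rightarrow> ('b \<Rightarrow>\<^sub>0 complex)"
  where "counit_left H = lin_ext (\<lambda>(a, b). smul (counit H (bvec a)) (bvec b))"

definition counit_right :: "('b, 'm) bialg_scheme \<Rightarrow> ('b \<times> 'b \<Rightarrow>\<^sub>0 complex) \<Rightarrow> ('b \<Rightarrow>\<^sub>0 complex)"
  where "counit_right H = lin_ext (\<lambda>(a, b). smul (counit H (bvec b)) (bvec a))"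

locale bialgebra = complex_algebra H for H :: "('b, 'm) bialg_scheme" (structure) +
  assumes comult_linear: "linear_between (basis H) smul (comult H)"
    and comult_hom: "comult H \<in> hom H (tensor_sq H)"
    and comult_one: "comult H \<one> = \<one>\<^bsub>tensor_sq H\<^esub>"
    and counit_linear: "linear_between (basis H) (*) (counit H)"
    and counit_mult: "u \<in> carrier H \<Longrightarrow> v \<in> carrier H \<Longrightarrow> counit H (u \<otimes> v) = counit H u * counit H v"
    and counit_one: "counit H \<one> = 1"
    and coassoc: "u \<in> carrier H \<Longrightarrow> comult_left H (comult H u) = comult_right H (comult H u)"
    and counit_left_comult: "u \<in> carrier H \<Longrightarrow> counit_left H (comult H u) = u"
    and counit_right_comult: "u \<in> carrier H \<Longrightarrow> counit_right H (comult H u) = u"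

definition mult_map :: "('b, 'm) based_alg_scheme \<Rightarrow> ('b \<times> 'b \<Rightarrow>\<^sub>0 complex) \<Rightarrow> ('b \<Rightarrow>\<^sub>0 complex)" where
  "mult_map A = lin_ext (\<lambda>(a, b). bvec a \<otimes>\<^bsub>A\<^esub> bvec b)"

definition is_antipode ::
    "('b, 'm) bialg_scheme \<Rightarrow> (('b \<Rightarrow>\<^sub>0 complex) \<Rightarrow> ('b \<Rightarrow>\<^sub>0 complex)) \<Rightarrow> bool" where
  "is_antipode H S \<longleftrightarrow>
     S \<in> carrier H \<rightarrow> carrier H \<and>
     linear_between (basis H) smul S \<and>
     (\<forall>u\<in>carrier H. mult_map H (tensor_map S id (comult H u)) = smul (counit H u) \<one>\<^bsub>H\<^esub>) \<and>
     (\<forall>u\<in>carrier H. mult_map H (tensor_map id S (comult H u)) = smul (counit H u) \<one>\<^bsub>H\<^esub>)"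

text \<open>The antipode of a Hopf algebra is determined by its bialgebra structure, so it is
  required to exist rather than stored in the record.\<close>

locale hopf_algebra = bialgebra +
  assumes antipode_exists: "\<exists>S. is_antipode H S"

definition subalgebra :: "('b, 'm) based_alg_scheme \<Rightarrow> ('b \<Rightarrow>\<^sub>0 complex) set \<Rightarrow> bool" where
  "subalgebra A K \<longleftrightarrow>
     K \<subseteq> carrier A \<and> module.subspace smul K \<and> \<one>\<^bsub>A\<^esub> \<in> K \<and>
     (\<forall>u\<in>K. \<forall>v\<in>K. u \<otimes>\<^bsub>A\<^esub> v \<in> K)"

definition hopf_subalgebra :: "('b, 'm) bialg_scheme \<Rightarrow> ('b \<Rightarrow>\<^sub>0 complex) set \<Rightarrow> bool" where
  "hopf_subalgebra H K \<longleftrightarrow>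
     subalgebra H K \<and>
     (\<forall>u\<in>K. comult H u \<in> module.span smul {tensor v w |v w. v \<in> K \<and> w \<in> K}) \<and>
     (\<forall>S. is_antipode H S \<longrightarrow> S ` K \<subseteq> K)"


section \<open>Triangular structures, minimality and twists\<close>

locale quasitriangular_hopf_algebra = hopf_algebra +
  fixes R
  assumes R_unit: "R \<in> Units (tensor_sq H)"
    and R_comult: "u \<in> carrier H \<Longrightarrow>
      R \<otimes>\<^bsub>tensor_sq H\<^esub> comult H u = tensor_flip (comult H u) \<otimes>\<^bsub>tensor_sq H\<^esub> R"
    and R_comult_left: "comult_left H R = leg13 H R \<otimes>\<^bsub>tensor_cube H\<^esub> leg23 H R"
    and R_comult_right: "comult_right H R = leg13 H R \<otimes>\<^bsub>tensor_cube H\<^esub> leg12 H R"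

locale triangular_hopf_algebra = quasitriangular_hopf_algebra +
  assumes R_inv: "inv\<^bsub>tensor_sq H\<^esub> R = tensor_flip R"

definition tensor_decomposition ::
    "('b, 'm) based_alg_scheme \<Rightarrow> ('b \<times> 'b \<Rightarrow>\<^sub>0 complex) \<Rightarrow> nat \<Rightarrow>
     (nat \<Rightarrow> ('b \<Rightarrow>\<^sub>0 complex)) \<Rightarrow> (nat \<Rightarrow> ('b \<Rightarrow>\<^sub>0 complex)) \<Rightarrow> bool" where
  "tensor_decomposition A R n x y \<longleftrightarrow>
     (\<forall>i<n. x i \<in> carrier A \<and> y i \<in> carrier A) \<and> R = (\<Sum>i<n. tensor (x i) (y i))"

definition shortest_decomposition ::
    "('b, 'm) based_alg_scheme \<Rightarrow> ('b \<times> 'b \<Rightarrow>\<^sub>0 complex) \<Rightarrow> nat \<Rightarrow>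
     (nat \<Rightarrow> ('b \<Rightarrow>\<^sub>0 complex)) \<Rightarrow> (nat \<Rightarrow> ('b \<Rightarrow>\<^sub>0 complex)) \<Rightarrow> bool" where
  "shortest_decomposition A R n x y \<longleftrightarrow>
     tensor_decomposition A R n x y \<and>
     (\<forall>m x' y'. tensor_decomposition A R m x' y' \<longrightarrow> n \<le> m)"

text \<open>A shortest decomposition exists for every element of the tensor square. The two spans do
  not depend on its choice.\<close>

locale minimal_quasitriangular_hopf_algebra = quasitriangular_hopf_algebra +
  assumes left_span: "shortest_decomposition H R n x y \<Longrightarrow>
      hopf_subalgebra H (module.span smul (x ` {..<n}))"
    and right_span: "shortest_decomposition H R n x y \<Longrightarrow>
      hopf_subalgebra H (module.span smul (y ` {..<n}))"
    and generated: "shortest_decomposition H R n x y \<Longrightarrow>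
      subalgebra H hull
        (module.span smul (x ` {..<n}) \<union> module.span smul (y ` {..<n})) = carrier H"

definition is_twist :: "('b, 'm) bialg_scheme \<Rightarrow> ('b \<times> 'b \<Rightarrow>\<^sub>0 complex) \<Rightarrow> bool" where
  "is_twist H J \<longleftrightarrow>
     J \<in> Units (tensor_sq H) \<and>
     comult_left H J \<otimes>\<^bsub>tensor_cube H\<^esub> leg12 H J = comult_right H J \<otimes>\<^bsub>tensor_cube H\<^esub> leg23 H J \<and>
     counit_left H J = \<one>\<^bsub>H\<^esub> \<and> counit_right H J = \<one>\<^bsub>H\<^esub>"

definition twisted :: "('b, 'm) bialg_scheme \<Rightarrow> ('b \<times> 'b \<Rightarrow>\<^sub>0 complex) \<Rightarrow> ('b, 'm) bialg_scheme" where
  "twisted H J =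
     H\<lparr>comult := \<lambda>u. inv\<^bsub>tensor_sq H\<^esub> J \<otimes>\<^bsub>tensor_sq H\<^esub> comult H u \<otimes>\<^bsub>tensor_sq H\<^esub> J\<rparr>"

definition group_algebra :: "('g, 'm) monoid_scheme \<Rightarrow> 'g bialg" where
  "group_algebra \<Gamma> =
     \<lparr>carrier = free_space (carrier \<Gamma>),
      monoid.mult = (\<lambda>u v. lin_ext (\<lambda>g. lin_ext (\<lambda>h. bvec (g \<otimes>\<^bsub>\<Gamma>\<^esub> h)) v) u),
      one = bvec \<one>\<^bsub>\<Gamma>\<^esub>,
      basis = carrier \<Gamma>,
      comult = lin_ext (\<lambda>g. bvec (g, g)),
      counit = (\<lambda>u. \<Sum>g\<in>Poly_Mapping.keys u. Poly_Mapping.lookup u g)\<rparr>"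


section \<open>The dual group, the semidirect product and bijective cocycles\<close>

definition nonzero_complex :: "complex monoid" where
  "nonzero_complex = \<lparr>carrier = - {0}, monoid.mult = (*), one = 1\<rparr>"

definition dual_group :: "('a, 'm) monoid_scheme \<Rightarrow> ('a \<Rightarrow> complex) monoid" where
  "dual_group A =
     \<lparr>carrier = hom A nonzero_complex \<inter> extensional (carrier A),
      monoid.mult = (\<lambda>\<chi> \<psi>. \<lambda>x\<in>carrier A. \<chi> x * \<psi> x),
      one = (\<lambda>x\<in>carrier A. 1)\<rparr>"

definition dual_action ::
    "('g, 'm) monoid_scheme \<Rightarrow> ('a, 'n) monoid_scheme \<Rightarrow> ('g \<Rightarrow> 'a \<Rightarrow> 'a) \<Rightarrow> 'g \<Rightarrow>
     ('a \<Rightarrow> complex) \<Rightarrow> ('a \<Rightarrow> complex)" where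
  "dual_action G A \<rho> g \<chi> = (\<lambda>x\<in>carrier A. \<chi> (\<rho> (inv\<^bsub>G\<^esub> g) x))"

text \<open>The pair \<open>(g, \<chi>)\<close> stands for the product \<open>\<chi> g\<close> of the embedded elements, so that
  \<open>(\<chi> g) (\<psi> h) = \<chi> (g \<psi> g\<inverse>) (g h)\<close> with \<open>g \<psi> g\<inverse>\<close> given by the action.\<close>

definition semidirect_dual ::
    "('g, 'm) monoid_scheme \<Rightarrow> ('a, 'n) monoid_scheme \<Rightarrow> ('g \<Rightarrow> 'a \<Rightarrow> 'a) \<Rightarrow>
     ('g \<times> ('a \<Rightarrow> complex)) monoid" where
  "semidirect_dual G A \<rho> =
     \<lparr>carrier = carrier G \<times> carrier (dual_group A),
      monoid.mult = (\<lambda>(g, \<chi>) (h, \<psi>). (g \<otimes>\<^bsub>G\<^esub> h, \<chi> \<otimes>\<^bsub>dual_group A\<^esub> dual_action G A \<rho> g \<psi>)),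
      one = (\<one>\<^bsub>G\<^esub>, \<one>\<^bsub>dual_group A\<^esub>)\<rparr>"

definition emb_group :: "('a, 'n) monoid_scheme \<Rightarrow> 'g \<Rightarrow> 'g \<times> ('a \<Rightarrow> complex)" where
  "emb_group A g = (g, \<one>\<^bsub>dual_group A\<^esub>)"

definition emb_dual :: "('g, 'm) monoid_scheme \<Rightarrow> ('a \<Rightarrow> complex) \<Rightarrow> 'g \<times> ('a \<Rightarrow> complex)" where
  "emb_dual G \<chi> = (\<one>\<^bsub>G\<^esub>, \<chi>)"

definition cocycle ::
    "('g, 'm) monoid_scheme \<Rightarrow> ('a, 'n) monoid_scheme \<Rightarrow> ('g \<Rightarrow> 'a \<Rightarrow> 'a) \<Rightarrow> ('g \<Rightarrow> 'a) \<Rightarrow> bool" where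
  "cocycle G A \<rho> \<pi> \<longleftrightarrow>
     \<pi> \<in> carrier G \<rightarrow> carrier A \<and>
     (\<forall>g\<in>carrier G. \<forall>g'\<in>carrier G. \<pi> (g \<otimes>\<^bsub>G\<^esub> g') = \<pi> g \<otimes>\<^bsub>A\<^esub> \<rho> g (\<pi> g'))"

text \<open>The exponential \<open>e\<^bsup>(x, \<chi>)\<^esup>\<close> of the standard pairing is \<open>\<chi> x\<close>.\<close>

definition cocycle_twist ::
    "('g, 'm) monoid_scheme \<Rightarrow> ('a, 'n) monoid_scheme \<Rightarrow> ('g \<Rightarrow> 'a) \<Rightarrow>
     (('g \<times> ('a \<Rightarrow> complex)) \<times> ('g \<times> ('a \<Rightarrow> complex)) \<Rightarrow>\<^sub>0 complex)" where
  "cocycle_twist G A \<pi> =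
     smul (1 / of_nat (card (carrier A)))
       (\<Sum>x\<in>carrier A. \<Sum>\<chi>\<in>carrier (dual_group A).
          smul (\<chi> x)
            (tensor (bvec (emb_group A (inv_into (carrier G) \<pi> x))) (bvec (emb_dual G \<chi>))))"

definition cocycle_R_matrix ::
    "('g, 'm) monoid_scheme \<Rightarrow> ('a, 'n) monoid_scheme \<Rightarrow> ('g \<Rightarrow> 'a \<Rightarrow> 'a) \<Rightarrow> ('g \<Rightarrow> 'a) \<Rightarrow>
     ('a \<Rightarrow> 'a) \<Rightarrow> (('g \<times> ('a \<Rightarrow> complex)) \<times> ('g \<times> ('a \<Rightarrow> complex)) \<Rightarrow>\<^sub>0 complex)" where
  "cocycle_R_matrix G A \<rho> \<pi> T =
     smul (1 / of_nat (card (carrier A)) ^ 2)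
       (\<Sum>x\<in>carrier A. \<Sum>y\<in>carrier A. \<Sum>\<chi>\<in>carrier (dual_group A). \<Sum>\<psi>\<in>carrier (dual_group A).
          smul (\<psi> x / \<chi> y)
            (tensor
              (bvec (emb_dual G \<chi> \<otimes>\<^bsub>semidirect_dual G A \<rho>\<^esub>
                     emb_group A (inv_into (carrier G) \<pi> x)))
              (bvec (emb_group A (inv_into (carrier G) \<pi> (T y)) \<otimes>\<^bsub>semidirect_dual G A \<rho>\<^esub>
                     emb_dual G \<psi>))))"

end

theory Submission
  imports Defs
begin

text \<open>
  Write \<open>p\<close> for the inverse of \<open>\<pi>\<close>, and put \<open>e\<^sub>x = |A|\<inverse> \<Sum>\<^sub>\<chi> \<chi>(x) \<chi>\<close> in the group algebra of the dual
  group. Since the characters of \<open>A\<close> separate its points, the \<open>e\<^sub>x\<close> are orthogonal idempotents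
  with sum \<open>1\<close>. They satisfy \<open>\<chi> e\<^sub>x = \<chi>(x)\<inverse> e\<^sub>x\<close>, \<open>g e\<^sub>x = e\<^bsub>gx\<^esub> g\<close> and
  \<open>\<Delta>(e\<^sub>x) (1 \<otimes> e\<^sub>w) = e\<^bsub>x/w\<^esub> \<otimes> e\<^sub>w\<close>. In these terms \<open>J = \<Sum>\<^sub>g g \<otimes> e\<^bsub>\<pi>(g)\<^esub>\<close>, which makes everything
  computable. The inverse is \<open>\<Sum>\<^sub>g g\<inverse> \<otimes> e\<^bsub>\<pi>(g)\<^esub>\<close>, and both sides of the twist equation equal
  \<open>\<Sum>\<^bsub>g,h\<^esub> gh \<otimes> g e\<^bsub>\<pi>(h)\<^esub> \<otimes> e\<^bsub>\<pi>(g)\<^esub>\<close>; on the right-hand side this uses \<open>\<pi>(gh) / \<pi>(g) = g \<pi>(h)\<close>,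
  which is the cocycle identity (\<open>cocycle_twist_equation\<close>).

  That \<open>\<complex>[\<Gamma>]\<^sup>J\<close> is a triangular Hopf algebra with \<open>R = J\<^bsub>21\<^esub>\<inverse> J\<close> holds for every group \<open>\<Gamma>\<close> and every
  twist \<open>J\<close> of its group algebra (\<open>twisted_triangular\<close>). The tensor powers of \<open>\<complex>[\<Gamma>]\<close> are the
  group algebras of the powers of \<open>\<Gamma>\<close>, and the coproduct, the flip and the insertions of a unit
  are induced by homomorphisms between these powers. Hence the twist equation can be transported
  along any permutation of the three tensor factors. Each hexagon identity follows from the twist
  equation and two of its permuted forms, where the cocommutativity of \<open>\<complex>[\<Gamma>]\<close> makes a term of one
  coincide with a term of the other. The new antipode is \<open>u \<mapsto> P S(u) Q\<close> with \<open>Q = m(S \<otimes> I)(J)\<close>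
  and \<open>P = m(I \<otimes> S)(J\<inverse>)\<close>.

  For the twist of a cocycle one gets \<open>R = \<Sum>\<^bsub>g,h\<^esub> e\<^bsub>\<pi>(g)\<^esub> h \<otimes> g\<inverse> e\<^bsub>\<pi>(h)\<^esub>\<close> (\<open>R_expansion\<close>). Expanding the
  idempotents gives the stated formula; the map \<open>T\<close> appears because \<open>p(T(y))\<close> is the inverse of
  \<open>p(y\<inverse>)\<close>. The elements \<open>e\<^bsub>\<pi>(g)\<^esub> h\<close>, and likewise the elements \<open>g\<inverse> e\<^bsub>\<pi>(h)\<^esub>\<close>, form a basis of the group
  algebra, so \<open>R\<close> has full rank: in every decomposition \<open>R = \<Sum>\<^sub>i x\<^sub>i \<otimes> y\<^sub>i\<close> the \<open>x\<^sub>i\<close> span the whole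
  algebra, and so do the \<open>y\<^sub>i\<close>. Minimality is then immediate (\<open>R_minimal\<close>).
\<close>

section \<open>Linear maps between free spaces\<close>

interpretation free: vector_space "smul :: complex \<Rightarrow> ('b \<Rightarrow>\<^sub>0 complex) \<Rightarrow> _"
  by (rule vector_space_smul)

abbreviation linear_map :: "(('b \<Rightarrow>\<^sub>0 complex) \<Rightarrow> ('c \<Rightarrow>\<^sub>0 complex)) \<Rightarrow> bool" where
  "linear_map f \<equiv> Vector_Spaces.linear smul smul f"

lemma linear_mapI:
  assumes "\<And>u v. f (u + v) = f u + f v" and "\<And>c u. f (smul c u) = smul c (f u)"
  shows "linear_map f"
  using assms by unfold_locales

lemma linear_map_add: "linear_map f \<Longrightarrow> f (u + v) = f u + f v"
  and linear_map_smul: "linear_map f \<Longrightarrow> f (smul c u) = smul c (f u)"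
  and linear_map_sum: "linear_map f \<Longrightarrow> f (\<Sum>i\<in>I. h i) = (\<Sum>i\<in>I. f (h i))"
  unfolding Vector_Spaces.linear_def
  by (blast intro: module_hom.add module_hom.scale module_hom.sum)+

lemma free_space_iff: "u \<in> free_space B \<longleftrightarrow> (\<forall>b. b \<notin> B \<longrightarrow> Poly_Mapping.lookup u b = 0)"
  by (auto simp: free_space_def in_keys_iff)

lemma free_space_subspace: "free.subspace (free_space B)"
  by (rule free.subspaceI) (auto simp: free_space_iff lookup_smul lookup_add)

lemma free_space_smul: "u \<in> free_space B \<Longrightarrow> smul c u \<in> free_space B"
  and free_space_sum: "(\<And>i. i \<in> I \<Longrightarrow> h i \<in> free_space B) \<Longrightarrow> (\<Sum>i\<in>I. h i) \<in> free_space B"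
  using free_space_subspace[of B]
  by (auto simp: free.subspace_scale intro!: free.subspace_sum)

lemma bvec_in_free_space [simp]: "bvec b \<in> free_space B \<longleftrightarrow> b \<in> B"
  by (simp add: free_space_def bvec_def)

lemma free_space_UNIV [simp]: "u \<in> free_space UNIV"
  by (simp add: free_space_def)

lemma lookup_bvec: "Poly_Mapping.lookup (bvec b) c = (if b = c then 1 else 0)"
  by (simp add: bvec_def lookup_single when_def)

lemma basis_expansion:
  "u = (\<Sum>b\<in>Poly_Mapping.keys u. smul (Poly_Mapping.lookup u b) (bvec b))"
proof (rule poly_mapping_eqI)
  fix c
  show "Poly_Mapping.lookup u c =
      Poly_Mapping.lookup (\<Sum>b\<in>Poly_Mapping.keys u. smul (Poly_Mapping.lookup u b) (bvec b)) c"
    by (simp add: lookup_sum lookup_smul lookup_bvec in_keys_iff sum.delta'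
        if_distrib[of "\<lambda>x. _ * x"] cong: if_cong)
qed

lemma linear_map_eqI:
  assumes "linear_map f" and "linear_map g" and "u \<in> free_space B"
    and "\<And>b. b \<in> B \<Longrightarrow> f (bvec b) = g (bvec b)"
  shows "f u = g u"
proof -
  have "f u = (\<Sum>b\<in>Poly_Mapping.keys u. smul (Poly_Mapping.lookup u b) (f (bvec b)))"
    by (subst basis_expansion[of u]) (simp add: linear_map_sum linear_map_smul assms(1))
  also have "\<dots> = (\<Sum>b\<in>Poly_Mapping.keys u. smul (Poly_Mapping.lookup u b) (g (bvec b)))"
    using assms(3,4) by (intro sum.cong) (auto simp: free_space_def)
  also have "\<dots> = g u"
    by (subst (2) basis_expansion[of u]) (simp add: linear_map_sum linear_map_smul assms(2))
  finally show ?thesis .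
qed

lemma bilinear_map_eqI:
  assumes "u \<in> free_space B" and "v \<in> free_space C"
    and "\<And>v. linear_map (\<lambda>u. f u v)" and "\<And>u. linear_map (f u)"
    and "\<And>v. linear_map (\<lambda>u. g u v)" and "\<And>u. linear_map (g u)"
    and "\<And>b c. b \<in> B \<Longrightarrow> c \<in> C \<Longrightarrow> f (bvec b) (bvec c) = g (bvec b) (bvec c)"
  shows "f u v = g u v"
proof -
  have "f u (bvec c) = g u (bvec c)" if "c \<in> C" for c
    using linear_map_eqI[of "\<lambda>u. f u (bvec c)" "\<lambda>u. g u (bvec c)"] assms that by blast
  then show ?thesis
    using linear_map_eqI[of "f u" "g u"] assms by blast
qed

lemma lin_ext_superset:
  assumes "finite B" and "Poly_Mapping.keys u \<subseteq> B"
  shows "lin_ext \<phi> u = (\<Sum>b\<in>B. smul (Poly_Mapping.lookup u b) (\<phi> b))"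
  unfolding lin_ext_def using assms by (intro sum.mono_neutral_left) (auto simp: in_keys_iff)

lemma linear_lin_ext: "linear_map (lin_ext \<phi>)"
proof (rule linear_mapI)
  fix u v :: "'a \<Rightarrow>\<^sub>0 complex" and c
  have fin: "finite (Poly_Mapping.keys u \<union> Poly_Mapping.keys v)" by simp
  show "lin_ext \<phi> (u + v) = lin_ext \<phi> u + lin_ext \<phi> v"
    using Poly_Mapping.keys_add[of u v]
    by (subst (1 2 3) lin_ext_superset[OF fin])
      (auto simp: lookup_add free.scale_left_distrib sum.distrib)
  show "lin_ext \<phi> (smul c u) = smul c (lin_ext \<phi> u)"
    by (subst (1 2) lin_ext_superset[of "Poly_Mapping.keys u"])
      (auto simp: lookup_smul in_keys_iff free.scale_sum_right)
qed

lemma lin_ext_bvec [simp]: "lin_ext \<phi> (bvec b) = \<phi> b"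
  by (simp add: lin_ext_def bvec_def)

lemma lin_ext_closed:
  assumes "u \<in> free_space B" and "\<And>b. b \<in> B \<Longrightarrow> \<phi> b \<in> free_space C"
  shows "lin_ext \<phi> u \<in> free_space C"
  unfolding lin_ext_def using assms
  by (auto simp: free_space_def[of B] intro!: free_space_sum free_space_smul)

text \<open>A map built by composition from linear pieces is linear by the rules collected here; the
  equality of two such maps then needs to be checked on basis vectors only.\<close>

named_theorems linear_intros

lemma linear_map_id [linear_intros]: "linear_map (\<lambda>u. u)"
  by (rule linear_mapI) auto

lemma linear_map_lin_ext [linear_intros]:
  assumes "linear_map f"
  shows "linear_map (\<lambda>u. lin_ext \<phi> (f u))"
  by (rule linear_mapI)
    (simp_all add: linear_map_add[OF assms] linear_map_smul[OF assms]
      linear_map_add[OF linear_lin_ext] linear_map_smul[OF linear_lin_ext])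

lemma linear_map_lin_ext_param [linear_intros]:
  assumes "\<And>b. linear_map (\<lambda>u. \<phi> u b)"
  shows "linear_map (\<lambda>u. lin_ext (\<phi> u) v)"
  by (rule linear_mapI)
    (simp_all add: lin_ext_def linear_map_add[OF assms] linear_map_smul[OF assms]
      free.scale_right_distrib sum.distrib free.scale_sum_right mult.commute)

lemma linear_map_tensor_left [linear_intros]:
  assumes "linear_map f"
  shows "linear_map (\<lambda>u. tensor (f u) v)"
  unfolding tensor_def by (intro linear_intros assms)

lemma linear_map_tensor_right [linear_intros]:
  assumes "linear_map f"
  shows "linear_map (\<lambda>u. tensor v (f u))"
  unfolding tensor_def by (intro linear_intros assms)

lemma tensor_bvec [simp]: "tensor (bvec b) (bvec c) = bvec (b, c)"
  by (simp add: tensor_def)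

lemma tensor_closed:
  "u \<in> free_space B \<Longrightarrow> v \<in> free_space C \<Longrightarrow> tensor u v \<in> free_space (B \<times> C)"
  unfolding tensor_def by (auto intro!: lin_ext_closed)

lemma tensor_smul_left: "tensor (smul c u) v = smul c (tensor u v)"
  and tensor_sum_left: "tensor (\<Sum>i\<in>I. h i) v = (\<Sum>i\<in>I. tensor (h i) v)"
  using linear_map_tensor_left[OF linear_map_id, of v]
  by (auto dest: linear_map_smul linear_map_sum)

lemma tensor_smul_right: "tensor u (smul c v) = smul c (tensor u v)"
  and tensor_sum_right: "tensor u (\<Sum>i\<in>I. h i) = (\<Sum>i\<in>I. tensor u (h i))"
  using linear_map_tensor_right[OF linear_map_id, of u]
  by (auto dest: linear_map_smul linear_map_sum)

section \<open>Slices of tensors\<close>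

lemma span_subset_free_space: "V \<subseteq> free_space B \<Longrightarrow> free.span V \<subseteq> free_space B"
  by (rule free.span_minimal[OF _ free_space_subspace])

lemma free_space_subset_span:
  assumes "\<And>b. b \<in> B \<Longrightarrow> bvec b \<in> free.span V"
  shows "free_space B \<subseteq> free.span V"
proof
  fix u assume "u \<in> free_space B"
  then have "Poly_Mapping.keys u \<subseteq> B" by (simp add: free_space_def)
  then show "u \<in> free.span V"
    using assms by (subst basis_expansion[of u]) (auto intro!: free.span_sum free.span_scale)
qed

lemma tensor_zero_right: "tensor u 0 = 0"
  using tensor_smul_right[of u 0 0] by simp

text \<open>
  Contraction with a linear functional. Every functional used below is a coefficient of the
  image under a linear map, so the functional is given as the map \<open>F\<close> and the index \<open>d\<close>.
\<close>

definition slice_right ::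
    "(('c \<Rightarrow>\<^sub>0 complex) \<Rightarrow> ('d \<Rightarrow>\<^sub>0 complex)) \<Rightarrow> 'd \<Rightarrow> ('b \<times> 'c \<Rightarrow>\<^sub>0 complex) \<Rightarrow> ('b \<Rightarrow>\<^sub>0 complex)"
  where "slice_right F d =
    lin_ext (\<lambda>p. smul (Poly_Mapping.lookup (F (bvec (snd p))) d) (bvec (fst p)))"

definition slice_left ::
    "(('b \<Rightarrow>\<^sub>0 complex) \<Rightarrow> ('d \<Rightarrow>\<^sub>0 complex)) \<Rightarrow> 'd \<Rightarrow> ('b \<times> 'c \<Rightarrow>\<^sub>0 complex) \<Rightarrow> ('c \<Rightarrow>\<^sub>0 complex)"
  where "slice_left F d =
    lin_ext (\<lambda>p. smul (Poly_Mapping.lookup (F (bvec (fst p))) d) (bvec (snd p)))"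

lemma linear_map_coefficient:
  assumes "linear_map F"
  shows "linear_map (\<lambda>v. smul (Poly_Mapping.lookup (F v) d) u)"
  by (rule linear_mapI) (simp_all add: linear_map_add[OF assms] linear_map_smul[OF assms]
      lookup_add lookup_smul free.scale_left_distrib)

lemma slice_tensor:
  assumes F: "linear_map F"
  shows "slice_right F d (tensor u v) = smul (Poly_Mapping.lookup (F v) d) u"
  by (rule bilinear_map_eqI[of u UNIV v UNIV, where f = "\<lambda>u v. slice_right F d (tensor u v)"
        and g = "\<lambda>u v. smul (Poly_Mapping.lookup (F v) d) u"];
      (intro linear_map_coefficient[OF F])?)
    (auto simp: slice_right_def intro!: linear_intros)

lemma slice_left_tensor:
  assumes F: "linear_map F"
  shows "slice_left F d (tensor u v) = smul (Poly_Mapping.lookup (F u) d) v"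
  by (rule bilinear_map_eqI[of u UNIV v UNIV, where f = "\<lambda>u v. slice_left F d (tensor u v)"
        and g = "\<lambda>u v. smul (Poly_Mapping.lookup (F u) d) v"];
      (intro linear_map_coefficient[OF F])?)
    (auto simp: slice_left_def intro!: linear_intros)

lemma slice_sum:
  "slice_right F d (\<Sum>i\<in>I. h i) = (\<Sum>i\<in>I. slice_right F d (h i))"
  "slice_left F d (\<Sum>i\<in>I. k i) = (\<Sum>i\<in>I. slice_left F d (k i))"
  unfolding slice_right_def slice_left_def by (simp_all add: linear_map_sum[OF linear_lin_ext])

text \<open>
  Applying a linear functional to one factor of \<open>\<Sum>\<^sub>i x\<^sub>i \<otimes> y\<^sub>i\<close> leaves a combination of the elements
  in the other factor. This bounds the spans of a decomposition from below.
\<close>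

lemma slice_in_span:
  assumes "tensor_decomposition U t n x y"
  shows "linear_map F \<Longrightarrow> slice_right F d t \<in> free.span (x ` {..<n})"
    and "linear_map F' \<Longrightarrow> slice_left F' d' t \<in> free.span (y ` {..<n})"
proof -
  have t: "t = (\<Sum>i<n. tensor (x i) (y i))"
    using assms by (simp add: tensor_decomposition_def)
  show "slice_right F d t \<in> free.span (x ` {..<n})" if "linear_map F"
    unfolding t slice_sum slice_tensor[OF that]
    by (rule free.span_sum, rule free.span_scale, rule free.span_base) simp
  show "slice_left F' d' t \<in> free.span (y ` {..<n})" if "linear_map F'"
    unfolding t slice_sum slice_left_tensor[OF that]
    by (rule free.span_sum, rule free.span_scale, rule free.span_base) simp
qed

section \<open>Group algebras and the maps induced by maps of groups\<close>

notation group_algebra ("\<complex>[_]")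

text \<open>
  The group algebra is a functor, and \<open>push\<close> is its action on maps. Almost all structure maps
  of a group algebra are of this form.
\<close>

definition push :: "('b \<Rightarrow> 'c) \<Rightarrow> ('b \<Rightarrow>\<^sub>0 complex) \<Rightarrow> ('c \<Rightarrow>\<^sub>0 complex)" where
  "push f = lin_ext (\<lambda>b. bvec (f b))"

lemma push_bvec [simp]: "push f (bvec b) = bvec (f b)"
  by (simp add: push_def)

lemma linear_map_push [linear_intros]: "linear_map h \<Longrightarrow> linear_map (\<lambda>u. push f (h u))"
  unfolding push_def by (intro linear_intros)

lemma push_closed: "u \<in> free_space B \<Longrightarrow> f \<in> B \<rightarrow> C \<Longrightarrow> push f u \<in> free_space C"
  unfolding push_def by (auto intro!: lin_ext_closed)

lemma push_push: "push f (push g u) = push (\<lambda>b. f (g b)) u"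
  by (rule linear_map_eqI[where B = UNIV])
    (auto intro!: linear_intros simp: free_space_def)

lemma push_id: "push (\<lambda>b. b) u = u"
  by (rule linear_map_eqI[where B = UNIV])
    (auto intro!: linear_intros simp: free_space_def)

lemma push_sum: "push f (\<Sum>i\<in>I. h i) = (\<Sum>i\<in>I. push f (h i))"
  and push_smul: "push f (smul c u) = smul c (push f u)"
  using linear_map_push[OF linear_map_id, of f] by (auto dest: linear_map_sum linear_map_smul)

lemma group_algebra_simps [simp]:
  "carrier \<complex>[\<Gamma>] = free_space (carrier \<Gamma>)"
  "basis \<complex>[\<Gamma>] = carrier \<Gamma>"
  "\<one>\<^bsub>\<complex>[\<Gamma>]\<^esub> = bvec \<one>\<^bsub>\<Gamma>\<^esub>"
  "comult \<complex>[\<Gamma>] = push (\<lambda>g. (g, g))"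
  by (simp_all add: group_algebra_def push_def)

lemma mult_bvec [simp]: "bvec g \<otimes>\<^bsub>\<complex>[\<Gamma>]\<^esub> bvec h = bvec (g \<otimes>\<^bsub>\<Gamma>\<^esub> h)"
  by (simp add: group_algebra_def)

lemma linear_map_mult_left [linear_intros]:
  "linear_map f \<Longrightarrow> linear_map (\<lambda>u. f u \<otimes>\<^bsub>\<complex>[\<Gamma>]\<^esub> v)"
  unfolding group_algebra_def by (auto intro!: linear_intros)

lemma linear_map_mult_right [linear_intros]:
  "linear_map f \<Longrightarrow> linear_map (\<lambda>u. v \<otimes>\<^bsub>\<complex>[\<Gamma>]\<^esub> f u)"
  unfolding group_algebra_def by (auto intro!: linear_intros)

lemma mult_smul_left: "smul c u \<otimes>\<^bsub>\<complex>[\<Gamma>]\<^esub> v = smul c (u \<otimes>\<^bsub>\<complex>[\<Gamma>]\<^esub> v)"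
  and mult_sum_left: "(\<Sum>i\<in>I. h i) \<otimes>\<^bsub>\<complex>[\<Gamma>]\<^esub> v = (\<Sum>i\<in>I. h i \<otimes>\<^bsub>\<complex>[\<Gamma>]\<^esub> v)"
  using linear_map_mult_left[OF linear_map_id, of \<Gamma> v]
  by (auto dest: linear_map_smul linear_map_sum)

lemma mult_smul_right: "u \<otimes>\<^bsub>\<complex>[\<Gamma>]\<^esub> smul c v = smul c (u \<otimes>\<^bsub>\<complex>[\<Gamma>]\<^esub> v)"
  and mult_sum_right: "u \<otimes>\<^bsub>\<complex>[\<Gamma>]\<^esub> (\<Sum>i\<in>I. h i) = (\<Sum>i\<in>I. u \<otimes>\<^bsub>\<complex>[\<Gamma>]\<^esub> h i)"
  using linear_map_mult_right[OF linear_map_id, of \<Gamma> u]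
  by (auto dest: linear_map_smul linear_map_sum)

lemma linear_map_between: "linear_map f \<Longrightarrow> linear_between B smul f"
  by (simp add: linear_between_def linear_map_add linear_map_smul)

lemma (in monoid) group_algebra_mult_closed:
  "u \<in> free_space (carrier G) \<Longrightarrow> v \<in> free_space (carrier G) \<Longrightarrow>
    u \<otimes>\<^bsub>\<complex>[G]\<^esub> v \<in> free_space (carrier G)"
  by (auto simp: group_algebra_def intro!: lin_ext_closed)

lemma (in monoid) monoid_group_algebra: "monoid \<complex>[G]"
proof (rule monoidI)
  fix u v w assume uvw: "u \<in> carrier \<complex>[G]" "v \<in> carrier \<complex>[G]" "w \<in> carrier \<complex>[G]"
  have "u \<otimes>\<^bsub>\<complex>[G]\<^esub> v \<otimes>\<^bsub>\<complex>[G]\<^esub> bvec c = u \<otimes>\<^bsub>\<complex>[G]\<^esub> (v \<otimes>\<^bsub>\<complex>[G]\<^esub> bvec c)"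
    if "c \<in> carrier G" for c
    by (rule bilinear_map_eqI[where B = "carrier G" and C = "carrier G"
          and f = "\<lambda>u v. u \<otimes>\<^bsub>\<complex>[G]\<^esub> v \<otimes>\<^bsub>\<complex>[G]\<^esub> bvec c"
          and g = "\<lambda>u v. u \<otimes>\<^bsub>\<complex>[G]\<^esub> (v \<otimes>\<^bsub>\<complex>[G]\<^esub> bvec c)"])
      (use uvw that in \<open>auto intro!: linear_intros simp: m_assoc\<close>)
  then show "u \<otimes>\<^bsub>\<complex>[G]\<^esub> v \<otimes>\<^bsub>\<complex>[G]\<^esub> w = u \<otimes>\<^bsub>\<complex>[G]\<^esub> (v \<otimes>\<^bsub>\<complex>[G]\<^esub> w)"
    using uvw
    by (intro linear_map_eqI[where B = "carrier G" and u = w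
          and f = "\<lambda>w. u \<otimes>\<^bsub>\<complex>[G]\<^esub> v \<otimes>\<^bsub>\<complex>[G]\<^esub> w"
          and g = "\<lambda>w. u \<otimes>\<^bsub>\<complex>[G]\<^esub> (v \<otimes>\<^bsub>\<complex>[G]\<^esub> w)"])
      (auto intro!: linear_intros)
next
  fix u assume u: "u \<in> carrier \<complex>[G]"
  show "\<one>\<^bsub>\<complex>[G]\<^esub> \<otimes>\<^bsub>\<complex>[G]\<^esub> u = u" "u \<otimes>\<^bsub>\<complex>[G]\<^esub> \<one>\<^bsub>\<complex>[G]\<^esub> = u"
    by (rule linear_map_eqI[where B = "carrier G" and u = u];
        use u in \<open>auto intro!: linear_intros\<close>)+
qed (auto intro: group_algebra_mult_closed)

lemma (in monoid) complex_algebra_group_algebra: "complex_algebra \<complex>[G]"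
  by (intro complex_algebra.intro monoid_group_algebra complex_algebra_axioms.intro)
    (auto intro!: linear_map_between linear_intros)

text \<open>
  A group homomorphism induces an algebra homomorphism. This is the source of every
  multiplicativity statement about coproducts, flips and legs below.
\<close>

lemma push_mult:
  assumes "u \<in> free_space (carrier \<Gamma>)" and "v \<in> free_space (carrier \<Gamma>)"
    and "f \<in> hom \<Gamma> \<Delta>"
  shows "push f (u \<otimes>\<^bsub>\<complex>[\<Gamma>]\<^esub> v) = push f u \<otimes>\<^bsub>\<complex>[\<Delta>]\<^esub> push f v"
  by (rule bilinear_map_eqI[OF assms(1,2)])
    (use assms(3) in \<open>auto intro!: linear_intros simp: hom_mult\<close>)

lemma push_unit:
  assumes "monoid \<Gamma>" and "monoid \<Delta>" and "u \<in> Units \<complex>[\<Gamma>]"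
    and f: "f \<in> hom \<Gamma> \<Delta>" "f \<one>\<^bsub>\<Gamma>\<^esub> = \<one>\<^bsub>\<Delta>\<^esub>"
  shows "push f u \<in> Units \<complex>[\<Delta>]" and "push f (inv\<^bsub>\<complex>[\<Gamma>]\<^esub> u) = inv\<^bsub>\<complex>[\<Delta>]\<^esub> push f u"
proof -
  interpret \<Gamma>: monoid "\<complex>[\<Gamma>]" using assms(1) by (rule monoid.monoid_group_algebra)
  interpret \<Delta>: monoid "\<complex>[\<Delta>]" using assms(2) by (rule monoid.monoid_group_algebra)
  let ?v = "inv\<^bsub>\<complex>[\<Gamma>]\<^esub> u"
  have uv: "u \<in> free_space (carrier \<Gamma>)" "?v \<in> free_space (carrier \<Gamma>)"
    using assms(3) \<Gamma>.Units_closed \<Gamma>.Units_inv_closed by fastforce+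
  have cl: "push f u \<in> carrier \<complex>[\<Delta>]" "push f ?v \<in> carrier \<complex>[\<Delta>]"
    using f(1) uv by (auto simp: hom_def intro: push_closed)
  have "push f u \<otimes>\<^bsub>\<complex>[\<Delta>]\<^esub> push f ?v = \<one>\<^bsub>\<complex>[\<Delta>]\<^esub>" "push f ?v \<otimes>\<^bsub>\<complex>[\<Delta>]\<^esub> push f u = \<one>\<^bsub>\<complex>[\<Delta>]\<^esub>"
    using push_mult[OF uv(1,2) f(1)] push_mult[OF uv(2,1) f(1)] f(2) assms(3) by auto
  then show "push f u \<in> Units \<complex>[\<Delta>]" "push f ?v = inv\<^bsub>\<complex>[\<Delta>]\<^esub> push f u"
    using cl \<Delta>.inv_char[of "push f u" "push f ?v"] unfolding Units_def by auto
qed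

text \<open>The tensor product of group algebras is the group algebra of the direct product, up to
  the coalgebra structure of the latter.\<close>

text \<open>
  The type of algebras without a coalgebra structure is reached from that of bialgebras by
  truncation, which changes none of the algebra operations.
\<close>

lemma truncate_simps [simp]:
  "carrier (based_alg.truncate U) = carrier U"
  "monoid.mult (based_alg.truncate U) = monoid.mult U"
  "\<one>\<^bsub>based_alg.truncate U\<^esub> = \<one>\<^bsub>U\<^esub>"
  "basis (based_alg.truncate U) = basis U"
  "Units (based_alg.truncate U) = Units U"
  "m_inv (based_alg.truncate U) = m_inv U"
  "hom V (based_alg.truncate U) = hom V U"
proof -
  show *: "carrier (based_alg.truncate U) = carrier U"
    "monoid.mult (based_alg.truncate U) = monoid.mult U"
    "\<one>\<^bsub>based_alg.truncate U\<^esub> = \<one>\<^bsub>U\<^esub>"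
    "basis (based_alg.truncate U) = basis U"
    by (simp_all add: based_alg.defs)
  show "Units (based_alg.truncate U) = Units U" "hom V (based_alg.truncate U) = hom V U"
    by (simp_all only: Units_def hom_def *)
  show "m_inv (based_alg.truncate U) = m_inv U"
    by (rule ext) (simp only: m_inv_def *)
qed

lemma tensor_alg_group_algebra [simp]:
  "tensor_alg \<complex>[\<Gamma>] \<complex>[\<Delta>] = based_alg.truncate \<complex>[\<Gamma> \<times>\<times> \<Delta>]"
proof -
  have "(\<lambda>(a', c'). tensor (bvec a \<otimes>\<^bsub>\<complex>[\<Gamma>]\<^esub> bvec a') (bvec c \<otimes>\<^bsub>\<complex>[\<Delta>]\<^esub> bvec c')) =
      (\<lambda>h. bvec ((a, c) \<otimes>\<^bsub>\<Gamma> \<times>\<times> \<Delta>\<^esub> h))" for a c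
    by (rule ext) (simp split: prod.split)
  then have "(\<lambda>(a, c). lin_ext (\<lambda>(a', c').
        tensor (bvec a \<otimes>\<^bsub>\<complex>[\<Gamma>]\<^esub> bvec a') (bvec c \<otimes>\<^bsub>\<complex>[\<Delta>]\<^esub> bvec c')) t) =
      (\<lambda>g. lin_ext (\<lambda>h. bvec (g \<otimes>\<^bsub>\<Gamma> \<times>\<times> \<Delta>\<^esub> h)) t)" for t
    by (intro ext) (simp split: prod.split)
  then show ?thesis
    by (simp add: tensor_alg_def based_alg.defs(4)) (simp add: group_algebra_def)
qed

lemma tensor_alg_truncate [simp]: "tensor_alg U (based_alg.truncate V) = tensor_alg U V"
  by (simp add: tensor_alg_def)

lemma tensor_mult:
  assumes "u \<in> free_space (carrier \<Gamma>)" "u' \<in> free_space (carrier \<Gamma>)"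
    and "v \<in> free_space (carrier \<Delta>)" "v' \<in> free_space (carrier \<Delta>)"
  shows "tensor u v \<otimes>\<^bsub>\<complex>[\<Gamma> \<times>\<times> \<Delta>]\<^esub> tensor u' v' =
    tensor (u \<otimes>\<^bsub>\<complex>[\<Gamma>]\<^esub> u') (v \<otimes>\<^bsub>\<complex>[\<Delta>]\<^esub> v')"
proof -
  let ?f = "\<lambda>u u' v v'. tensor u v \<otimes>\<^bsub>\<complex>[\<Gamma> \<times>\<times> \<Delta>]\<^esub> tensor u' v'"
  let ?g = "\<lambda>u u' v v'. tensor (u \<otimes>\<^bsub>\<complex>[\<Gamma>]\<^esub> u') (v \<otimes>\<^bsub>\<complex>[\<Delta>]\<^esub> v')"
  have "?f u u' (bvec d) (bvec d') = ?g u u' (bvec d) (bvec d')" for d d'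
    by (rule bilinear_map_eqI[OF assms(1,2), where f = "\<lambda>u u'. ?f u u' (bvec d) (bvec d')"
          and g = "\<lambda>u u'. ?g u u' (bvec d) (bvec d')"]; (intro linear_intros)?) simp
  then show ?thesis
    by (intro bilinear_map_eqI[OF assms(3,4), where f = "?f u u'" and g = "?g u u'"];
        (intro linear_intros)?)
qed

section \<open>The Hopf algebra structure of a group algebra\<close>

lemma tensor_flip_push: "tensor_flip = push (\<lambda>(b, c). (c, b))"
  unfolding tensor_flip_def push_def by (auto intro!: arg_cong[of _ _ lin_ext])

lemma tensor_assoc_push: "tensor_assoc = push (\<lambda>((b, c), d). (b, c, d))"
  unfolding tensor_assoc_def push_def by (auto intro!: arg_cong[of _ _ lin_ext])

lemma tensor_bvec_left: "tensor (bvec b) v = push (\<lambda>c. (b, c)) v"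
  by (rule linear_map_eqI[where B = UNIV]) (auto intro!: linear_intros)

lemma tensor_bvec_right: "tensor u (bvec c) = push (\<lambda>b. (b, c)) u"
  by (rule linear_map_eqI[where B = UNIV and u = u]) (auto intro!: linear_intros)

lemma leg_push:
  "leg12 \<complex>[\<Gamma>] = push (\<lambda>(a, b). (a, b, \<one>\<^bsub>\<Gamma>\<^esub>))"
  "leg23 \<complex>[\<Gamma>] = push (\<lambda>(a, b). (\<one>\<^bsub>\<Gamma>\<^esub>, a, b))"
  "leg13 \<complex>[\<Gamma>] = push (\<lambda>(a, b). (a, \<one>\<^bsub>\<Gamma>\<^esub>, b))"
  by (rule ext, simp add: leg12_def tensor_assoc_push tensor_bvec_right push_push case_prod_unfold)
    (rule ext, simp add: leg23_def tensor_bvec_left case_prod_unfold,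
      simp add: leg13_def push_def case_prod_unfold)

lemma comult_legs_push:
  "comult_left \<complex>[\<Gamma>] = push (\<lambda>(a, b). (a, a, b))"
  "comult_right \<complex>[\<Gamma>] = push (\<lambda>(a, b). (a, b, b))"
proof -
  show "comult_left \<complex>[\<Gamma>] = push (\<lambda>(a, b). (a, a, b))"
  proof
    fix t :: "'a \<times> 'a \<Rightarrow>\<^sub>0 complex"
    show "comult_left \<complex>[\<Gamma>] t = push (\<lambda>(a, b). (a, a, b)) t"
      unfolding comult_left_def tensor_map_def tensor_assoc_push
      by (rule linear_map_eqI[where B = UNIV]) (auto intro!: linear_intros)
  qed
  show "comult_right \<complex>[\<Gamma>] = push (\<lambda>(a, b). (a, b, b))"
  proof
    fix t :: "'a \<times> 'a \<Rightarrow>\<^sub>0 complex"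
    show "comult_right \<complex>[\<Gamma>] t = push (\<lambda>(a, b). (a, b, b)) t"
      unfolding comult_right_def tensor_map_def
      by (rule linear_map_eqI[where B = UNIV]) (auto intro!: linear_intros)
  qed
qed

lemma bvec_nonzero [simp]: "bvec b \<noteq> 0"
  by (metis lookup_bvec lookup_zero zero_neq_one)

text \<open>
  The counit is induced by the map to the trivial group; written with an arbitrary target point
  this reduces its properties to those of \<open>push\<close>.
\<close>

lemma counit_push: "smul (counit \<complex>[\<Gamma>] u) (bvec x) = push (\<lambda>_. x) u"
  by (simp add: group_algebra_def push_def lin_ext_def free.scale_sum_left)

lemma counit_lookup: "counit \<complex>[\<Gamma>] u = Poly_Mapping.lookup (push (\<lambda>_. ()) u) ()"
  by (simp flip: counit_push[of \<Gamma>] add: lookup_smul lookup_bvec)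

lemma counit_bvec [simp]: "counit \<complex>[\<Gamma>] (bvec g) = 1"
  by (simp add: counit_lookup lookup_bvec)

lemma counit_legs_push:
  "counit_left \<complex>[\<Gamma>] = push snd"
  "counit_right \<complex>[\<Gamma>] = push fst"
  by (simp_all add: counit_left_def counit_right_def push_def case_prod_unfold)

lemma mult_map_push: "mult_map \<complex>[\<Gamma>] = push (\<lambda>(a, b). a \<otimes>\<^bsub>\<Gamma>\<^esub> b)"
  by (simp add: mult_map_def push_def case_prod_unfold)

lemma mult_map_tensor:
  assumes "u \<in> free_space (carrier \<Gamma>)" and "v \<in> free_space (carrier \<Gamma>)"
  shows "mult_map \<complex>[\<Gamma>] (tensor u v) = u \<otimes>\<^bsub>\<complex>[\<Gamma>]\<^esub> v"
  unfolding mult_map_push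
  by (rule bilinear_map_eqI[OF assms]) (auto intro!: linear_intros)

lemma push_in_hom: "f \<in> hom \<Gamma> \<Delta> \<Longrightarrow> push f \<in> hom \<complex>[\<Gamma>] \<complex>[\<Delta>]"
  by (rule homI) (auto simp: push_mult hom_def intro!: push_closed[where B = "carrier \<Gamma>"])

lemma counit_add: "counit \<complex>[\<Gamma>] (u + v) = counit \<complex>[\<Gamma>] u + counit \<complex>[\<Gamma>] v"
  and counit_smul: "counit \<complex>[\<Gamma>] (smul c u) = c * counit \<complex>[\<Gamma>] u"
  by (simp_all add: counit_lookup lookup_smul push_smul lookup_add
      linear_map_add[OF linear_map_push[OF linear_map_id]])

lemma (in group) bialgebra_group_algebra: "bialgebra \<complex>[G]"
proof (intro bialgebra.intro complex_algebra_group_algebra bialgebra_axioms.intro)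
  show "linear_between (basis \<complex>[G]) smul (comult \<complex>[G])"
    by (auto intro!: linear_map_between linear_intros)
  show "comult \<complex>[G] \<in> hom \<complex>[G] (tensor_sq \<complex>[G])"
    using push_in_hom[of "\<lambda>g. (g, g)" G "G \<times>\<times> G"] by (simp add: hom_def)
  show "comult \<complex>[G] \<one>\<^bsub>\<complex>[G]\<^esub> = \<one>\<^bsub>tensor_sq \<complex>[G]\<^esub>"
    by simp
  show "linear_between (basis \<complex>[G]) (*) (counit \<complex>[G])"
    by (simp add: linear_between_def counit_add counit_smul)
  show "counit \<complex>[G] \<one>\<^bsub>\<complex>[G]\<^esub> = 1"
    by simp
next
  fix u v assume uv: "u \<in> carrier \<complex>[G]" "v \<in> carrier \<complex>[G]"
  have "(\<lambda>_. \<one>) \<in> hom G G"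
    by (auto simp: hom_def)
  from push_mult[OF _ _ this] uv
  have "smul (counit \<complex>[G] (u \<otimes>\<^bsub>\<complex>[G]\<^esub> v)) (bvec \<one>) =
    smul (counit \<complex>[G] u * counit \<complex>[G] v) (bvec \<one>)"
    by (simp flip: counit_push[of G] add: mult_smul_left mult_smul_right)
  then show "counit \<complex>[G] (u \<otimes>\<^bsub>\<complex>[G]\<^esub> v) = counit \<complex>[G] u * counit \<complex>[G] v"
    by simp
qed (simp_all add: comult_legs_push counit_legs_push push_push push_id)

lemma (in group) hopf_group_algebra: "hopf_algebra \<complex>[G]"
proof (intro hopf_algebra.intro bialgebra_group_algebra hopf_algebra_axioms.intro exI)
  show "is_antipode \<complex>[G] (push (m_inv G))"
    unfolding is_antipode_def
  proof (intro conjI ballI)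
    show "push (m_inv G) \<in> carrier \<complex>[G] \<rightarrow> carrier \<complex>[G]"
      by (auto intro!: push_closed[where B = "carrier G"])
    show "linear_between (basis \<complex>[G]) smul (push (m_inv G))"
      by (intro linear_map_between linear_intros)
    fix u assume "u \<in> carrier \<complex>[G]"
    then have u: "u \<in> free_space (carrier G)" by simp
    show "mult_map \<complex>[G] (tensor_map (push (m_inv G)) id (comult \<complex>[G] u)) =
        smul (counit \<complex>[G] u) \<one>\<^bsub>\<complex>[G]\<^esub>"
      unfolding mult_map_push tensor_map_def group_algebra_simps counit_push
      by (rule linear_map_eqI[OF _ _ u]) (auto intro!: linear_intros)
    show "mult_map \<complex>[G] (tensor_map id (push (m_inv G)) (comult \<complex>[G] u)) =
        smul (counit \<complex>[G] u) \<one>\<^bsub>\<complex>[G]\<^esub>"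
      unfolding mult_map_push tensor_map_def group_algebra_simps counit_push
      by (rule linear_map_eqI[OF _ _ u]) (auto intro!: linear_intros)
  qed
qed

section \<open>Twisting a group algebra\<close>

text \<open>
  The computation common to both hexagon identities. In the application to the first one \<open>a\<close>, \<open>c\<close>,
  \<open>d\<close>, \<open>e\<close>, \<open>f\<close> are \<open>J\<^bsub>12\<^esub>\<close>, \<open>J\<^bsub>31\<^esub>\<close>, \<open>J\<^bsub>32\<^esub>\<close>, \<open>J\<^bsub>13\<^esub>\<close>, \<open>J\<^bsub>23\<^esub>\<close>, while \<open>b\<close>, \<open>l\<close>, \<open>n\<close> are obtained from \<open>J\<^bsub>21\<^esub>\<close> and
  \<open>J\<close> by a coproduct in one factor. The unit \<open>m\<close>, shared by the first two equations, cancels.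
\<close>

lemma (in monoid) hexagon_identity:
  assumes units: "a \<in> Units G" "b \<in> Units G" "c \<in> Units G" "d \<in> Units G" "m \<in> Units G"
    and closed: "l \<in> carrier G" "n \<in> carrier G" "e \<in> carrier G" "f \<in> carrier G"
    and 1: "b \<otimes> a = m \<otimes> c" and 2: "m \<otimes> e = n \<otimes> d" and 3: "l \<otimes> a = n \<otimes> f"
  shows "inv a \<otimes> (inv b \<otimes> l) \<otimes> a = (inv c \<otimes> e) \<otimes> (inv d \<otimes> f)"
proof -
  note [simp] = m_assoc Units_inv_closed Units_closed
  have "n = m \<otimes> (e \<otimes> inv d)"
    using 2 units closed by (metis Units_closed Units_inv_closed Units_r_inv m_assoc r_one)
  then have "l \<otimes> a = m \<otimes> (e \<otimes> (inv d \<otimes> f))"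
    using 3 units closed by simp
  also have "\<dots> = b \<otimes> (a \<otimes> (inv c \<otimes> (e \<otimes> (inv d \<otimes> f))))"
  proof -
    have "m = b \<otimes> a \<otimes> inv c"
      using 1 units by simp
    then show ?thesis using units closed by simp
  qed
  finally have "inv b \<otimes> (l \<otimes> a) = a \<otimes> (inv c \<otimes> (e \<otimes> (inv d \<otimes> f)))"
    using units closed by (metis Units_closed Units_inv_closed Units_l_inv l_one m_assoc m_closed)
  then have "inv a \<otimes> (inv b \<otimes> (l \<otimes> a)) = inv c \<otimes> (e \<otimes> (inv d \<otimes> f))"
    using units closed by (metis Units_closed Units_inv_closed Units_l_inv l_one m_assoc m_closed)
  then show ?thesis using units closed by simp
qed

lemma (in monoid) inv_mult_units:
  assumes "x \<in> Units G" and "y \<in> Units G"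
  shows "inv (x \<otimes> y) = inv y \<otimes> inv x"
proof (rule inv_char)
  have "x \<otimes> y \<otimes> (inv y \<otimes> inv x) = x \<otimes> (y \<otimes> inv y) \<otimes> inv x"
    using assms by (simp add: m_assoc Units_closed del: Units_r_inv)
  then show "x \<otimes> y \<otimes> (inv y \<otimes> inv x) = \<one>"
    using assms by (simp add: Units_closed)
  have "inv y \<otimes> inv x \<otimes> (x \<otimes> y) = inv y \<otimes> (inv x \<otimes> x) \<otimes> y"
    using assms by (simp add: m_assoc Units_closed del: Units_l_inv)
  then show "inv y \<otimes> inv x \<otimes> (x \<otimes> y) = \<one>"
    using assms by (simp add: Units_closed)
qed (use assms in \<open>simp_all add: Units_closed\<close>)

lemma (in monoid) Units_cancel:
  assumes "x \<in> Units G" and "y \<in> carrier G"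
  shows "inv x \<otimes> (x \<otimes> y) = y" and "x \<otimes> (inv x \<otimes> y) = y"
  using assms by (simp_all add: Units_closed flip: m_assoc)

locale group_algebra_twist = group \<Gamma> for \<Gamma> (structure) +
  fixes J
  assumes twist: "is_twist \<complex>[\<Gamma>] J"
begin

abbreviation "\<Gamma>2 \<equiv> \<Gamma> \<times>\<times> \<Gamma>"
abbreviation "\<Gamma>3 \<equiv> \<Gamma> \<times>\<times> \<Gamma> \<times>\<times> \<Gamma>"
abbreviation "J' \<equiv> inv\<^bsub>\<complex>[\<Gamma>2]\<^esub> J"

sublocale H: monoid "\<complex>[\<Gamma>]" by (rule monoid_group_algebra)

lemma monoid_2: "monoid \<Gamma>2" and monoid_3: "monoid \<Gamma>3"
  using is_monoid by (simp_all add: DirProd_monoid)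

sublocale H2: monoid "\<complex>[\<Gamma>2]" by (rule monoid.monoid_group_algebra[OF monoid_2])
sublocale H3: monoid "\<complex>[\<Gamma>3]" by (rule monoid.monoid_group_algebra[OF monoid_3])

abbreviation "F1 \<equiv> free_space (carrier \<Gamma>)"
abbreviation "F2 \<equiv> free_space (carrier \<Gamma> \<times> carrier \<Gamma>)"

lemma mult_F1 [simp]: "u \<in> F1 \<Longrightarrow> v \<in> F1 \<Longrightarrow> u \<otimes>\<^bsub>\<complex>[\<Gamma>]\<^esub> v \<in> F1"
  and mult_F2 [simp]: "s \<in> F2 \<Longrightarrow> t \<in> F2 \<Longrightarrow> s \<otimes>\<^bsub>\<complex>[\<Gamma>2]\<^esub> t \<in> F2"
  using H.m_closed H2.m_closed by simp_all

lemma J_unit: "J \<in> Units \<complex>[\<Gamma>2]"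
  using twist by (simp add: is_twist_def)

lemma J_closed [simp]: "J \<in> F2" "J' \<in> F2"
  using H2.Units_closed[OF J_unit] H2.Units_inv_closed[OF J_unit] by simp_all

lemma J_inverse [simp]:
  "J \<otimes>\<^bsub>\<complex>[\<Gamma>2]\<^esub> J' = bvec (\<one>, \<one>)" "J' \<otimes>\<^bsub>\<complex>[\<Gamma>2]\<^esub> J = bvec (\<one>, \<one>)"
  using H2.Units_r_inv[OF J_unit] H2.Units_l_inv[OF J_unit] by simp_all

lemma J_counit: "push snd J = bvec \<one>" "push fst J = bvec \<one>"
  using twist by (simp_all add: is_twist_def counit_legs_push)

lemma J'_counit: "push snd J' = bvec \<one>" "push fst J' = bvec \<one>"
proof -
  have "snd \<in> hom \<Gamma>2 \<Gamma>" "fst \<in> hom \<Gamma>2 \<Gamma>" by (auto simp: hom_def)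
  from push_unit(2)[OF monoid_2 is_monoid J_unit this(1)] push_unit(2)[OF monoid_2 is_monoid J_unit this(2)]
  show "push snd J' = bvec \<one>" "push fst J' = bvec \<one>"
    using H.inv_one by (simp_all add: J_counit)
qed

lemma twist_equation:
  "push (\<lambda>(a, b). (a, a, b)) J \<otimes>\<^bsub>\<complex>[\<Gamma>3]\<^esub> push (\<lambda>(a, b). (a, b, \<one>)) J =
   push (\<lambda>(a, b). (a, b, b)) J \<otimes>\<^bsub>\<complex>[\<Gamma>3]\<^esub> push (\<lambda>(a, b). (\<one>, a, b)) J"
  using twist by (simp add: is_twist_def comult_legs_push leg_push)

text \<open>
  An endomorphism of \<open>\<Gamma>3\<close> induces an algebra endomorphism, which can be applied to the twist
  equation. The endomorphisms needed are permutations of the three tensor factors.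
\<close>

lemma twist_equation_permuted:
  assumes "f \<in> hom \<Gamma>3 \<Gamma>3"
  shows "push (\<lambda>(a, b). f (a, a, b)) J \<otimes>\<^bsub>\<complex>[\<Gamma>3]\<^esub> push (\<lambda>(a, b). f (a, b, \<one>)) J =
    push (\<lambda>(a, b). f (a, b, b)) J \<otimes>\<^bsub>\<complex>[\<Gamma>3]\<^esub> push (\<lambda>(a, b). f (\<one>, a, b)) J"
proof -
  have cl: "push h J \<in> free_space (carrier \<Gamma> \<times> carrier \<Gamma> \<times> carrier \<Gamma>)"
    if "h \<in> carrier \<Gamma> \<times> carrier \<Gamma> \<rightarrow> carrier \<Gamma>3" for h
    using push_closed[OF J_closed(1) that] by simp
  show ?thesis
    using arg_cong[OF twist_equation, of "push f"]
    by (subst (asm) (1 2) push_mult[OF _ _ assms])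
      (auto intro!: cl simp: push_push case_prod_unfold)
qed

lemma leg_unit:
  assumes "f \<in> hom \<Gamma>2 \<Delta>" "f (\<one>, \<one>) = \<one>\<^bsub>\<Delta>\<^esub>" "monoid \<Delta>"
  shows "push f J \<in> Units \<complex>[\<Delta>]" "inv\<^bsub>\<complex>[\<Delta>]\<^esub> push f J = push f J'"
  using push_unit[OF monoid_2 assms(3) J_unit assms(1)] assms(2) by simp_all

lemma twisted_simps [simp]:
  "carrier (twisted \<complex>[\<Gamma>] J) = F1"
  "basis (twisted \<complex>[\<Gamma>] J) = carrier \<Gamma>"
  "\<one>\<^bsub>twisted \<complex>[\<Gamma>] J\<^esub> = bvec \<one>"
  "monoid.mult (twisted \<complex>[\<Gamma>] J) = monoid.mult \<complex>[\<Gamma>]"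
  "counit (twisted \<complex>[\<Gamma>] J) = counit \<complex>[\<Gamma>]"
  "tensor_alg U (twisted \<complex>[\<Gamma>] J) = tensor_alg U \<complex>[\<Gamma>]"
  "tensor_alg (twisted \<complex>[\<Gamma>] J) = tensor_alg \<complex>[\<Gamma>]"
  "hom (twisted \<complex>[\<Gamma>] J) V = hom \<complex>[\<Gamma>] V"
  "leg12 (twisted \<complex>[\<Gamma>] J) = leg12 \<complex>[\<Gamma>]"
  "leg13 (twisted \<complex>[\<Gamma>] J) = leg13 \<complex>[\<Gamma>]"
  "leg23 (twisted \<complex>[\<Gamma>] J) = leg23 \<complex>[\<Gamma>]"
  "counit_left (twisted \<complex>[\<Gamma>] J) = counit_left \<complex>[\<Gamma>]"
  "counit_right (twisted \<complex>[\<Gamma>] J) = counit_right \<complex>[\<Gamma>]"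
  "mult_map (twisted \<complex>[\<Gamma>] J) = mult_map \<complex>[\<Gamma>]"
  "comult (twisted \<complex>[\<Gamma>] J) u = J' \<otimes>\<^bsub>\<complex>[\<Gamma>2]\<^esub> push (\<lambda>g. (g, g)) u \<otimes>\<^bsub>\<complex>[\<Gamma>2]\<^esub> J"
proof -
  have same: "tensor_alg (twisted \<complex>[\<Gamma>] J) = tensor_alg \<complex>[\<Gamma>]"
    by (simp add: fun_eq_iff twisted_def tensor_alg_def)
  show "tensor_alg U (twisted \<complex>[\<Gamma>] J) = tensor_alg U \<complex>[\<Gamma>]"
    by (simp add: twisted_def tensor_alg_def)
  show "tensor_alg (twisted \<complex>[\<Gamma>] J) = tensor_alg \<complex>[\<Gamma>]"
    by (rule same)
  show "comult (twisted \<complex>[\<Gamma>] J) u = J' \<otimes>\<^bsub>\<complex>[\<Gamma>2]\<^esub> push (\<lambda>g. (g, g)) u \<otimes>\<^bsub>\<complex>[\<Gamma>2]\<^esub> J"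
    by (simp add: twisted_def)
qed (simp_all add: twisted_def fun_eq_iff hom_def leg12_def leg13_def
      leg23_def counit_left_def counit_right_def mult_map_def)

text \<open>
  The maps \<open>w \<mapsto> \<Sum> S(t\<^sub>1) w t\<^sub>2\<close> and \<open>w \<mapsto> \<Sum> t\<^sub>1 w S(t\<^sub>2)\<close> for \<open>t = \<Sum> t\<^sub>1 \<otimes> t\<^sub>2\<close>. They are a right and a
  left action of the tensor square on the group algebra, and the diagonal acts on \<open>1\<close> through the
  counit. The antipode equations for the twisted coproduct become statements about these actions.
\<close>

definition right_sandwich :: "('a \<times> 'a \<Rightarrow>\<^sub>0 complex) \<Rightarrow> ('a \<Rightarrow>\<^sub>0 complex) \<Rightarrow> ('a \<Rightarrow>\<^sub>0 complex)" where
  "right_sandwich t w =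
    lin_ext (\<lambda>p. bvec (inv (fst p)) \<otimes>\<^bsub>\<complex>[\<Gamma>]\<^esub> w \<otimes>\<^bsub>\<complex>[\<Gamma>]\<^esub> bvec (snd p)) t"

definition left_sandwich :: "('a \<times> 'a \<Rightarrow>\<^sub>0 complex) \<Rightarrow> ('a \<Rightarrow>\<^sub>0 complex) \<Rightarrow> ('a \<Rightarrow>\<^sub>0 complex)" where
  "left_sandwich t w =
    lin_ext (\<lambda>p. bvec (fst p) \<otimes>\<^bsub>\<complex>[\<Gamma>]\<^esub> w \<otimes>\<^bsub>\<complex>[\<Gamma>]\<^esub> bvec (inv (snd p))) t"

lemma linear_map_sandwich [linear_intros]:
  "linear_map f \<Longrightarrow> linear_map (\<lambda>u. right_sandwich (f u) w)"
  "linear_map h \<Longrightarrow> linear_map (\<lambda>u. right_sandwich t (h u))"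
  "linear_map f \<Longrightarrow> linear_map (\<lambda>u. left_sandwich (f u) w)"
  "linear_map h \<Longrightarrow> linear_map (\<lambda>u. left_sandwich t (h u))"
  unfolding right_sandwich_def left_sandwich_def by (auto intro!: linear_intros)

lemma sandwich_bvec [simp]:
  "right_sandwich (bvec (a, b)) w = bvec (inv a) \<otimes>\<^bsub>\<complex>[\<Gamma>]\<^esub> w \<otimes>\<^bsub>\<complex>[\<Gamma>]\<^esub> bvec b"
  "left_sandwich (bvec (a, b)) w = bvec a \<otimes>\<^bsub>\<complex>[\<Gamma>]\<^esub> w \<otimes>\<^bsub>\<complex>[\<Gamma>]\<^esub> bvec (inv b)"
  by (simp_all add: right_sandwich_def left_sandwich_def)

lemma sandwich_closed [simp]:
  assumes "t \<in> F2" and "w \<in> F1"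
  shows "right_sandwich t w \<in> F1" and "left_sandwich t w \<in> F1"
  unfolding right_sandwich_def left_sandwich_def using assms by (auto intro!: lin_ext_closed)

lemma sandwich_mult:
  assumes s: "s \<in> F2" and t: "t \<in> F2" and w: "w \<in> F1"
  shows "right_sandwich (s \<otimes>\<^bsub>\<complex>[\<Gamma>2]\<^esub> t) w = right_sandwich t (right_sandwich s w)"
    and "left_sandwich (s \<otimes>\<^bsub>\<complex>[\<Gamma>2]\<^esub> t) w = left_sandwich s (left_sandwich t w)"
proof -
  show "right_sandwich (s \<otimes>\<^bsub>\<complex>[\<Gamma>2]\<^esub> t) w = right_sandwich t (right_sandwich s w)"
  proof (rule bilinear_map_eqI[OF s t, where f = "\<lambda>s t. right_sandwich (s \<otimes>\<^bsub>\<complex>[\<Gamma>2]\<^esub> t) w"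
        and g = "\<lambda>s t. right_sandwich t (right_sandwich s w)"]; (intro linear_intros)?)
    fix p q assume "p \<in> carrier \<Gamma> \<times> carrier \<Gamma>" "q \<in> carrier \<Gamma> \<times> carrier \<Gamma>"
    then obtain a b c d where p: "p = (a, b)" "q = (c, d)"
      and *: "a \<in> carrier \<Gamma>" "b \<in> carrier \<Gamma>" "c \<in> carrier \<Gamma>" "d \<in> carrier \<Gamma>" by auto
    show "right_sandwich (bvec p \<otimes>\<^bsub>\<complex>[\<Gamma>2]\<^esub> bvec q) w =
        right_sandwich (bvec q) (right_sandwich (bvec p) w)"
      unfolding p mult_bvec[where \<Gamma> = \<Gamma>2] mult_DirProd sandwich_bvec
      using w * by (simp add: H.m_assoc inv_mult_group flip: mult_bvec)
  qed
  show "left_sandwich (s \<otimes>\<^bsub>\<complex>[\<Gamma>2]\<^esub> t) w = left_sandwich s (left_sandwich t w)"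
  proof (rule bilinear_map_eqI[OF s t, where f = "\<lambda>s t. left_sandwich (s \<otimes>\<^bsub>\<complex>[\<Gamma>2]\<^esub> t) w"
        and g = "\<lambda>s t. left_sandwich s (left_sandwich t w)"]; (intro linear_intros)?)
    fix p q assume "p \<in> carrier \<Gamma> \<times> carrier \<Gamma>" "q \<in> carrier \<Gamma> \<times> carrier \<Gamma>"
    then obtain a b c d where p: "p = (a, b)" "q = (c, d)"
      and *: "a \<in> carrier \<Gamma>" "b \<in> carrier \<Gamma>" "c \<in> carrier \<Gamma>" "d \<in> carrier \<Gamma>" by auto
    show "left_sandwich (bvec p \<otimes>\<^bsub>\<complex>[\<Gamma>2]\<^esub> bvec q) w =
        left_sandwich (bvec p) (left_sandwich (bvec q) w)"
      unfolding p mult_bvec[where \<Gamma> = \<Gamma>2] mult_DirProd sandwich_bvec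
      using w * by (simp add: H.m_assoc inv_mult_group flip: mult_bvec)
  qed
qed

lemma sandwich_one:
  assumes "w \<in> F1"
  shows "right_sandwich (bvec (\<one>, \<one>)) w = w" and "left_sandwich (bvec (\<one>, \<one>)) w = w"
  using assms H.l_one[of w] H.r_one[of w] by simp_all

lemma sandwich_diagonal:
  assumes u: "u \<in> F1"
  shows "right_sandwich (push (\<lambda>g. (g, g)) u) (bvec \<one>) = smul (counit \<complex>[\<Gamma>] u) (bvec \<one>)"
    and "left_sandwich (push (\<lambda>g. (g, g)) u) (bvec \<one>) = smul (counit \<complex>[\<Gamma>] u) (bvec \<one>)"
  unfolding counit_push
  by (rule linear_map_eqI[OF _ _ u]; auto intro!: linear_intros)+

abbreviation "Q \<equiv> right_sandwich J (bvec \<one>)"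
abbreviation "P \<equiv> left_sandwich J' (bvec \<one>)"

text \<open>
  Apply \<open>a \<otimes> b \<otimes> c \<mapsto> a S(b) c\<close> to the twist equation in the form
  \<open>J\<^bsub>23\<^esub> J\<^bsub>12\<^esub>\<inverse> = (I \<otimes> \<Delta>)(J)\<inverse> (\<Delta> \<otimes> I)(J)\<close>. The left-hand side goes to \<open>P Q\<close>. On the right-hand side
  the middle factors cancel and leave the product of two counits of \<open>J\<inverse>\<close> and \<open>J\<close>, which is \<open>1\<close>.
\<close>

lemma P_mult_Q: "P \<otimes>\<^bsub>\<complex>[\<Gamma>]\<^esub> Q = bvec \<one>"
proof -
  let ?\<theta> = "push (\<lambda>(a, b, c). a \<otimes> inv b \<otimes> c)"
  let ?L = "push (\<lambda>(a, b). (a, a, b)) J" and ?J12 = "push (\<lambda>(a, b). (a, b, \<one>)) J"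
  let ?N = "push (\<lambda>(a, b). (a, b, b)) J" and ?J23 = "push (\<lambda>(a, b). (\<one>, a, b)) J"
  have hom: "(\<lambda>(a, b). (a, b, \<one>)) \<in> hom \<Gamma>2 \<Gamma>3" "(\<lambda>(a, b). (a, b, b)) \<in> hom \<Gamma>2 \<Gamma>3"
    "(\<lambda>(a, b). (a, a, b)) \<in> hom \<Gamma>2 \<Gamma>3" "(\<lambda>(a, b). (\<one>, a, b)) \<in> hom \<Gamma>2 \<Gamma>3"
    by (auto simp: hom_def)
  have units: "?L \<in> Units \<complex>[\<Gamma>3]" "?J12 \<in> Units \<complex>[\<Gamma>3]" "?N \<in> Units \<complex>[\<Gamma>3]" "?J23 \<in> Units \<complex>[\<Gamma>3]"
    and inverses: "inv\<^bsub>\<complex>[\<Gamma>3]\<^esub> ?N = push (\<lambda>(a, b). (a, b, b)) J'"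
      "inv\<^bsub>\<complex>[\<Gamma>3]\<^esub> ?J12 = push (\<lambda>(a, b). (a, b, \<one>)) J'"
    using hom by (auto intro!: leg_unit monoid_3)
  have "?J23 \<otimes>\<^bsub>\<complex>[\<Gamma>3]\<^esub> inv\<^bsub>\<complex>[\<Gamma>3]\<^esub> ?J12 = inv\<^bsub>\<complex>[\<Gamma>3]\<^esub> ?N \<otimes>\<^bsub>\<complex>[\<Gamma>3]\<^esub> ?L"
    using twist_equation units H3.Units_closed H3.Units_inv_closed
    by (smt (verit) H3.Units_l_inv H3.Units_r_inv H3.l_one H3.m_assoc H3.m_closed H3.r_one)
  then have *: "?J23 \<otimes>\<^bsub>\<complex>[\<Gamma>3]\<^esub> push (\<lambda>(a, b). (a, b, \<one>)) J' =
      push (\<lambda>(a, b). (a, b, b)) J' \<otimes>\<^bsub>\<complex>[\<Gamma>3]\<^esub> ?L"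
    by (simp only: inverses)
  have "P \<otimes>\<^bsub>\<complex>[\<Gamma>]\<^esub> Q = ?\<theta> (?J23 \<otimes>\<^bsub>\<complex>[\<Gamma>3]\<^esub> push (\<lambda>(a, b). (a, b, \<one>)) J')"
  proof (rule bilinear_map_eqI[OF J_closed(2,1), where f = "\<lambda>s t. left_sandwich s (bvec \<one>)
        \<otimes>\<^bsub>\<complex>[\<Gamma>]\<^esub> right_sandwich t (bvec \<one>)" and g = "\<lambda>s t. ?\<theta> (push (\<lambda>(a, b). (\<one>, a, b)) t
        \<otimes>\<^bsub>\<complex>[\<Gamma>3]\<^esub> push (\<lambda>(a, b). (a, b, \<one>)) s)"]; (intro linear_intros)?)
    fix p q assume "p \<in> carrier \<Gamma> \<times> carrier \<Gamma>" "q \<in> carrier \<Gamma> \<times> carrier \<Gamma>"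
    then show "left_sandwich (bvec p) (bvec \<one>) \<otimes>\<^bsub>\<complex>[\<Gamma>]\<^esub> right_sandwich (bvec q) (bvec \<one>) =
        ?\<theta> (push (\<lambda>(a, b). (\<one>, a, b)) (bvec q) \<otimes>\<^bsub>\<complex>[\<Gamma>3]\<^esub> push (\<lambda>(a, b). (a, b, \<one>)) (bvec p))"
      by (auto simp: inv_mult_group m_assoc)
  qed
  also have "\<dots> = ?\<theta> (push (\<lambda>(a, b). (a, b, b)) J' \<otimes>\<^bsub>\<complex>[\<Gamma>3]\<^esub> ?L)"
    by (simp only: *)
  also have "\<dots> = push fst J' \<otimes>\<^bsub>\<complex>[\<Gamma>]\<^esub> push snd J"
  proof (rule bilinear_map_eqI[OF J_closed(2,1), where f = "\<lambda>s t. ?\<theta> (push (\<lambda>(a, b). (a, b, b)) s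
        \<otimes>\<^bsub>\<complex>[\<Gamma>3]\<^esub> push (\<lambda>(a, b). (a, a, b)) t)" and g = "\<lambda>s t. push fst s \<otimes>\<^bsub>\<complex>[\<Gamma>]\<^esub> push snd t"];
      (intro linear_intros)?)
    fix p q assume "p \<in> carrier \<Gamma> \<times> carrier \<Gamma>" "q \<in> carrier \<Gamma> \<times> carrier \<Gamma>"
    then obtain a b c d where p: "p = (a, b)" "q = (c, d)"
      and *: "a \<in> carrier \<Gamma>" "b \<in> carrier \<Gamma>" "c \<in> carrier \<Gamma>" "d \<in> carrier \<Gamma>" by auto
    then have "a \<otimes> c \<otimes> inv (b \<otimes> c) \<otimes> (b \<otimes> d) = a \<otimes> (c \<otimes> inv c) \<otimes> ((inv b \<otimes> b) \<otimes> d)"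
      by (simp only: inv_mult_group m_assoc m_closed inv_closed)
    then show "?\<theta> (push (\<lambda>(a, b). (a, b, b)) (bvec p) \<otimes>\<^bsub>\<complex>[\<Gamma>3]\<^esub> push (\<lambda>(a, b). (a, a, b)) (bvec q)) =
        push fst (bvec p) \<otimes>\<^bsub>\<complex>[\<Gamma>]\<^esub> push snd (bvec q)"
      using * by (simp add: p)
  qed
  finally show ?thesis
    by (simp add: J_counit J'_counit)
qed

text \<open>
  The action property turns \<open>\<Sum> S'(t\<^sub>1) t\<^sub>2\<close> for \<open>t = J\<inverse> \<Delta>(u) J\<close> into the action of \<open>J J\<inverse>\<close>, then
  \<open>\<Delta>(u)\<close>, then \<open>J\<close> on \<open>1\<close>, so that only \<open>P Q = 1\<close> is left to use; similarly on the other side.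
\<close>

lemma twisted_antipode:
  "is_antipode (twisted \<complex>[\<Gamma>] J) (\<lambda>u. P \<otimes>\<^bsub>\<complex>[\<Gamma>]\<^esub> push (m_inv \<Gamma>) u \<otimes>\<^bsub>\<complex>[\<Gamma>]\<^esub> Q)"
    (is "is_antipode _ ?S")
  unfolding is_antipode_def twisted_simps
proof (intro conjI ballI)
  have inv_closed': "push (m_inv \<Gamma>) u \<in> F1" if "u \<in> F1" for u
    using that by (rule push_closed) auto
  show "?S \<in> F1 \<rightarrow> F1"
    by (auto simp: inv_closed')
  show "linear_between (carrier \<Gamma>) smul ?S"
    by (intro linear_map_between linear_intros)
  fix u assume u: "u \<in> F1"
  let ?d = "push (\<lambda>g. (g, g)) u"
  have d: "?d \<in> F2"
    using u by (rule push_closed) auto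
  have "mult_map \<complex>[\<Gamma>] (tensor_map ?S id t) = P \<otimes>\<^bsub>\<complex>[\<Gamma>]\<^esub> right_sandwich t Q" if t: "t \<in> F2" for t
    unfolding tensor_map_def
  proof (rule linear_map_eqI[OF _ _ t])
    show "linear_map (\<lambda>t. mult_map \<complex>[\<Gamma>] (lin_ext (\<lambda>(b, c). tensor (?S (bvec b)) (id (bvec c))) t))"
      unfolding mult_map_push by (intro linear_intros)
    show "linear_map (\<lambda>t. P \<otimes>\<^bsub>\<complex>[\<Gamma>]\<^esub> right_sandwich t Q)"
      by (intro linear_intros)
  qed (auto simp: mult_map_tensor H.m_assoc)
  then have "mult_map \<complex>[\<Gamma>] (tensor_map ?S id (J' \<otimes>\<^bsub>\<complex>[\<Gamma>2]\<^esub> ?d \<otimes>\<^bsub>\<complex>[\<Gamma>2]\<^esub> J)) =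
      P \<otimes>\<^bsub>\<complex>[\<Gamma>]\<^esub> right_sandwich J (right_sandwich ?d (right_sandwich (J \<otimes>\<^bsub>\<complex>[\<Gamma>2]\<^esub> J') (bvec \<one>)))"
    using d by (simp add: sandwich_mult del: J_inverse)
  also have "\<dots> = P \<otimes>\<^bsub>\<complex>[\<Gamma>]\<^esub> right_sandwich J (smul (counit \<complex>[\<Gamma>] u) (bvec \<one>))"
    using u by (simp only: J_inverse sandwich_one sandwich_diagonal bvec_in_free_space one_closed)
  also have "\<dots> = smul (counit \<complex>[\<Gamma>] u) (P \<otimes>\<^bsub>\<complex>[\<Gamma>]\<^esub> Q)"
    by (simp add: linear_map_smul[OF linear_map_sandwich(2)[OF linear_map_id]] mult_smul_right)
  finally show "mult_map \<complex>[\<Gamma>] (tensor_map ?S id (J' \<otimes>\<^bsub>\<complex>[\<Gamma>2]\<^esub> ?d \<otimes>\<^bsub>\<complex>[\<Gamma>2]\<^esub> J)) =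
      smul (counit \<complex>[\<Gamma>] u) (bvec \<one>)"
    by (simp only: P_mult_Q)
  have "mult_map \<complex>[\<Gamma>] (tensor_map id ?S t) = left_sandwich t P \<otimes>\<^bsub>\<complex>[\<Gamma>]\<^esub> Q" if t: "t \<in> F2" for t
    unfolding tensor_map_def
  proof (rule linear_map_eqI[OF _ _ t])
    show "linear_map (\<lambda>t. mult_map \<complex>[\<Gamma>] (lin_ext (\<lambda>(b, c). tensor (id (bvec b)) (?S (bvec c))) t))"
      unfolding mult_map_push by (intro linear_intros)
    show "linear_map (\<lambda>t. left_sandwich t P \<otimes>\<^bsub>\<complex>[\<Gamma>]\<^esub> Q)"
      by (intro linear_intros)
  qed (auto simp: mult_map_tensor H.m_assoc)
  then have "mult_map \<complex>[\<Gamma>] (tensor_map id ?S (J' \<otimes>\<^bsub>\<complex>[\<Gamma>2]\<^esub> ?d \<otimes>\<^bsub>\<complex>[\<Gamma>2]\<^esub> J)) =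
      left_sandwich J' (left_sandwich ?d (left_sandwich (J \<otimes>\<^bsub>\<complex>[\<Gamma>2]\<^esub> J') (bvec \<one>))) \<otimes>\<^bsub>\<complex>[\<Gamma>]\<^esub> Q"
    using d by (simp add: sandwich_mult del: J_inverse)
  also have "\<dots> = left_sandwich J' (smul (counit \<complex>[\<Gamma>] u) (bvec \<one>)) \<otimes>\<^bsub>\<complex>[\<Gamma>]\<^esub> Q"
    using u by (simp only: J_inverse sandwich_one sandwich_diagonal bvec_in_free_space one_closed)
  also have "\<dots> = smul (counit \<complex>[\<Gamma>] u) (P \<otimes>\<^bsub>\<complex>[\<Gamma>]\<^esub> Q)"
    by (simp add: linear_map_smul[OF linear_map_sandwich(4)[OF linear_map_id]] mult_smul_left)
  finally show "mult_map \<complex>[\<Gamma>] (tensor_map id ?S (J' \<otimes>\<^bsub>\<complex>[\<Gamma>2]\<^esub> ?d \<otimes>\<^bsub>\<complex>[\<Gamma>2]\<^esub> J)) =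
      smul (counit \<complex>[\<Gamma>] u) (bvec \<one>)"
    by (simp only: P_mult_Q)
qed

text \<open>
  The R-matrix \<open>J\<^bsub>21\<^esub>\<inverse> J\<close> obtained from the trivial R-matrix of the cocommutative \<open>\<complex>[\<Gamma>]\<close>.
\<close>

abbreviation "R \<equiv> inv\<^bsub>\<complex>[\<Gamma>2]\<^esub> push (\<lambda>(a, b). (b, a)) J \<otimes>\<^bsub>\<complex>[\<Gamma>2]\<^esub> J"

lemma swap_hom: "(\<lambda>(a, b). (b, a)) \<in> hom \<Gamma>2 \<Gamma>2"
  by (auto simp: hom_def)

lemma swap_unit: "push (\<lambda>(a, b). (b, a)) J \<in> Units \<complex>[\<Gamma>2]"
  and swap_inv: "inv\<^bsub>\<complex>[\<Gamma>2]\<^esub> push (\<lambda>(a, b). (b, a)) J = push (\<lambda>(a, b). (b, a)) J'"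
  using leg_unit[OF swap_hom _ monoid_2] by simp_all

lemma push_F2 [simp]: "t \<in> F2 \<Longrightarrow> push (\<lambda>(a, b). (b, a)) t \<in> F2"
  by (rule push_closed) auto

lemma push_diagonal_F2 [simp]: "u \<in> F1 \<Longrightarrow> push (\<lambda>g. (g, g)) u \<in> F2"
  by (rule push_closed) auto

text \<open>
  Coproducts of one tensor factor are also conjugate to the untwisted ones, by \<open>J\<^bsub>12\<^esub>\<close> here and by
  \<open>J\<^bsub>23\<^esub>\<close> for the other factor.
\<close>

lemma twisted_comult_left:
  assumes t: "t \<in> F2"
  shows "comult_left (twisted \<complex>[\<Gamma>] J) t = push (\<lambda>(a, b). (a, b, \<one>)) J' \<otimes>\<^bsub>\<complex>[\<Gamma>3]\<^esub>
    push (\<lambda>(a, b). (a, a, b)) t \<otimes>\<^bsub>\<complex>[\<Gamma>3]\<^esub> push (\<lambda>(a, b). (a, b, \<one>)) J"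
  unfolding comult_left_def tensor_map_def tensor_assoc_push
proof (rule linear_map_eqI[OF _ _ t]; (intro linear_intros)?)
  fix p assume "p \<in> carrier \<Gamma> \<times> carrier \<Gamma>"
  then obtain a b where p: "p = (a, b)" and ab: "a \<in> carrier \<Gamma>" "b \<in> carrier \<Gamma>" by auto
  have assoc_hom: "(\<lambda>((b, c), d). (b, c, d)) \<in> hom (\<Gamma>2 \<times>\<times> \<Gamma>) \<Gamma>3"
    by (auto simp: hom_def)
  have "tensor (J' \<otimes>\<^bsub>\<complex>[\<Gamma>2]\<^esub> bvec (a, a) \<otimes>\<^bsub>\<complex>[\<Gamma>2]\<^esub> J) (bvec b) =
      tensor J' (bvec \<one>) \<otimes>\<^bsub>\<complex>[\<Gamma>2 \<times>\<times> \<Gamma>]\<^esub> tensor (bvec (a, a)) (bvec b)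
        \<otimes>\<^bsub>\<complex>[\<Gamma>2 \<times>\<times> \<Gamma>]\<^esub> tensor J (bvec \<one>)"
    using ab by (subst tensor_mult; simp)+
  moreover have "tensor J (bvec \<one>) \<in> free_space (carrier (\<Gamma>2 \<times>\<times> \<Gamma>))"
    "tensor J' (bvec \<one>) \<otimes>\<^bsub>\<complex>[\<Gamma>2 \<times>\<times> \<Gamma>]\<^esub> tensor (bvec (a, a)) (bvec b) \<in> free_space (carrier (\<Gamma>2 \<times>\<times> \<Gamma>))"
    "tensor J' (bvec \<one>) \<in> free_space (carrier (\<Gamma>2 \<times>\<times> \<Gamma>))"
    using ab tensor_closed[OF J_closed(1), of "bvec \<one>" "carrier \<Gamma>"]
      tensor_closed[OF J_closed(2), of "bvec \<one>" "carrier \<Gamma>"]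
      monoid.group_algebra_mult_closed[OF DirProd_monoid[OF monoid_2 is_monoid]]
    by simp_all
  ultimately show "push (\<lambda>((b, c), d). (b, c, d))
      (lin_ext (\<lambda>(b, c). tensor (comult (twisted \<complex>[\<Gamma>] J) (bvec b)) (id (bvec c))) (bvec p)) =
    push (\<lambda>(a, b). (a, b, \<one>)) J' \<otimes>\<^bsub>\<complex>[\<Gamma>3]\<^esub>
      push (\<lambda>(a, b). (a, a, b)) (bvec p) \<otimes>\<^bsub>\<complex>[\<Gamma>3]\<^esub> push (\<lambda>(a, b). (a, b, \<one>)) J"
    using ab
    by (simp add: p push_mult[OF _ _ assoc_hom])
      (simp add: tensor_bvec_right push_push case_prod_unfold)
qed

lemma twisted_comult_right:
  assumes t: "t \<in> F2"
  shows "comult_right (twisted \<complex>[\<Gamma>] J) t = push (\<lambda>(a, b). (\<one>, a, b)) J' \<otimes>\<^bsub>\<complex>[\<Gamma>3]\<^esub>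
    push (\<lambda>(a, b). (a, b, b)) t \<otimes>\<^bsub>\<complex>[\<Gamma>3]\<^esub> push (\<lambda>(a, b). (\<one>, a, b)) J"
  unfolding comult_right_def tensor_map_def
proof (rule linear_map_eqI[OF _ _ t]; (intro linear_intros)?)
  fix p assume "p \<in> carrier \<Gamma> \<times> carrier \<Gamma>"
  then obtain a b where p: "p = (a, b)" and ab: "a \<in> carrier \<Gamma>" "b \<in> carrier \<Gamma>" by auto
  have "tensor (bvec a) (J' \<otimes>\<^bsub>\<complex>[\<Gamma>2]\<^esub> bvec (b, b) \<otimes>\<^bsub>\<complex>[\<Gamma>2]\<^esub> J) =
      tensor (bvec \<one>) J' \<otimes>\<^bsub>\<complex>[\<Gamma>3]\<^esub> tensor (bvec a) (bvec (b, b)) \<otimes>\<^bsub>\<complex>[\<Gamma>3]\<^esub> tensor (bvec \<one>) J"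
    using ab by (subst tensor_mult; simp)+
  then show "lin_ext (\<lambda>(b, c). tensor (id (bvec b)) (comult (twisted \<complex>[\<Gamma>] J) (bvec c))) (bvec p) =
    push (\<lambda>(a, b). (\<one>, a, b)) J' \<otimes>\<^bsub>\<complex>[\<Gamma>3]\<^esub>
      push (\<lambda>(a, b). (a, b, b)) (bvec p) \<otimes>\<^bsub>\<complex>[\<Gamma>3]\<^esub> push (\<lambda>(a, b). (\<one>, a, b)) J"
    by (simp add: p) (simp add: tensor_bvec_left case_prod_unfold)
qed

lemma leg_homs:
  "(\<lambda>(a, b). (a, a, b)) \<in> hom \<Gamma>2 \<Gamma>3" "(\<lambda>(a, b). (a, b, b)) \<in> hom \<Gamma>2 \<Gamma>3"
  "(\<lambda>(a, b). (a, b, a)) \<in> hom \<Gamma>2 \<Gamma>3" "(\<lambda>(a, b). (b, a, b)) \<in> hom \<Gamma>2 \<Gamma>3"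
  "(\<lambda>(a, b). (b, b, a)) \<in> hom \<Gamma>2 \<Gamma>3" "(\<lambda>(a, b). (b, a, a)) \<in> hom \<Gamma>2 \<Gamma>3"
  "(\<lambda>(a, b). (a, b, \<one>)) \<in> hom \<Gamma>2 \<Gamma>3" "(\<lambda>(a, b). (\<one>, a, b)) \<in> hom \<Gamma>2 \<Gamma>3"
  "(\<lambda>(a, b). (a, \<one>, b)) \<in> hom \<Gamma>2 \<Gamma>3" "(\<lambda>(a, b). (b, a, \<one>)) \<in> hom \<Gamma>2 \<Gamma>3"
  "(\<lambda>(a, b). (\<one>, b, a)) \<in> hom \<Gamma>2 \<Gamma>3" "(\<lambda>(a, b). (b, \<one>, a)) \<in> hom \<Gamma>2 \<Gamma>3"
  "Pair \<one> \<in> hom \<Gamma>2 \<Gamma>3"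
  by (auto simp: hom_def)

lemma push_leg_mult:
  assumes "f \<in> hom \<Gamma>2 \<Gamma>3" and "s \<in> F2" and "t \<in> F2"
  shows "push f (s \<otimes>\<^bsub>\<complex>[\<Gamma>2]\<^esub> t) = push f s \<otimes>\<^bsub>\<complex>[\<Gamma>3]\<^esub> push f t"
  using assms by (intro push_mult) simp_all

lemma push_leg_closed:
  assumes "f \<in> hom \<Gamma>2 \<Gamma>3" and "t \<in> F2"
  shows "push f t \<in> carrier \<complex>[\<Gamma>3]"
  using push_closed[OF assms(2), of f "carrier \<Gamma>3"] assms(1) by (simp add: hom_def)

text \<open>
  Coassociativity is where the twist equation enters: the two iterated twisted coproducts are the
  conjugates of the same element by the two sides of that equation.
\<close>

lemma twisted_bialgebra: "bialgebra (twisted \<complex>[\<Gamma>] J)"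
proof -
  interpret B: bialgebra "\<complex>[\<Gamma>]" by (rule bialgebra_group_algebra)
  have "monoid (twisted \<complex>[\<Gamma>] J)"
    using H.monoid_axioms by (simp add: monoid_def)
  then have alg: "complex_algebra (twisted \<complex>[\<Gamma>] J)"
    using B.complex_algebra_axioms by (simp add: complex_algebra_def complex_algebra_axioms_def)
  have pushes: "push fst (s \<otimes>\<^bsub>\<complex>[\<Gamma>2]\<^esub> t) = push fst s \<otimes>\<^bsub>\<complex>[\<Gamma>]\<^esub> push fst t"
    "push snd (s \<otimes>\<^bsub>\<complex>[\<Gamma>2]\<^esub> t) = push snd s \<otimes>\<^bsub>\<complex>[\<Gamma>]\<^esub> push snd t"
    if "s \<in> F2" "t \<in> F2" for s t
    using that by (auto intro!: push_mult simp: hom_def)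
  show ?thesis
  proof (intro bialgebra.intro alg bialgebra_axioms.intro; (unfold twisted_simps)?)
    show "linear_between (carrier \<Gamma>) smul
        (\<lambda>u. J' \<otimes>\<^bsub>\<complex>[\<Gamma>2]\<^esub> push (\<lambda>g. (g, g)) u \<otimes>\<^bsub>\<complex>[\<Gamma>2]\<^esub> J)"
      by (intro linear_map_between linear_intros)
    show "(\<lambda>u. J' \<otimes>\<^bsub>\<complex>[\<Gamma>2]\<^esub> push (\<lambda>g. (g, g)) u \<otimes>\<^bsub>\<complex>[\<Gamma>2]\<^esub> J) \<in> hom \<complex>[\<Gamma>] (tensor_sq \<complex>[\<Gamma>])"
    proof (rule homI; simp)
      fix u v assume uv: "u \<in> F1" "v \<in> F1"
      let ?u = "push (\<lambda>g. (g, g)) u" and ?v = "push (\<lambda>g. (g, g)) v"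
      have "push (\<lambda>g. (g, g)) (u \<otimes>\<^bsub>\<complex>[\<Gamma>]\<^esub> v) = ?u \<otimes>\<^bsub>\<complex>[\<Gamma>2]\<^esub> ?v"
        using uv by (intro push_mult) (auto simp: hom_def)
      moreover have "J \<otimes>\<^bsub>\<complex>[\<Gamma>2]\<^esub> (J' \<otimes>\<^bsub>\<complex>[\<Gamma>2]\<^esub> w) = w" if "w \<in> F2" for w
        using that H2.m_assoc[of J J' w] H2.l_one[of w] by simp
      ultimately show "J' \<otimes>\<^bsub>\<complex>[\<Gamma>2]\<^esub> push (\<lambda>g. (g, g)) (u \<otimes>\<^bsub>\<complex>[\<Gamma>]\<^esub> v) \<otimes>\<^bsub>\<complex>[\<Gamma>2]\<^esub> J =
          J' \<otimes>\<^bsub>\<complex>[\<Gamma>2]\<^esub> ?u \<otimes>\<^bsub>\<complex>[\<Gamma>2]\<^esub> J \<otimes>\<^bsub>\<complex>[\<Gamma>2]\<^esub> (J' \<otimes>\<^bsub>\<complex>[\<Gamma>2]\<^esub> ?v \<otimes>\<^bsub>\<complex>[\<Gamma>2]\<^esub> J)"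
        using uv by (simp add: H2.m_assoc)
    qed
    show "J' \<otimes>\<^bsub>\<complex>[\<Gamma>2]\<^esub> push (\<lambda>g. (g, g)) (bvec \<one>) \<otimes>\<^bsub>\<complex>[\<Gamma>2]\<^esub> J = \<one>\<^bsub>tensor_sq \<complex>[\<Gamma>]\<^esub>"
      using H2.r_one[of J'] by simp
    show "linear_between (carrier \<Gamma>) (*) (counit \<complex>[\<Gamma>])"
      using B.counit_linear by simp
    show "counit \<complex>[\<Gamma>] (bvec \<one>) = 1"
      by simp
  next
    fix u v assume "u \<in> F1" "v \<in> F1"
    then show "counit \<complex>[\<Gamma>] (u \<otimes>\<^bsub>\<complex>[\<Gamma>]\<^esub> v) = counit \<complex>[\<Gamma>] u * counit \<complex>[\<Gamma>] v"
      using B.counit_mult by simp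
  next
    fix u assume u: "u \<in> F1"
    let ?d = "push (\<lambda>g. (g, g)) u"
    let ?L = "\<lambda>t. push (\<lambda>(a, b). (a, a, b)) t" and ?N = "\<lambda>t. push (\<lambda>(a, b). (a, b, b)) t"
    let ?l12 = "\<lambda>t. push (\<lambda>(a, b). (a, b, \<one>)) t" and ?l23 = "\<lambda>t. push (\<lambda>(a, b). (\<one>, a, b)) t"
    \<comment> \<open>Here \<open>?L\<close> and \<open>?N\<close> are the untwisted coproducts of the left and of the right factor.\<close>
    have diag: "?L ?d = ?N ?d"
      by (simp add: push_push)
    have closed: "?L ?d \<in> carrier \<complex>[\<Gamma>3]"
      using u by (intro push_leg_closed leg_homs) simp
    note units = leg_unit(1)[OF _ _ monoid_3]
    have units: "?L J \<in> Units \<complex>[\<Gamma>3]" "?l12 J \<in> Units \<complex>[\<Gamma>3]" "?N J \<in> Units \<complex>[\<Gamma>3]" "?l23 J \<in> Units \<complex>[\<Gamma>3]"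
      by (auto intro!: units leg_homs)
    show "comult_left (twisted \<complex>[\<Gamma>] J) (J' \<otimes>\<^bsub>\<complex>[\<Gamma>2]\<^esub> ?d \<otimes>\<^bsub>\<complex>[\<Gamma>2]\<^esub> J) =
        comult_right (twisted \<complex>[\<Gamma>] J) (J' \<otimes>\<^bsub>\<complex>[\<Gamma>2]\<^esub> ?d \<otimes>\<^bsub>\<complex>[\<Gamma>2]\<^esub> J)"
    proof -
      have "?l12 J' \<otimes>\<^bsub>\<complex>[\<Gamma>3]\<^esub> ?L J' = inv\<^bsub>\<complex>[\<Gamma>3]\<^esub> (?L J \<otimes>\<^bsub>\<complex>[\<Gamma>3]\<^esub> ?l12 J)"
        "?l23 J' \<otimes>\<^bsub>\<complex>[\<Gamma>3]\<^esub> ?N J' = inv\<^bsub>\<complex>[\<Gamma>3]\<^esub> (?N J \<otimes>\<^bsub>\<complex>[\<Gamma>3]\<^esub> ?l23 J)"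
        using units by (simp_all add: H3.inv_mult_units leg_unit(2)[OF _ _ monoid_3] leg_homs)
      then have "?l12 J' \<otimes>\<^bsub>\<complex>[\<Gamma>3]\<^esub> ?L J' = ?l23 J' \<otimes>\<^bsub>\<complex>[\<Gamma>3]\<^esub> ?N J'"
        by (simp only: twist_equation)
      moreover note closed = closed push_leg_closed[OF leg_homs(1) J_closed(1)]
        push_leg_closed[OF leg_homs(1) J_closed(2)] push_leg_closed[OF leg_homs(2) J_closed(1)]
        push_leg_closed[OF leg_homs(2) J_closed(2)] push_leg_closed[OF leg_homs(7) J_closed(1)]
        push_leg_closed[OF leg_homs(7) J_closed(2)] push_leg_closed[OF leg_homs(8) J_closed(1)]
        push_leg_closed[OF leg_homs(8) J_closed(2)]
      ultimately have "(?l12 J' \<otimes>\<^bsub>\<complex>[\<Gamma>3]\<^esub> ?L J') \<otimes>\<^bsub>\<complex>[\<Gamma>3]\<^esub> (?L ?d \<otimes>\<^bsub>\<complex>[\<Gamma>3]\<^esub> (?L J \<otimes>\<^bsub>\<complex>[\<Gamma>3]\<^esub> ?l12 J)) =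
          (?l23 J' \<otimes>\<^bsub>\<complex>[\<Gamma>3]\<^esub> ?N J') \<otimes>\<^bsub>\<complex>[\<Gamma>3]\<^esub> (?N ?d \<otimes>\<^bsub>\<complex>[\<Gamma>3]\<^esub> (?N J \<otimes>\<^bsub>\<complex>[\<Gamma>3]\<^esub> ?l23 J))"
        by (simp only: diag twist_equation)
      then show ?thesis
        using u closed closed(1)[unfolded diag]
        by (simp add: twisted_comult_left twisted_comult_right push_leg_mult leg_homs H3.m_assoc
            del: group_algebra_simps)
    qed
  next
    fix u assume u: "u \<in> F1"
    let ?d = "push (\<lambda>g. (g, g)) u"
    show "counit_left \<complex>[\<Gamma>] (J' \<otimes>\<^bsub>\<complex>[\<Gamma>2]\<^esub> ?d \<otimes>\<^bsub>\<complex>[\<Gamma>2]\<^esub> J) = u"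
      "counit_right \<complex>[\<Gamma>] (J' \<otimes>\<^bsub>\<complex>[\<Gamma>2]\<^esub> ?d \<otimes>\<^bsub>\<complex>[\<Gamma>2]\<^esub> J) = u"
      using u H.l_one[of u] H.r_one[of u]
      by (simp_all add: counit_legs_push pushes J_counit J'_counit push_push push_id)
  qed
qed

text \<open>
  The R-matrix identities reduce to cancellation because \<open>\<complex>[\<Gamma>]\<close> is cocommutative, that is, the
  flip fixes \<open>\<Delta>(u)\<close>. The hexagons come from \<open>hexagon_identity\<close> and permuted twist equations.
\<close>

lemma twisted_triangular: "triangular_hopf_algebra (twisted \<complex>[\<Gamma>] J) R"
proof (intro triangular_hopf_algebra.intro quasitriangular_hopf_algebra.intro hopf_algebra.intro
    hopf_algebra_axioms.intro twisted_bialgebra exI quasitriangular_hopf_algebra_axioms.intro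
    triangular_hopf_algebra_axioms.intro; (rule twisted_antipode)?; (unfold twisted_simps)?)
  let ?s = "push (\<lambda>(a, b). (b, a)) :: _ \<Rightarrow> ('a \<times> 'a \<Rightarrow>\<^sub>0 complex)"
  show "R \<in> Units (tensor_sq \<complex>[\<Gamma>])"
    using swap_unit J_unit by simp
  have swap_inverse: "?s J' \<otimes>\<^bsub>\<complex>[\<Gamma>2]\<^esub> (?s J \<otimes>\<^bsub>\<complex>[\<Gamma>2]\<^esub> w) = w" 
    "?s J \<otimes>\<^bsub>\<complex>[\<Gamma>2]\<^esub> (?s J' \<otimes>\<^bsub>\<complex>[\<Gamma>2]\<^esub> w) = w"
    "J \<otimes>\<^bsub>\<complex>[\<Gamma>2]\<^esub> (J' \<otimes>\<^bsub>\<complex>[\<Gamma>2]\<^esub> w) = w" if "w \<in> F2" for w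
    using that H2.Units_cancel[OF swap_unit, of w] H2.Units_cancel(2)[OF J_unit, of w]
    by (simp_all add: swap_inv)
  have swap_mult: "?s (v \<otimes>\<^bsub>\<complex>[\<Gamma>2]\<^esub> w) = ?s v \<otimes>\<^bsub>\<complex>[\<Gamma>2]\<^esub> ?s w" if "v \<in> F2" "w \<in> F2" for v w
    using that swap_hom by (intro push_mult) simp_all
  have swap_swap: "?s (?s w) = w" for w
    by (simp add: push_push case_prod_unfold push_id)
  show "inv\<^bsub>tensor_sq \<complex>[\<Gamma>]\<^esub> R = tensor_flip R"
    using swap_inverse H2.Units_l_inv[OF swap_unit]
    by (auto intro!: H2.inv_char simp: H2.m_assoc swap_mult swap_swap tensor_flip_push swap_inv)
  fix u assume u: "u \<in> F1"
  then show "R \<otimes>\<^bsub>tensor_sq \<complex>[\<Gamma>]\<^esub> (J' \<otimes>\<^bsub>\<complex>[\<Gamma>2]\<^esub> push (\<lambda>g. (g, g)) u \<otimes>\<^bsub>\<complex>[\<Gamma>2]\<^esub> J) =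
      tensor_flip (J' \<otimes>\<^bsub>\<complex>[\<Gamma>2]\<^esub> push (\<lambda>g. (g, g)) u \<otimes>\<^bsub>\<complex>[\<Gamma>2]\<^esub> J) \<otimes>\<^bsub>tensor_sq \<complex>[\<Gamma>]\<^esub> R"
    using swap_inverse
    by (simp add: H2.m_assoc swap_mult tensor_flip_push swap_inv push_push)
next
  let ?l21 = "push (\<lambda>(a, b). (b, a)) J'"
  have R: "R = ?l21 \<otimes>\<^bsub>\<complex>[\<Gamma>2]\<^esub> J" and RF: "R \<in> F2"
    by (simp_all add: swap_inv)
  note units = leg_unit[OF _ _ monoid_3] and closed = push_leg_closed[OF _ J_closed(1)]
  \<comment> \<open>The first two permutations serve the first hexagon, the other two the second.\<close>
  have cycle: "(\<lambda>(a, b, c). (b, c, a)) \<in> hom \<Gamma>3 \<Gamma>3" "(\<lambda>(a, b, c). (a, c, b)) \<in> hom \<Gamma>3 \<Gamma>3"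
    "(\<lambda>(a, b, c). (c, a, b)) \<in> hom \<Gamma>3 \<Gamma>3" "(\<lambda>(a, b, c). (b, a, c)) \<in> hom \<Gamma>3 \<Gamma>3"
    by (auto simp: hom_def)
  have legs: "push f R = push (\<lambda>(a, b). f (b, a)) J' \<otimes>\<^bsub>\<complex>[\<Gamma>3]\<^esub> push f J" if "f \<in> hom \<Gamma>2 \<Gamma>3" for f
    unfolding R push_leg_mult[OF that push_F2[OF J_closed(2)] J_closed(1)]
    by (simp add: push_push case_prod_unfold)
  show "comult_left (twisted \<complex>[\<Gamma>] J) R = leg13 \<complex>[\<Gamma>] R \<otimes>\<^bsub>tensor_cube \<complex>[\<Gamma>]\<^esub> leg23 \<complex>[\<Gamma>] R"
    using H3.hexagon_identity[of "push (\<lambda>(a, b). (a, b, \<one>)) J" "push (\<lambda>(a, b). (b, b, a)) J"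
        "push (\<lambda>(a, b). (b, \<one>, a)) J" "push (\<lambda>(a, b). (\<one>, b, a)) J" "push (\<lambda>(a, b). (a, b, a)) J"
        "push (\<lambda>(a, b). (a, a, b)) J" "push (\<lambda>(a, b). (a, b, b)) J"
        "push (\<lambda>(a, b). (a, \<one>, b)) J" "push (\<lambda>(a, b). (\<one>, a, b)) J"]
      twist_equation twist_equation_permuted[OF cycle(1)] twist_equation_permuted[OF cycle(2)]
    by (simp add: twisted_comult_left[OF RF] leg_push legs leg_homs units closed
        del: group_algebra_simps)
  show "comult_right (twisted \<complex>[\<Gamma>] J) R = leg13 \<complex>[\<Gamma>] R \<otimes>\<^bsub>tensor_cube \<complex>[\<Gamma>]\<^esub> leg12 \<complex>[\<Gamma>] R"
    using H3.hexagon_identity[of "push (\<lambda>(a, b). (\<one>, a, b)) J" "push (\<lambda>(a, b). (b, a, a)) J"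
        "push (\<lambda>(a, b). (b, \<one>, a)) J" "push (\<lambda>(a, b). (b, a, \<one>)) J" "push (\<lambda>(a, b). (b, a, b)) J"
        "push (\<lambda>(a, b). (a, b, b)) J" "push (\<lambda>(a, b). (a, a, b)) J"
        "push (\<lambda>(a, b). (a, \<one>, b)) J" "push (\<lambda>(a, b). (a, b, \<one>)) J"]
      twist_equation twist_equation_permuted[OF cycle(3)] twist_equation_permuted[OF cycle(4)]
    by (simp add: twisted_comult_right[OF RF] leg_push legs leg_homs units closed
        del: group_algebra_simps)
qed

lemma carrier_hopf_subalgebra: "hopf_subalgebra (twisted \<complex>[\<Gamma>] J) F1"
  unfolding hopf_subalgebra_def subalgebra_def
proof (intro conjI ballI allI impI)
  fix u assume u: "u \<in> F1"
  have "comult (twisted \<complex>[\<Gamma>] J) u \<in> F2"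
    using u by simp
  moreover have "F2 \<subseteq> free.span {tensor v w |v w. v \<in> F1 \<and> w \<in> F1}"
  proof (rule free_space_subset_span)
    fix p assume "p \<in> carrier \<Gamma> \<times> carrier \<Gamma>"
    then have "bvec p = tensor (bvec (fst p)) (bvec (snd p))"
      "bvec (fst p) \<in> F1" "bvec (snd p) \<in> F1" by auto
    then show "bvec p \<in> free.span {tensor v w |v w. v \<in> F1 \<and> w \<in> F1}"
      by (intro free.span_base) blast
  qed
  ultimately show "comult (twisted \<complex>[\<Gamma>] J) u \<in> free.span {tensor v w |v w. v \<in> F1 \<and> w \<in> F1}"
    by blast
next
  fix S assume "is_antipode (twisted \<complex>[\<Gamma>] J) S"
  then show "S ` F1 \<subseteq> F1"
    by (auto simp: is_antipode_def)
qed (auto simp: free_space_subspace)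

text \<open>
  It suffices that both spans are everything, since the whole algebra is a Hopf subalgebra of itself.
\<close>

lemma twisted_minimal:
  assumes left: "\<And>n x y. tensor_decomposition \<complex>[\<Gamma>] R n x y \<Longrightarrow> F1 \<subseteq> free.span (x ` {..<n})"
    and right: "\<And>n x y. tensor_decomposition \<complex>[\<Gamma>] R n x y \<Longrightarrow> F1 \<subseteq> free.span (y ` {..<n})"
  shows "minimal_quasitriangular_hopf_algebra (twisted \<complex>[\<Gamma>] J) R"
proof -
  interpret triangular_hopf_algebra "twisted \<complex>[\<Gamma>] J" R by (rule twisted_triangular)
  have spans: "free.span (x ` {..<n}) = F1" "free.span (y ` {..<n}) = F1"
    if "shortest_decomposition (twisted \<complex>[\<Gamma>] J) R n x y" for n x y
  proof -
    have dec: "tensor_decomposition \<complex>[\<Gamma>] R n x y"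
      using that by (simp add: shortest_decomposition_def tensor_decomposition_def)
    then have "x ` {..<n} \<subseteq> F1" "y ` {..<n} \<subseteq> F1"
      by (auto simp: tensor_decomposition_def)
    then show "free.span (x ` {..<n}) = F1" "free.span (y ` {..<n}) = F1"
      using left[OF dec] right[OF dec] span_subset_free_space by blast+
  qed
  have "subalgebra (twisted \<complex>[\<Gamma>] J) F1"
    using carrier_hopf_subalgebra by (simp add: hopf_subalgebra_def)
  then have "subalgebra (twisted \<complex>[\<Gamma>] J) hull F1 = F1"
    by (rule hull_same)
  then show ?thesis
    by unfold_locales (simp_all add: spans carrier_hopf_subalgebra)
qed

end

section \<open>Characters of finite abelian groups\<close>

lemma (in group) subgroup_nat_pow_closed:
  "subgroup B G \<Longrightarrow> x \<in> B \<Longrightarrow> x [^] (k::nat) \<in> B"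
  using subgroup_int_pow_closed[of B x "int k"] by (simp add: int_pow_int)

text \<open>
  Division with remainder: the remainder would otherwise be a smaller positive exponent.
\<close>

lemma (in comm_group) subgroup_pow_dvd:
  assumes B: "subgroup B G" and a: "a \<in> carrier G" and m: "m = (LEAST k. 0 < k \<and> a [^] k \<in> B)"
    and "a [^] (k::nat) \<in> B"
  shows "m dvd k"
proof (cases "k = 0")
  case False
  then have ex: "0 < m \<and> a [^] m \<in> B"
    unfolding m using assms(4) by (intro LeastI[of "\<lambda>k. 0 < k \<and> a [^] k \<in> B" k]) simp
  have "a [^] k = (a [^] m) [^] (k div m) \<otimes> a [^] (k mod m)"
    using a by (simp add: nat_pow_pow nat_pow_mult)
  moreover have am: "(a [^] m) [^] (k div m) \<in> B"
    using ex B by (simp add: subgroup_nat_pow_closed)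
  ultimately have "a [^] (k mod m) = inv ((a [^] m) [^] (k div m)) \<otimes> a [^] k"
    using a by (simp add: inv_solve_left)
  then have "a [^] (k mod m) \<in> B"
    using B am assms(4) by (simp add: subgroup.m_closed subgroup.m_inv_closed)
  moreover have "k mod m < m"
    using ex by simp
  ultimately have "k mod m = 0"
    using not_less_Least[of "k mod m" "\<lambda>k. 0 < k \<and> a [^] k \<in> B"] unfolding m[symmetric] by auto
  then show ?thesis by auto
qed simp

definition partial_character :: "('a, 'm) monoid_scheme \<Rightarrow> 'a set \<Rightarrow> ('a \<Rightarrow> complex) \<Rightarrow> bool" where
  "partial_character A B \<chi> \<longleftrightarrow> subgroup B A \<and>
    (\<forall>x\<in>B. \<chi> x \<noteq> 0) \<and> (\<forall>x\<in>B. \<forall>y\<in>B. \<chi> (x \<otimes>\<^bsub>A\<^esub> y) = \<chi> x * \<chi> y)"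

text \<open>
  Let \<open>m\<close> be least with \<open>a\<^sup>m \<in> B\<close>. A character of \<open>B\<close> extends to the group generated by \<open>B\<close> and
  \<open>a\<close> by sending \<open>a\<close> to any \<open>m\<close>-th root of \<open>\<chi>(a\<^sup>m)\<close>. As \<open>m \<ge> 2\<close> there are at least two such
  roots, so the value at \<open>a\<close> can be chosen different from \<open>1\<close>.
\<close>

lemma (in comm_group) character_extends:
  assumes fin: "finite (carrier G)" and \<chi>: "partial_character G B \<chi>"
    and a: "a \<in> carrier G" "a \<notin> B"
  obtains C \<psi> where "partial_character G C \<psi>" "B \<subset> C" "a \<in> C" "\<psi> a \<noteq> 1"
    "\<And>x. x \<in> B \<Longrightarrow> \<psi> x = \<chi> x"
proof -
  have B: "subgroup B G" and nz: "\<And>x. x \<in> B \<Longrightarrow> \<chi> x \<noteq> 0"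
    and mult: "\<And>x y. x \<in> B \<Longrightarrow> y \<in> B \<Longrightarrow> \<chi> (x \<otimes> y) = \<chi> x * \<chi> y"
    using \<chi> by (auto simp: partial_character_def)
  have BG: "\<And>x. x \<in> B \<Longrightarrow> x \<in> carrier G"
    using subgroup.subset[OF B] by auto
  define m where "m = (LEAST k. 0 < k \<and> a [^] (k::nat) \<in> B)"
  have "0 < ord a \<and> a [^] ord a \<in> B"
    using ord_ge_1[OF fin a(1)] a by (simp add: pow_ord_eq_1 subgroup.one_closed[OF B])
  then have m: "0 < m" "a [^] m \<in> B"
    unfolding m_def using LeastI[of "\<lambda>k. 0 < k \<and> a [^] k \<in> B" "ord a"] by simp_all
  have "m \<noteq> 1"
    using m a by auto
  then have "2 \<le> card {z. z ^ m = \<chi> (a [^] m)}"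
    using m nz by (subst card_nth_roots) auto
  then have "\<not> {z. z ^ m = \<chi> (a [^] m)} \<subseteq> {1}"
    using card_mono[of "{1::complex}" "{z. z ^ m = \<chi> (a [^] m)}"] by auto
  then obtain z where z: "z ^ m = \<chi> (a [^] m)" "z \<noteq> 1" by auto
  have z0: "z \<noteq> 0"
    using z(1) m nz by (auto simp: power_0_left)
  have pow: "\<chi> (x [^] q) = \<chi> x ^ q" if "x \<in> B" for x and q :: nat
  proof (induction q)
    case 0
    have "\<chi> \<one> * \<chi> \<one> = \<chi> \<one> * 1"
      using mult[of \<one> \<one>] subgroup.one_closed[OF B] by simp
    then show ?case using nz[of \<one>] subgroup.one_closed[OF B] by simp
  next
    case (Suc q)
    then show ?case
      using that B by (simp add: mult subgroup_nat_pow_closed)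
  qed
  \<comment> \<open>The value \<open>\<chi>(b) z\<^sup>k\<close> at \<open>b a\<^sup>k\<close> does not depend on the representation.\<close>
  have wd: "\<chi> b * z ^ k = \<chi> c * z ^ l"
    if "b \<in> B" "c \<in> B" "b \<otimes> a [^] k = c \<otimes> a [^] l" "k \<le> l" for b c k l
  proof -
    have "b = c \<otimes> a [^] (l - k)"
    proof -
      have "b \<otimes> a [^] k = c \<otimes> a [^] (l - k) \<otimes> a [^] k"
        using that a BG by (simp add: m_assoc nat_pow_mult)
      then show ?thesis
        using that a BG by simp
    qed
    moreover from this have "a [^] (l - k) = inv c \<otimes> b"
      using that a BG by (simp add: inv_solve_left)
    then have "a [^] (l - k) \<in> B"
      using that B by (simp add: subgroup.m_closed subgroup.m_inv_closed)
    moreover from subgroup_pow_dvd[OF B a(1) m_def this] obtain q where q: "l - k = m * q" ..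
    ultimately have "\<chi> b = \<chi> c * \<chi> (a [^] (l - k))" "\<chi> (a [^] (l - k)) = z ^ (l - k)"
      using that mult[of c "a [^] (l - k)"] pow[OF m(2), of q] a z
      by (simp_all add: nat_pow_pow power_mult)
    then show ?thesis
      using that(4) by (simp flip: power_add)
  qed
  have wd': "\<chi> b * z ^ k = \<chi> c * z ^ l"
    if "b \<in> B" "c \<in> B" "b \<otimes> a [^] k = c \<otimes> a [^] l" for b c k l
    using wd[of b c k l] wd[of c b l k] that by (cases "k \<le> l") auto
  define C where "C = {b \<otimes> a [^] k | b k::nat. b \<in> B}"
  define \<psi> where "\<psi> x = (SOME w. \<exists>b k. b \<in> B \<and> x = b \<otimes> a [^] (k::nat) \<and> w = \<chi> b * z ^ k)" for x
  have \<psi>: "\<psi> (b \<otimes> a [^] k) = \<chi> b * z ^ k" if "b \<in> B" for b k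
  proof -
    have "\<exists>c l. c \<in> B \<and> b \<otimes> a [^] k = c \<otimes> a [^] l \<and> \<psi> (b \<otimes> a [^] k) = \<chi> c * z ^ l"
      unfolding \<psi>_def by (rule someI_ex) (use that in blast)
    then show ?thesis using wd'[OF that] by auto
  qed
  have prod: "(b \<otimes> a [^] k) \<otimes> (c \<otimes> a [^] l) = (b \<otimes> c) \<otimes> a [^] (k + l)"
    if "b \<in> B" "c \<in> B" for b c and k l :: nat
    using that a BG by (simp add: m_ac flip: nat_pow_mult)
  have C: "subgroup C G"
  proof (rule subgroupI)
    show "C \<subseteq> carrier G" "C \<noteq> {}"
      using BG a subgroup.one_closed[OF B] by (auto simp: C_def)
    show mult_C: "x \<otimes> y \<in> C" if "x \<in> C" "y \<in> C" for x y
      using that prod subgroup.m_closed[OF B] unfolding C_def by blast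
    have one_C: "\<one> \<in> C"
    proof -
      have "\<one> = \<one> \<otimes> a [^] (0::nat)" by simp
      then show ?thesis
        using subgroup.one_closed[OF B] unfolding C_def by blast
    qed
    show "inv x \<in> C" if x: "x \<in> C" for x
    proof -
      have xG: "x \<in> carrier G"
        using x BG a by (auto simp: C_def)
      \<comment> \<open>In a finite group the inverse is a power.\<close>
      have "x [^] k \<in> C" for k :: nat
        using x mult_C one_C by (induction k) auto
      moreover have "x [^] (ord x - 1) \<otimes> x = \<one>"
        using ord_ge_1[OF fin xG] pow_ord_eq_1[OF xG] xG nat_pow_Suc[of x "ord x - 1"] by simp
      then have "inv x = x [^] (ord x - 1)"
        using xG by (simp add: inv_equality)
      ultimately show ?thesis by simp
    qed
  qed
  have BC: "b \<in> C \<and> \<psi> b = \<chi> b" if "b \<in> B" for b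
  proof -
    have "b \<otimes> a [^] (0::nat) \<in> C"
      using that unfolding C_def by blast
    then show ?thesis
      using that BG \<psi>[OF that, of 0] by simp
  qed
  have one: "\<one> \<in> B" "\<chi> \<one> = 1"
    using subgroup.one_closed[OF B] pow[of \<one> 0] by auto
  have aC: "a \<in> C" "\<psi> a = z"
  proof -
    have "\<one> \<otimes> a [^] (1::nat) \<in> C"
      using one unfolding C_def by blast
    then show "a \<in> C" "\<psi> a = z"
      using one a \<psi>[of \<one> 1] by simp_all
  qed
  have "partial_character G C \<psi>"
    unfolding partial_character_def
  proof (intro conjI ballI C)
    show "\<psi> x \<noteq> 0" if "x \<in> C" for x
      using that \<psi> nz z0 by (auto simp: C_def)
    show "\<psi> (x \<otimes> y) = \<psi> x * \<psi> y" if xy: "x \<in> C" "y \<in> C" for x y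
    proof -
      obtain b k c l where "b \<in> B" "c \<in> B" "x = b \<otimes> a [^] (k::nat)" "y = c \<otimes> a [^] (l::nat)"
        using xy unfolding C_def by blast
      then show ?thesis
        by (simp add: prod \<psi> subgroup.m_closed[OF B] mult power_add)
    qed
  qed
  then show ?thesis
    using that[of C \<psi>] BC aC z a by blast
qed

text \<open>
  Extend the trivial character of the trivial subgroup so that its value at \<open>x\<close> is not \<open>1\<close>, then
  keep extending; a maximal subgroup carrying such an extension is the whole group.
\<close>

lemma (in comm_group) characters_separate:
  assumes fin: "finite (carrier G)" and x: "x \<in> carrier G" "x \<noteq> \<one>"
  obtains \<chi> where "\<chi> \<in> carrier (dual_group G)" "\<chi> x \<noteq> 1"
proof -
  define P where "P C \<longleftrightarrow> (\<exists>\<psi>. partial_character G C \<psi> \<and> x \<in> C \<and> \<psi> x \<noteq> 1)" for C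
  have "partial_character G {\<one>} (\<lambda>_. 1)"
    by (simp add: partial_character_def triv_subgroup)
  then obtain C0 where "P C0"
    using character_extends[OF fin _ x(1)] x(2) unfolding P_def by (metis singletonD)
  moreover have sub: "C \<subseteq> carrier G" if "P C" for C
    using that by (auto simp: P_def partial_character_def dest: subgroup.subset)
  moreover have "finite {C. P C}"
    using fin sub by (auto intro: finite_subset[of _ "Pow (carrier G)"])
  ultimately obtain C where C: "P C" and max: "\<And>D. P D \<Longrightarrow> C \<subseteq> D \<Longrightarrow> D = C"
    using finite_has_maximal[of "{C. P C}"] by blast
  then obtain \<psi> where \<psi>: "partial_character G C \<psi>" "x \<in> C" "\<psi> x \<noteq> 1"
    by (auto simp: P_def)
  have "C = carrier G"
  proof (rule ccontr)
    assume "C \<noteq> carrier G"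
    then obtain a where "a \<in> carrier G" "a \<notin> C"
      using sub[OF C] by blast
    from character_extends[OF fin \<psi>(1) this] obtain D \<phi> where
      "partial_character G D \<phi>" "C \<subset> D" "\<And>y. y \<in> C \<Longrightarrow> \<phi> y = \<psi> y" by metis
    then show False
      using max[of D] \<psi> unfolding P_def by (metis psubset_eq subsetD)
  qed
  then have "restrict \<psi> (carrier G) \<in> carrier (dual_group G)"
    using \<psi>(1) by (auto simp: dual_group_def hom_def nonzero_complex_def partial_character_def)
  then show ?thesis
    using that[of "restrict \<psi> (carrier G)"] \<psi> x by simp
qed

locale finite_abelian_group = comm_group A for A (structure) +
  assumes finite_carrier: "finite (carrier A)"
begin

abbreviation "dual \<equiv> dual_group A"

lemma character_iff:
  "\<chi> \<in> carrier dual \<longleftrightarrow> \<chi> \<in> extensional (carrier A) \<and> (\<forall>x\<in>carrier A. \<chi> x \<noteq> 0) \<and>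
    (\<forall>x\<in>carrier A. \<forall>y\<in>carrier A. \<chi> (x \<otimes> y) = \<chi> x * \<chi> y)"
  by (auto simp: dual_group_def hom_def nonzero_complex_def)

lemma character_nonzero: "\<chi> \<in> carrier dual \<Longrightarrow> x \<in> carrier A \<Longrightarrow> \<chi> x \<noteq> 0"
  and character_mult: "\<chi> \<in> carrier dual \<Longrightarrow> x \<in> carrier A \<Longrightarrow> y \<in> carrier A \<Longrightarrow>
    \<chi> (x \<otimes> y) = \<chi> x * \<chi> y"
  by (auto simp: character_iff)

lemma character_one: "\<chi> \<in> carrier dual \<Longrightarrow> \<chi> \<one> = 1"
  using character_mult[of \<chi> \<one> \<one>] character_nonzero[of \<chi> \<one>] by simp

lemma character_inv:
  assumes "\<chi> \<in> carrier dual" and "x \<in> carrier A"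
  shows "\<chi> (inv x) = 1 / \<chi> x"
  using character_mult[of \<chi> x "inv x"] character_nonzero[of \<chi> x] character_one[of \<chi>] assms
  by (simp add: field_simps)

lemma dual_simps:
  "\<one>\<^bsub>dual\<^esub> = (\<lambda>x\<in>carrier A. 1)"
  "\<chi> \<otimes>\<^bsub>dual\<^esub> \<psi> = (\<lambda>x\<in>carrier A. \<chi> x * \<psi> x)"
  by (simp_all add: dual_group_def)

lemma group_dual: "group dual"
proof (rule groupI)
  fix \<chi> assume \<chi>: "\<chi> \<in> carrier dual"
  show "\<one>\<^bsub>dual\<^esub> \<otimes>\<^bsub>dual\<^esub> \<chi> = \<chi>"
    using \<chi> by (auto simp: dual_simps character_iff fun_eq_iff extensional_def)
  have "(\<lambda>x\<in>carrier A. 1 / \<chi> x) \<in> carrier dual"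
    using \<chi> by (auto simp: character_iff)
  moreover have "(\<lambda>x\<in>carrier A. 1 / \<chi> x) \<otimes>\<^bsub>dual\<^esub> \<chi> = \<one>\<^bsub>dual\<^esub>"
    using \<chi> by (auto simp: dual_simps fun_eq_iff character_iff)
  ultimately show "\<exists>\<psi>\<in>carrier dual. \<psi> \<otimes>\<^bsub>dual\<^esub> \<chi> = \<one>\<^bsub>dual\<^esub>" by blast
qed (auto simp: dual_simps character_iff)

sublocale dual: group dual by (rule group_dual)

lemma finite_dual: "finite (carrier dual)"
proof (rule finite_subset)
  let ?n = "order A"
  show "carrier dual \<subseteq> PiE (carrier A) (\<lambda>_. {z. z ^ ?n = 1})"
  proof
    fix \<chi> assume \<chi>: "\<chi> \<in> carrier dual"
    have "\<chi> x ^ ?n = 1" if x: "x \<in> carrier A" for x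
    proof -
      have "\<chi> (x [^] k) = \<chi> x ^ k" for k :: nat
        using \<chi> x by (induction k) (simp_all add: character_one character_mult)
      then show ?thesis
        using pow_order_eq_1[OF x] character_one[OF \<chi>] by metis
    qed
    then show "\<chi> \<in> PiE (carrier A) (\<lambda>_. {z. z ^ ?n = 1})"
      using \<chi> by (auto simp: character_iff PiE_iff)
  qed
  have "?n > 0"
    using finite_carrier by (auto simp: order_gt_0_iff_finite)
  then show "finite (PiE (carrier A) (\<lambda>_. {z::complex. z ^ ?n = 1}))"
    using finite_carrier by (intro finite_PiE) (auto intro: finite_nth_roots)
qed

text \<open>
  Translating the summation variable by \<open>y\<close> multiplies the sum by \<open>\<chi>(y)\<close>.
\<close>

lemma character_sum:
  assumes \<chi>: "\<chi> \<in> carrier dual"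
  shows "(\<Sum>x\<in>carrier A. \<chi> x) = (if \<chi> = \<one>\<^bsub>dual\<^esub> then of_nat (card (carrier A)) else 0)"
proof (cases "\<chi> = \<one>\<^bsub>dual\<^esub>")
  case False
  moreover have "\<chi> = \<one>\<^bsub>dual\<^esub>" if "\<forall>y\<in>carrier A. \<chi> y = 1"
    using \<chi> that unfolding dual_simps character_iff
    by (intro extensionalityI[of _ "carrier A"]) auto
  ultimately obtain y where y: "y \<in> carrier A" "\<chi> y \<noteq> 1" by blast
  have "(\<Sum>x\<in>carrier A. \<chi> x) = (\<Sum>x\<in>carrier A. \<chi> (y \<otimes> x))"
    by (rule sum.reindex_bij_witness[of _ "\<lambda>x. y \<otimes> x" "\<lambda>x. inv y \<otimes> x"])
      (use y m_assoc[of y "inv y", symmetric] m_assoc[of "inv y" y, symmetric] in simp_all)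
  also have "\<dots> = \<chi> y * (\<Sum>x\<in>carrier A. \<chi> x)"
    using y \<chi> by (simp add: character_mult sum_distrib_left)
  finally show ?thesis using y False by simp
qed (simp add: dual_simps)

text \<open>
  The dual argument translates by a character, and here one that is not \<open>1\<close> at \<open>x\<close> is needed.
\<close>

lemma dual_sum_nontrivial:
  assumes x: "x \<in> carrier A" "x \<noteq> \<one>"
  shows "(\<Sum>\<chi>\<in>carrier dual. \<chi> x) = 0"
proof -
  obtain \<psi> where \<psi>: "\<psi> \<in> carrier dual" "\<psi> x \<noteq> 1"
    using characters_separate[OF finite_carrier x] .
  have "(\<Sum>\<chi>\<in>carrier dual. \<chi> x) = (\<Sum>\<chi>\<in>carrier dual. (\<psi> \<otimes>\<^bsub>dual\<^esub> \<chi>) x)"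
    by (rule sum.reindex_bij_witness[of _ "\<lambda>\<chi>. \<psi> \<otimes>\<^bsub>dual\<^esub> \<chi>" "\<lambda>\<chi>. inv\<^bsub>dual\<^esub> \<psi> \<otimes>\<^bsub>dual\<^esub> \<chi>"])
      (use \<psi> dual.m_assoc[of \<psi> "inv\<^bsub>dual\<^esub> \<psi>", symmetric]
         dual.m_assoc[of "inv\<^bsub>dual\<^esub> \<psi>" \<psi>, symmetric] in simp_all)
  also have "\<dots> = \<psi> x * (\<Sum>\<chi>\<in>carrier dual. \<chi> x)"
    using x by (simp add: dual_simps sum_distrib_left)
  finally show ?thesis using \<psi> by simp
qed

text \<open>
  Sum \<open>\<chi>(x)\<close> over all \<open>\<chi>\<close> and \<open>x\<close> in both orders.
\<close>

lemma card_dual: "card (carrier dual) = card (carrier A)"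
proof -
  have "of_nat (card (carrier dual)) = (\<Sum>x\<in>carrier A. \<Sum>\<chi>\<in>carrier dual. \<chi> x)"
    using finite_carrier
    by (subst sum.remove[of _ \<one>]) (simp_all add: dual_sum_nontrivial character_one)
  also have "\<dots> = (\<Sum>\<chi>\<in>carrier dual. \<Sum>x\<in>carrier A. \<chi> x)"
    by (rule sum.swap)
  also have "\<dots> = (of_nat (card (carrier A)) :: complex)"
    using finite_dual by (simp add: character_sum)
  finally show ?thesis
    using of_nat_eq_iff by blast
qed

lemma dual_sum:
  assumes "x \<in> carrier A"
  shows "(\<Sum>\<chi>\<in>carrier dual. \<chi> x) = (if x = \<one> then of_nat (card (carrier A)) else 0)"
  using assms by (simp add: dual_sum_nontrivial character_one card_dual)

end

section \<open>The semidirect product with the dual group\<close>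

locale bijective_cocycle = finite_abelian_group A + G: group G
  for A :: "('a, 'n) monoid_scheme" (structure) and G :: "('g, 'm) monoid_scheme" +
  fixes \<rho> :: "'g \<Rightarrow> 'a \<Rightarrow> 'a" and \<pi> :: "'g \<Rightarrow> 'a"
  assumes finite_G: "finite (carrier G)"
    and \<rho>_hom: "\<rho> \<in> hom G (AutoGroup A)"
    and cocycle: "cocycle G A \<rho> \<pi>"
    and bij: "bij_betw \<pi> (carrier G) (carrier A)"
begin

lemma \<rho>_auto: "g \<in> carrier G \<Longrightarrow> \<rho> g \<in> auto A"
  using \<rho>_hom by (auto simp: hom_def AutoGroup_def)

lemma \<rho>_closed [simp]: "g \<in> carrier G \<Longrightarrow> x \<in> carrier A \<Longrightarrow> \<rho> g x \<in> carrier A"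
  using \<rho>_auto[of g] by (auto simp: auto_def hom_def)

lemma \<rho>_mult: "g \<in> carrier G \<Longrightarrow> x \<in> carrier A \<Longrightarrow> y \<in> carrier A \<Longrightarrow>
    \<rho> g (x \<otimes> y) = \<rho> g x \<otimes> \<rho> g y"
  using \<rho>_auto[of g] by (auto simp: auto_def hom_def)

lemma \<rho>_comp:
  assumes "g \<in> carrier G" "h \<in> carrier G" "x \<in> carrier A"
  shows "\<rho> (g \<otimes>\<^bsub>G\<^esub> h) x = \<rho> g (\<rho> h x)"
  using hom_mult[OF \<rho>_hom assms(1,2)] \<rho>_auto[of g] \<rho>_auto[of h] assms
  by (simp add: AutoGroup_def BijGroup_def auto_def compose_def)

lemma \<rho>_one: "x \<in> carrier A \<Longrightarrow> \<rho> \<one>\<^bsub>G\<^esub> x = x"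
  using \<rho>_comp[of "\<one>\<^bsub>G\<^esub>" "\<one>\<^bsub>G\<^esub>" x] \<rho>_auto[of "\<one>\<^bsub>G\<^esub>"]
  by (auto simp: auto_def Bij_def bij_betw_def dest: inj_onD)

lemma \<rho>_inv [simp]:
  assumes "g \<in> carrier G" "x \<in> carrier A"
  shows "\<rho> (inv\<^bsub>G\<^esub> g) (\<rho> g x) = x" "\<rho> g (\<rho> (inv\<^bsub>G\<^esub> g) x) = x"
  using assms by (simp_all add: \<rho>_one flip: \<rho>_comp)

abbreviation "act \<equiv> dual_action G A \<rho>"

lemma act_apply [simp]: "x \<in> carrier A \<Longrightarrow> act g \<chi> x = \<chi> (\<rho> (inv\<^bsub>G\<^esub> g) x)"
  by (simp add: dual_action_def)

lemma dual_eqI: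
  assumes "\<chi> \<in> carrier dual" "\<psi> \<in> carrier dual" "\<And>x. x \<in> carrier A \<Longrightarrow> \<chi> x = \<psi> x"
  shows "\<chi> = \<psi>"
  using assms by (auto simp: character_iff intro: extensionalityI)

lemma dual_apply [simp]:
  "x \<in> carrier A \<Longrightarrow> (\<chi> \<otimes>\<^bsub>dual\<^esub> \<psi>) x = \<chi> x * \<psi> x"
  "x \<in> carrier A \<Longrightarrow> \<one>\<^bsub>dual\<^esub> x = 1"
  by (simp_all add: dual_simps)

lemma act_closed [simp]:
  assumes "g \<in> carrier G" "\<chi> \<in> carrier dual"
  shows "act g \<chi> \<in> carrier dual"
  using assms by (auto simp: character_iff \<rho>_mult) (simp add: dual_action_def)

lemma act_mult:
  "g \<in> carrier G \<Longrightarrow> \<chi> \<in> carrier dual \<Longrightarrow> \<psi> \<in> carrier dual \<Longrightarrow>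
    act g (\<chi> \<otimes>\<^bsub>dual\<^esub> \<psi>) = act g \<chi> \<otimes>\<^bsub>dual\<^esub> act g \<psi>"
  by (intro dual_eqI) simp_all

lemma act_comp:
  "g \<in> carrier G \<Longrightarrow> h \<in> carrier G \<Longrightarrow> \<chi> \<in> carrier dual \<Longrightarrow>
    act (g \<otimes>\<^bsub>G\<^esub> h) \<chi> = act g (act h \<chi>)"
  by (intro dual_eqI) (simp_all add: G.inv_mult_group \<rho>_comp)

lemma act_one [simp]: "\<chi> \<in> carrier dual \<Longrightarrow> act \<one>\<^bsub>G\<^esub> \<chi> = \<chi>"
  by (intro dual_eqI) (simp_all add: \<rho>_one)

lemma act_trivial [simp]: "g \<in> carrier G \<Longrightarrow> act g \<one>\<^bsub>dual\<^esub> = \<one>\<^bsub>dual\<^esub>"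
  by (intro dual_eqI) simp_all

lemma act_inv [simp]:
  assumes "g \<in> carrier G" "\<chi> \<in> carrier dual"
  shows "act (inv\<^bsub>G\<^esub> g) (act g \<chi>) = \<chi>" "act g (act (inv\<^bsub>G\<^esub> g) \<chi>) = \<chi>"
  using assms by (simp_all flip: act_comp)

abbreviation "G' \<equiv> semidirect_dual G A \<rho>"

lemma semidirect_simps [simp]:
  "carrier G' = carrier G \<times> carrier dual"
  "\<one>\<^bsub>G'\<^esub> = (\<one>\<^bsub>G\<^esub>, \<one>\<^bsub>dual\<^esub>)"
  "(g, \<chi>) \<otimes>\<^bsub>G'\<^esub> (h, \<psi>) = (g \<otimes>\<^bsub>G\<^esub> h, \<chi> \<otimes>\<^bsub>dual\<^esub> act g \<psi>)"
  by (simp_all add: semidirect_dual_def)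

lemma group_semidirect: "group G'"
proof (rule groupI)
  fix p assume "p \<in> carrier G'"
  then obtain g \<chi> where p: "p = (g, \<chi>)" "g \<in> carrier G" "\<chi> \<in> carrier dual" by auto
  then show "\<one>\<^bsub>G'\<^esub> \<otimes>\<^bsub>G'\<^esub> p = p" by simp
  have "(inv\<^bsub>G\<^esub> g, act (inv\<^bsub>G\<^esub> g) (inv\<^bsub>dual\<^esub> \<chi>)) \<otimes>\<^bsub>G'\<^esub> p = \<one>\<^bsub>G'\<^esub>"
    using p by (simp flip: act_mult)
  then show "\<exists>q\<in>carrier G'. q \<otimes>\<^bsub>G'\<^esub> p = \<one>\<^bsub>G'\<^esub>"
    using p by (intro bexI[of _ "(inv\<^bsub>G\<^esub> g, act (inv\<^bsub>G\<^esub> g) (inv\<^bsub>dual\<^esub> \<chi>))"]) auto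
qed (auto simp: act_mult act_comp G.m_assoc dual.m_assoc)

sublocale S: group G' by (rule group_semidirect)
sublocale H: monoid "\<complex>[G']" by (rule S.monoid_group_algebra)

section \<open>The idempotents of the dual group\<close>

abbreviation "F1 \<equiv> free_space (carrier G \<times> carrier dual)"
abbreviation "gvec g \<equiv> bvec (emb_group A g)"
abbreviation "dvec \<chi> \<equiv> bvec (emb_dual G \<chi>)"

lemma emb_simps:
  "emb_group A g = (g, \<one>\<^bsub>dual\<^esub>)"
  "emb_dual G \<chi> = (\<one>\<^bsub>G\<^esub>, \<chi>)"
  by (simp_all add: emb_group_def emb_dual_def)

lemma emb_closed [simp]:
  "emb_group A g \<in> carrier G \<times> carrier dual \<longleftrightarrow> g \<in> carrier G"
  "emb_dual G \<chi> \<in> carrier G \<times> carrier dual \<longleftrightarrow> \<chi> \<in> carrier dual"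
  by (simp_all add: emb_simps)

lemma emb_mult:
  "g \<in> carrier G \<Longrightarrow>
    emb_group A g \<otimes>\<^bsub>G'\<^esub> emb_group A h = emb_group A (g \<otimes>\<^bsub>G\<^esub> h)"
  "\<psi> \<in> carrier dual \<Longrightarrow>
    emb_dual G \<chi> \<otimes>\<^bsub>G'\<^esub> emb_dual G \<psi> = emb_dual G (\<chi> \<otimes>\<^bsub>dual\<^esub> \<psi>)"
  "g \<in> carrier G \<Longrightarrow> \<chi> \<in> carrier dual \<Longrightarrow>
    emb_dual G \<chi> \<otimes>\<^bsub>G'\<^esub> emb_group A g = (g, \<chi>)"
  "g \<in> carrier G \<Longrightarrow> \<chi> \<in> carrier dual \<Longrightarrow>
    emb_group A g \<otimes>\<^bsub>G'\<^esub> emb_dual G \<chi> = (g, act g \<chi>)"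
  by (simp_all add: emb_simps)

abbreviation "N \<equiv> of_nat (card (carrier A)) :: complex"

lemma card_nonzero [simp]: "card (carrier A) \<noteq> 0"
  using finite_carrier by auto

text \<open>
  The primitive idempotent of the group algebra of the dual on which \<open>\<chi>\<close> acts as \<open>\<chi>(x)\<inverse>\<close>.
\<close>

definition idem :: "'a \<Rightarrow> ('g \<times> ('a \<Rightarrow> complex) \<Rightarrow>\<^sub>0 complex)" where
  "idem x = smul (1 / N) (\<Sum>\<chi>\<in>carrier dual. smul (\<chi> x) (dvec \<chi>))"

lemma idem_closed [simp]: "idem x \<in> F1"
  unfolding idem_def by (auto intro!: free_space_smul free_space_sum)

lemma mult_F1 [simp]: "u \<in> F1 \<Longrightarrow> v \<in> F1 \<Longrightarrow> u \<otimes>\<^bsub>\<complex>[G']\<^esub> v \<in> F1"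
  using H.m_closed by simp

lemma dual_idem:
  assumes \<chi>: "\<chi> \<in> carrier dual" and x: "x \<in> carrier A"
  shows "dvec \<chi> \<otimes>\<^bsub>\<complex>[G']\<^esub> idem x = smul (1 / \<chi> x) (idem x)"
proof -
  have "(\<Sum>\<psi>\<in>carrier dual. smul (\<psi> x) (dvec (\<chi> \<otimes>\<^bsub>dual\<^esub> \<psi>))) =
      smul (1 / \<chi> x) (\<Sum>\<psi>\<in>carrier dual. smul (\<psi> x) (dvec \<psi>))"
    unfolding free.scale_sum_right
    by (rule sum.reindex_bij_witness[of _ "\<lambda>\<psi>. inv\<^bsub>dual\<^esub> \<chi> \<otimes>\<^bsub>dual\<^esub> \<psi>" "\<lambda>\<psi>. \<chi> \<otimes>\<^bsub>dual\<^esub> \<psi>"])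
      (use \<chi> x character_nonzero[OF \<chi> x] dual.m_assoc[of \<chi> "inv\<^bsub>dual\<^esub> \<chi>", symmetric]
         dual.m_assoc[of "inv\<^bsub>dual\<^esub> \<chi>" \<chi>, symmetric] in simp_all)
  then show ?thesis
    using \<chi> by (simp add: idem_def mult_smul_right mult_sum_right emb_mult mult.commute)
qed

lemma idem_idem:
  assumes "x \<in> carrier A" "y \<in> carrier A"
  shows "idem x \<otimes>\<^bsub>\<complex>[G']\<^esub> idem y = (if x = y then idem x else 0)"
proof -
  have "idem x \<otimes>\<^bsub>\<complex>[G']\<^esub> idem y =
      smul (1 / N) (\<Sum>\<chi>\<in>carrier dual. smul (\<chi> x / \<chi> y) (idem y))"
    unfolding idem_def[of x] using assms by (simp add: mult_smul_left mult_sum_left dual_idem)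
  also have "(\<Sum>\<chi>\<in>carrier dual. smul (\<chi> x / \<chi> y) (idem y)) =
      smul (\<Sum>\<chi>\<in>carrier dual. \<chi> (x \<otimes> inv y)) (idem y)"
    using assms by (simp add: free.scale_sum_left character_mult character_inv)
  also have "x \<otimes> inv y = \<one> \<longleftrightarrow> x = y"
    using assms by (metis inv_closed inv_equality inv_inv r_inv)
  then have "(\<Sum>\<chi>\<in>carrier dual. \<chi> (x \<otimes> inv y)) = (if x = y then N else 0)"
    using assms by (simp add: dual_sum)
  finally show ?thesis by simp
qed

lemma group_idem:
  assumes g: "g \<in> carrier G" and x: "x \<in> carrier A"
  shows "gvec g \<otimes>\<^bsub>\<complex>[G']\<^esub> idem x = idem (\<rho> g x) \<otimes>\<^bsub>\<complex>[G']\<^esub> gvec g"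
proof -
  have "(\<Sum>\<chi>\<in>carrier dual. smul (\<chi> x) (bvec (g, act g \<chi>))) =
      (\<Sum>\<chi>\<in>carrier dual. smul (\<chi> (\<rho> g x)) (bvec (g, \<chi>)))"
    by (rule sum.reindex_bij_witness[of _ "act (inv\<^bsub>G\<^esub> g)" "act g"]) (use g x in simp_all)
  then show ?thesis
    using g by (simp add: idem_def mult_smul_left mult_smul_right mult_sum_left mult_sum_right
        emb_mult)
qed

lemma sum_idem: "(\<Sum>x\<in>carrier A. idem x) = bvec (\<one>\<^bsub>G\<^esub>, \<one>\<^bsub>dual\<^esub>)"
proof -
  have "(\<Sum>x\<in>carrier A. idem x) =
      smul (1 / N) (\<Sum>\<chi>\<in>carrier dual. smul (\<Sum>x\<in>carrier A. \<chi> x) (dvec \<chi>))"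
    unfolding idem_def free.scale_sum_right[symmetric]
    by (subst sum.swap) (simp add: free.scale_sum_left)
  also have "(\<Sum>\<chi>\<in>carrier dual. smul (\<Sum>x\<in>carrier A. \<chi> x) (dvec \<chi>)) =
      (\<Sum>\<chi>\<in>{\<one>\<^bsub>dual\<^esub>}. smul N (dvec \<chi>))"
    by (rule sum.mono_neutral_cong_right) (auto simp: character_sum finite_dual)
  finally show ?thesis by (simp add: emb_simps)
qed

lemma dual_expansion:
  assumes "\<chi> \<in> carrier dual"
  shows "dvec \<chi> = (\<Sum>x\<in>carrier A. smul (1 / \<chi> x) (idem x))"
proof -
  have "dvec \<chi> = dvec \<chi> \<otimes>\<^bsub>\<complex>[G']\<^esub> (\<Sum>x\<in>carrier A. idem x)"
    using H.r_one[of "dvec \<chi>"] assms by (simp add: sum_idem)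
  then show ?thesis
    using assms by (simp add: mult_sum_right dual_idem)
qed

text \<open>
  A usable form of the coproduct formula \<open>\<Delta>(e\<^sub>x) = \<Sum>\<^bsub>yz = x\<^esub> e\<^sub>y \<otimes> e\<^sub>z\<close>: multiplication by \<open>1 \<otimes> e\<^sub>w\<close>
  selects the summand with \<open>z = w\<close>, and it turns each \<open>\<chi>\<close> in the second factor into a scalar.
\<close>

lemma comult_idem:
  assumes "x \<in> carrier A" "w \<in> carrier A"
  shows "push (\<lambda>g. (g, g)) (idem x) \<otimes>\<^bsub>\<complex>[G' \<times>\<times> G']\<^esub> tensor (bvec \<one>\<^bsub>G'\<^esub>) (idem w) =
    tensor (idem (x \<otimes> inv w)) (idem w)"
proof -
  have "dvec \<chi> \<otimes>\<^bsub>\<complex>[G']\<^esub> bvec \<one>\<^bsub>G'\<^esub> = dvec \<chi>" if "\<chi> \<in> carrier dual" for \<chi>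
    using that H.r_one[of "dvec \<chi>"] by simp
  then have "bvec (emb_dual G \<chi>, emb_dual G \<chi>) \<otimes>\<^bsub>\<complex>[G' \<times>\<times> G']\<^esub> tensor (bvec \<one>\<^bsub>G'\<^esub>) (idem w) =
      smul (1 / \<chi> w) (tensor (dvec \<chi>) (idem w))" if "\<chi> \<in> carrier dual" for \<chi>
    using that assms dual_idem[OF that assms(2)]
    by (subst tensor_bvec[symmetric], subst tensor_mult) (simp_all add: tensor_smul_right)
  then show ?thesis
    unfolding idem_def[of x] idem_def[of "x \<otimes> inv w"] using assms
    by (simp add: push_smul push_sum mult_smul_left mult_sum_left tensor_smul_left tensor_sum_left
        character_mult character_inv del: semidirect_simps)
qed

text \<open>
  The coefficient at the unit detects the group part of \<open>e\<^sub>x g\<close>; it will separate the terms of \<open>R\<close>.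
\<close>

lemma lookup_idem:
  assumes "g \<in> carrier G" and "x \<in> carrier A"
  shows "Poly_Mapping.lookup (idem x \<otimes>\<^bsub>\<complex>[G']\<^esub> gvec g) (\<one>\<^bsub>G\<^esub>, \<one>\<^bsub>dual\<^esub>) =
    (if g = \<one>\<^bsub>G\<^esub> then 1 / N else 0)"
proof -
  have "idem x \<otimes>\<^bsub>\<complex>[G']\<^esub> gvec g = smul (1 / N) (\<Sum>\<chi>\<in>carrier dual. smul (\<chi> x) (bvec (g, \<chi>)))"
    using assms by (simp add: idem_def mult_smul_left mult_sum_left emb_mult)
  then show ?thesis
    using assms finite_dual
    by (simp add: lookup_smul lookup_sum lookup_bvec if_distrib[of "\<lambda>x. _ * x"] sum.delta
        cong: if_cong)
qed

lemma counit_idem: "x \<in> carrier A \<Longrightarrow> counit \<complex>[G'] (idem x) = (if x = \<one> then 1 else 0)"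
  by (simp add: counit_lookup idem_def push_smul push_sum lookup_smul lookup_sum lookup_bvec dual_sum)

section \<open>The twist of a bijective cocycle\<close>

abbreviation "\<pi>_inv \<equiv> inv_into (carrier G) \<pi>"

lemma \<pi>_closed [simp]: "g \<in> carrier G \<Longrightarrow> \<pi> g \<in> carrier A"
  using bij by (auto simp: bij_betw_def)

lemma \<pi>_mult: "g \<in> carrier G \<Longrightarrow> h \<in> carrier G \<Longrightarrow> \<pi> (g \<otimes>\<^bsub>G\<^esub> h) = \<pi> g \<otimes> \<rho> g (\<pi> h)"
  using cocycle by (simp add: cocycle_def)

lemma \<pi>_eq_iff [simp]: "g \<in> carrier G \<Longrightarrow> h \<in> carrier G \<Longrightarrow> \<pi> g = \<pi> h \<longleftrightarrow> g = h"
  using bij by (auto simp: bij_betw_def dest: inj_onD)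

lemma \<pi>_one: "\<pi> \<one>\<^bsub>G\<^esub> = \<one>"
  using \<pi>_mult[of "\<one>\<^bsub>G\<^esub>" "\<one>\<^bsub>G\<^esub>"] by (simp add: \<rho>_one)

lemma \<pi>_inv_simps [simp]:
  "x \<in> carrier A \<Longrightarrow> \<pi>_inv x \<in> carrier G"
  "x \<in> carrier A \<Longrightarrow> \<pi> (\<pi>_inv x) = x"
  "g \<in> carrier G \<Longrightarrow> \<pi>_inv (\<pi> g) = g"
  using bij by (auto simp: bij_betw_def intro: inv_into_into f_inv_into_f)

lemma sum_\<pi>: "(\<Sum>x\<in>carrier A. f x) = (\<Sum>g\<in>carrier G. f (\<pi> g))"
  by (rule sum.reindex_bij_betw[OF bij, symmetric])

abbreviation "J \<equiv> cocycle_twist G A \<pi>"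

text \<open>
  Indexing by \<open>G\<close> rather than \<open>A\<close> avoids the inverse of \<open>\<pi>\<close> in all computations.
\<close>

lemma cocycle_twist_idem: "J = (\<Sum>g\<in>carrier G. tensor (gvec g) (idem (\<pi> g)))"
proof -
  have "J = (\<Sum>x\<in>carrier A. tensor (gvec (\<pi>_inv x)) (idem x))"
    by (simp add: cocycle_twist_def idem_def tensor_smul_right tensor_sum_right free.scale_sum_right)
  then show ?thesis by (simp add: sum_\<pi>)
qed

definition J_inverse where
  "J_inverse = (\<Sum>g\<in>carrier G. tensor (gvec (inv\<^bsub>G\<^esub> g)) (idem (\<pi> g)))"

abbreviation "K2 \<equiv> \<complex>[G' \<times>\<times> G']"
abbreviation "K3 \<equiv> \<complex>[G' \<times>\<times> G' \<times>\<times> G']"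

sublocale K2: monoid K2
  by (intro monoid.monoid_group_algebra DirProd_monoid S.is_monoid)

lemma tensor_mult':
  assumes "u \<in> F1" "v \<in> F1" "u' \<in> F1" "v' \<in> F1"
  shows "tensor u v \<otimes>\<^bsub>K2\<^esub> tensor u' v' = tensor (u \<otimes>\<^bsub>\<complex>[G']\<^esub> u') (v \<otimes>\<^bsub>\<complex>[G']\<^esub> v')"
  using assms by (intro tensor_mult) simp_all

lemma gvec_mult: "g \<in> carrier G \<Longrightarrow> h \<in> carrier G \<Longrightarrow>
    gvec g \<otimes>\<^bsub>\<complex>[G']\<^esub> gvec h = gvec (g \<otimes>\<^bsub>G\<^esub> h)"
  by (simp add: emb_mult)

lemma J_mult_inverse:
  "J \<otimes>\<^bsub>K2\<^esub> J_inverse = \<one>\<^bsub>K2\<^esub>" "J_inverse \<otimes>\<^bsub>K2\<^esub> J = \<one>\<^bsub>K2\<^esub>"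
proof -
  have one: "(\<Sum>g\<in>carrier G. tensor (gvec \<one>\<^bsub>G\<^esub>) (idem (\<pi> g))) = \<one>\<^bsub>K2\<^esub>"
    by (simp add: sum_idem emb_simps flip: tensor_sum_right sum_\<pi>)
  have *: "(\<Sum>g\<in>carrier G. tensor (gvec (f g)) (idem (\<pi> g))) \<otimes>\<^bsub>K2\<^esub>
      (\<Sum>g\<in>carrier G. tensor (gvec (h g)) (idem (\<pi> g))) = \<one>\<^bsub>K2\<^esub>"
    if fh: "\<And>g. g \<in> carrier G \<Longrightarrow> f g \<in> carrier G \<and> h g \<in> carrier G \<and> f g \<otimes>\<^bsub>G\<^esub> h g = \<one>\<^bsub>G\<^esub>" for f h
  proof -
    have "tensor (gvec (f g)) (idem (\<pi> g)) \<otimes>\<^bsub>K2\<^esub> tensor (gvec (h k)) (idem (\<pi> k)) =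
        (if k = g then tensor (gvec \<one>\<^bsub>G\<^esub>) (idem (\<pi> g)) else 0)"
      if "g \<in> carrier G" "k \<in> carrier G" for g k
      using that fh[of g] fh[of k]
      by (simp add: tensor_mult' gvec_mult idem_idem tensor_zero_right del: mult_bvec)
    then have "(\<Sum>g\<in>carrier G. \<Sum>k\<in>carrier G.
          tensor (gvec (f g)) (idem (\<pi> g)) \<otimes>\<^bsub>K2\<^esub> tensor (gvec (h k)) (idem (\<pi> k))) =
        (\<Sum>g\<in>carrier G. \<Sum>k\<in>carrier G. if k = g then tensor (gvec \<one>\<^bsub>G\<^esub>) (idem (\<pi> g)) else 0)"
      by (intro sum.cong refl) blast
    also have "\<dots> = \<one>\<^bsub>K2\<^esub>"
      unfolding one[symmetric] using finite_G by (intro sum.cong refl) simp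
    finally show ?thesis
      by (subst (asm) sum.swap) (simp only: mult_sum_left mult_sum_right)
  qed
  show "J \<otimes>\<^bsub>K2\<^esub> J_inverse = \<one>\<^bsub>K2\<^esub>" "J_inverse \<otimes>\<^bsub>K2\<^esub> J = \<one>\<^bsub>K2\<^esub>"
    unfolding cocycle_twist_idem J_inverse_def by (rule *; simp)+
qed

lemma J_closed: "J \<in> carrier K2" "J_inverse \<in> carrier K2"
  unfolding cocycle_twist_idem J_inverse_def
  by (auto intro!: free_space_sum tensor_closed)

lemma J_unit: "J \<in> Units K2" and inv_J: "inv\<^bsub>K2\<^esub> J = J_inverse"
  using J_mult_inverse J_closed K2.inv_char unfolding Units_def by blast+

lemma push_tensor_bvec:
  "push (\<lambda>(a, b). (a, a, b)) (tensor (bvec c) v) = tensor (bvec c) (tensor (bvec c) v)"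
  "push (\<lambda>(a, b). (a, b, b)) (tensor (bvec c) v) = tensor (bvec c) (push (\<lambda>g. (g, g)) v)"
  "push (\<lambda>(a, b). (a, b, d)) (tensor (bvec c) v) = tensor (bvec c) (tensor v (bvec d))"
  "push snd (tensor (bvec c) v) = v"
  by (simp_all add: tensor_bvec_left tensor_bvec_right push_push push_id)

lemma sum_shift:
  assumes g: "g \<in> carrier G"
  shows "(\<Sum>k\<in>carrier G. f k) = (\<Sum>h\<in>carrier G. f (g \<otimes>\<^bsub>G\<^esub> h))"
  by (rule sum.reindex_bij_witness[of _ "\<lambda>h. g \<otimes>\<^bsub>G\<^esub> h" "\<lambda>k. inv\<^bsub>G\<^esub> g \<otimes>\<^bsub>G\<^esub> k"])
    (use g G.m_assoc[of g "inv\<^bsub>G\<^esub> g", symmetric] G.m_assoc[of "inv\<^bsub>G\<^esub> g" g, symmetric]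
      in simp_all)

text \<open>
  Both sides are expanded over pairs. On the right-hand side the first factor \<open>k\<close> is written as
  \<open>gh\<close>, and the cocycle identity turns \<open>\<pi>(k) / \<pi>(g)\<close> into \<open>\<rho>(g) \<pi>(h)\<close>; moving the idempotent
  past \<open>g\<close> gives the summand of the left-hand side.
\<close>

lemma cocycle_twist_equation:
  "push (\<lambda>(a, b). (a, a, b)) J \<otimes>\<^bsub>K3\<^esub> push (\<lambda>(a, b). (a, b, \<one>\<^bsub>G'\<^esub>)) J =
   push (\<lambda>(a, b). (a, b, b)) J \<otimes>\<^bsub>K3\<^esub> push (\<lambda>(a, b). (\<one>\<^bsub>G'\<^esub>, a, b)) J"
proof -
  let ?F2 = "free_space ((carrier G \<times> carrier dual) \<times> carrier G \<times> carrier dual)"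
  have F2: "tensor u v \<in> ?F2" if "u \<in> F1" "v \<in> F1" for u v
    using that by (auto intro: tensor_closed)
  have d2: "push (\<lambda>g. (g, g)) (idem x) \<in> ?F2" for x
    by (rule push_closed[OF idem_closed]) auto
  have t3: "tensor u s \<otimes>\<^bsub>K3\<^esub> tensor v t = tensor (u \<otimes>\<^bsub>\<complex>[G']\<^esub> v) (s \<otimes>\<^bsub>K2\<^esub> t)"
    if "u \<in> F1" "v \<in> F1" "s \<in> ?F2" "t \<in> ?F2"
    for u v s t
    using that by (intro tensor_mult) simp_all
  have one: "\<one>\<^bsub>G'\<^esub> \<in> carrier G \<times> carrier dual" "u \<in> F1 \<Longrightarrow> u \<otimes>\<^bsub>\<complex>[G']\<^esub> bvec \<one>\<^bsub>G'\<^esub> = u"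
    "u \<in> F1 \<Longrightarrow> bvec \<one>\<^bsub>G'\<^esub> \<otimes>\<^bsub>\<complex>[G']\<^esub> u = u" for u
    using H.r_one[of u] H.l_one[of u] by simp_all
  let ?t = "\<lambda>g h. tensor (gvec (g \<otimes>\<^bsub>G\<^esub> h))
    (tensor (gvec g \<otimes>\<^bsub>\<complex>[G']\<^esub> idem (\<pi> h)) (idem (\<pi> g)))"
  have left: "tensor (gvec g) (tensor (gvec g) (idem (\<pi> g))) \<otimes>\<^bsub>K3\<^esub>
      tensor (gvec h) (tensor (idem (\<pi> h)) (bvec \<one>\<^bsub>G'\<^esub>)) = ?t g h"
    if "g \<in> carrier G" "h \<in> carrier G" for g h
    using that by (simp add: t3 F2 one gvec_mult tensor_mult' del: mult_bvec tensor_bvec semidirect_simps(2,3))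
  have right: "tensor (gvec (g \<otimes>\<^bsub>G\<^esub> h)) (push (\<lambda>g. (g, g)) (idem (\<pi> (g \<otimes>\<^bsub>G\<^esub> h)))) \<otimes>\<^bsub>K3\<^esub>
      tensor (bvec \<one>\<^bsub>G'\<^esub>) (tensor (gvec g) (idem (\<pi> g))) = ?t g h"
    if gh: "g \<in> carrier G" "h \<in> carrier G" for g h
  proof -
    have "tensor (gvec g) (idem (\<pi> g)) =
        tensor (bvec \<one>\<^bsub>G'\<^esub>) (idem (\<pi> g)) \<otimes>\<^bsub>K2\<^esub> tensor (gvec g) (bvec \<one>\<^bsub>G'\<^esub>)"
      using gh by (simp add: tensor_mult' one del: mult_bvec tensor_bvec semidirect_simps(2,3))
    then have "push (\<lambda>g. (g, g)) (idem (\<pi> (g \<otimes>\<^bsub>G\<^esub> h))) \<otimes>\<^bsub>K2\<^esub> tensor (gvec g) (idem (\<pi> g)) =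
      tensor (idem (\<pi> (g \<otimes>\<^bsub>G\<^esub> h) \<otimes> inv (\<pi> g))) (idem (\<pi> g)) \<otimes>\<^bsub>K2\<^esub> tensor (gvec g) (bvec \<one>\<^bsub>G'\<^esub>)"
      using gh d2 F2 one K2.m_assoc comult_idem[of "\<pi> (g \<otimes>\<^bsub>G\<^esub> h)" "\<pi> g"]
      by (simp del: mult_bvec tensor_bvec semidirect_simps(2,3) flip: K2.m_assoc)
    also have "\<pi> (g \<otimes>\<^bsub>G\<^esub> h) \<otimes> inv (\<pi> g) = \<rho> g (\<pi> h)"
      using gh by (simp add: \<pi>_mult m_comm[of _ "inv (\<pi> g)"] flip: m_assoc)
    also have "tensor (idem (\<rho> g (\<pi> h))) (idem (\<pi> g)) \<otimes>\<^bsub>K2\<^esub> tensor (gvec g) (bvec \<one>\<^bsub>G'\<^esub>) =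
        tensor (gvec g \<otimes>\<^bsub>\<complex>[G']\<^esub> idem (\<pi> h)) (idem (\<pi> g))"
      using gh by (simp add: tensor_mult' one group_idem del: mult_bvec tensor_bvec semidirect_simps(2,3))
    finally show ?thesis
      using gh by (simp add: t3 F2 d2 one del: mult_bvec tensor_bvec semidirect_simps(2,3))
  qed
  have "push (\<lambda>(a, b). (a, b, b)) J \<otimes>\<^bsub>K3\<^esub> push (\<lambda>(a, b). (\<one>\<^bsub>G'\<^esub>, a, b)) J =
      (\<Sum>g\<in>carrier G. \<Sum>k\<in>carrier G. tensor (gvec k) (push (\<lambda>g. (g, g)) (idem (\<pi> k))) \<otimes>\<^bsub>K3\<^esub>
        tensor (bvec \<one>\<^bsub>G'\<^esub>) (tensor (gvec g) (idem (\<pi> g))))"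
    by (simp add: cocycle_twist_idem push_sum push_tensor_bvec mult_sum_left mult_sum_right
        tensor_bvec_left[of "\<one>\<^bsub>G'\<^esub>", symmetric] case_prod_eta del: semidirect_simps(2,3))
  also have "\<dots> = (\<Sum>g\<in>carrier G. \<Sum>h\<in>carrier G. ?t g h)"
  proof (rule sum.cong[OF refl])
    fix g assume g: "g \<in> carrier G"
    show "(\<Sum>k\<in>carrier G. tensor (gvec k) (push (\<lambda>g. (g, g)) (idem (\<pi> k))) \<otimes>\<^bsub>K3\<^esub>
        tensor (bvec \<one>\<^bsub>G'\<^esub>) (tensor (gvec g) (idem (\<pi> g)))) = (\<Sum>h\<in>carrier G. ?t g h)"
      by (subst sum_shift[OF g]) (rule sum.cong[OF refl], rule right[OF g])
  qed
  also have "\<dots> = push (\<lambda>(a, b). (a, a, b)) J \<otimes>\<^bsub>K3\<^esub> push (\<lambda>(a, b). (a, b, \<one>\<^bsub>G'\<^esub>)) J"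
    by (subst sum.swap)
      (simp add: cocycle_twist_idem push_sum push_tensor_bvec mult_sum_left mult_sum_right left
        del: semidirect_simps(2,3))
  finally show ?thesis by simp
qed

lemma cocycle_twist_is_twist: "is_twist \<complex>[G'] J"
proof -
  have "push snd J = \<one>\<^bsub>\<complex>[G']\<^esub>"
    by (simp add: cocycle_twist_idem push_sum push_tensor_bvec sum_idem flip: sum_\<pi>)
  moreover have "push fst J = \<one>\<^bsub>\<complex>[G']\<^esub>"
  proof -
    have "push fst (tensor (gvec g) (idem (\<pi> g))) = (if g = \<one>\<^bsub>G\<^esub> then gvec \<one>\<^bsub>G\<^esub> else 0)"
      if "g \<in> carrier G" for g
      using that \<pi>_eq_iff[of g "\<one>\<^bsub>G\<^esub>"]
      by (simp add: tensor_bvec_left push_push counit_idem \<pi>_one del: \<pi>_eq_iff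
          flip: counit_push[of G'])
    then show ?thesis
      using finite_G by (simp add: cocycle_twist_idem push_sum emb_simps cong: sum.cong)
  qed
  ultimately show ?thesis
    using J_unit cocycle_twist_equation
    by (simp add: is_twist_def comult_legs_push leg_push counit_legs_push)
qed

section \<open>The universal R-matrix and minimality\<close>

sublocale twist: group_algebra_twist G' J
  by (intro group_algebra_twist.intro group_semidirect group_algebra_twist_axioms.intro
      cocycle_twist_is_twist)

abbreviation "left_basis g h \<equiv> idem (\<pi> g) \<otimes>\<^bsub>\<complex>[G']\<^esub> gvec h"
abbreviation "right_basis g h \<equiv> gvec (inv\<^bsub>G\<^esub> g) \<otimes>\<^bsub>\<complex>[G']\<^esub> idem (\<pi> h)"

lemma R_expansion:
  "twist.R = (\<Sum>g\<in>carrier G. \<Sum>h\<in>carrier G. tensor (left_basis g h) (right_basis g h))"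
proof -
  have swap: "push (\<lambda>(a, b). (b, a)) (tensor (bvec c) v) = tensor v (bvec c)"
    for c and v :: "'g \<times> ('a \<Rightarrow> complex) \<Rightarrow>\<^sub>0 complex"
    by (simp add: tensor_bvec_left tensor_bvec_right push_push)
  have "twist.R = (\<Sum>g\<in>carrier G. tensor (idem (\<pi> g)) (gvec (inv\<^bsub>G\<^esub> g))) \<otimes>\<^bsub>K2\<^esub>
      (\<Sum>h\<in>carrier G. tensor (gvec h) (idem (\<pi> h)))"
    unfolding twist.swap_inv inv_J by (simp only: J_inverse_def push_sum swap cocycle_twist_idem)
  also have "\<dots> = (\<Sum>h\<in>carrier G. \<Sum>g\<in>carrier G. tensor (left_basis g h) (right_basis g h))"
    by (simp add: mult_sum_left mult_sum_right tensor_mult')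
  finally show ?thesis by (subst sum.swap)
qed

lemma lookup_group_idem:
  assumes "g \<in> carrier G" and "x \<in> carrier A"
  shows "Poly_Mapping.lookup (gvec g \<otimes>\<^bsub>\<complex>[G']\<^esub> idem x) (\<one>\<^bsub>G\<^esub>, \<one>\<^bsub>dual\<^esub>) =
    (if g = \<one>\<^bsub>G\<^esub> then 1 / N else 0)"
  using assms by (simp add: group_idem lookup_idem)

lemma mult_zero [simp]: "u \<otimes>\<^bsub>\<complex>[G']\<^esub> 0 = 0" "0 \<otimes>\<^bsub>\<complex>[G']\<^esub> u = 0"
  using mult_smul_right[of G' u 0 0] mult_smul_left[of G' 0 0 u] by simp_all

lemma double_delta_sum:
  assumes "g \<in> carrier G" "h \<in> carrier G"
  shows "(\<Sum>g'\<in>carrier G. \<Sum>h'\<in>carrier G.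
      smul (if g' = g \<and> h' = h then c else 0) (f g' h')) = smul c (f g h)"
proof -
  have "(\<Sum>g'\<in>carrier G. \<Sum>h'\<in>carrier G. smul (if g' = g \<and> h' = h then c else 0) (f g' h')) =
      (\<Sum>g'\<in>carrier G. \<Sum>h'\<in>carrier G. if h' = h then if g' = g then smul c (f g h) else 0 else 0)"
    by (intro sum.cong refl) auto
  then show ?thesis using assms finite_G by simp
qed

text \<open>
  The functional \<open>v \<mapsto> (g v e\<^bsub>\<pi>(h)\<^esub>)(1)\<close>, where \<open>(1)\<close> is the coefficient at the unit, kills every
  \<open>g'\<inverse> e\<^bsub>\<pi>(h')\<^esub>\<close> except the one with \<open>g' = g\<close> and \<open>h' = h\<close>, where its value is \<open>1/|A|\<close>. So slicing
  \<open>R\<close> with it isolates a single left factor.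
\<close>

lemma left_basis_in_span:
  assumes dec: "tensor_decomposition \<complex>[G'] twist.R n x y"
    and gh: "g \<in> carrier G" "h \<in> carrier G"
  shows "left_basis g h \<in> free.span (x ` {..<n})"
proof -
  let ?F = "\<lambda>v. gvec g \<otimes>\<^bsub>\<complex>[G']\<^esub> v \<otimes>\<^bsub>\<complex>[G']\<^esub> idem (\<pi> h)"
  let ?d = "(\<one>\<^bsub>G\<^esub>, \<one>\<^bsub>dual\<^esub>)"
  have F: "linear_map ?F" by (intro linear_intros)
  have coeff: "Poly_Mapping.lookup (?F (right_basis g' h')) ?d =
      (if g' = g \<and> h' = h then 1 / N else 0)"
    if "g' \<in> carrier G" "h' \<in> carrier G" for g' h'
  proof -
    have "?F (right_basis g' h') =
        gvec g \<otimes>\<^bsub>\<complex>[G']\<^esub> gvec (inv\<^bsub>G\<^esub> g') \<otimes>\<^bsub>\<complex>[G']\<^esub> (idem (\<pi> h') \<otimes>\<^bsub>\<complex>[G']\<^esub> idem (\<pi> h))"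
      using gh that by (simp add: H.m_assoc del: mult_bvec)
    also have "\<dots> = (if h' = h then gvec (g \<otimes>\<^bsub>G\<^esub> inv\<^bsub>G\<^esub> g') \<otimes>\<^bsub>\<complex>[G']\<^esub> idem (\<pi> h) else 0)"
      using gh that by (simp add: gvec_mult idem_idem del: mult_bvec)
    finally show ?thesis
      using gh that G.inv_equality[of g "inv\<^bsub>G\<^esub> g'"] by (auto simp: lookup_group_idem)
  qed
  have "slice_right ?F ?d twist.R =
      (\<Sum>g'\<in>carrier G. \<Sum>h'\<in>carrier G. smul (if g' = g \<and> h' = h then 1 / N else 0) (left_basis g' h'))"
    unfolding R_expansion slice_sum slice_tensor[OF F] by (intro sum.cong refl) (simp only: coeff)
  also have "\<dots> = smul (1 / N) (left_basis g h)"
    using gh by (rule double_delta_sum)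
  finally have "smul (1 / N) (left_basis g h) \<in> free.span (x ` {..<n})"
    using slice_in_span(1)[OF dec F, of ?d] by simp
  from free.span_scale[OF this, of N] show ?thesis by simp
qed

text \<open>
  The mirror image, with the functional \<open>v \<mapsto> (e\<^bsub>\<pi>(g)\<^esub> v h\<inverse>)(1)\<close>.
\<close>

lemma right_basis_in_span:
  assumes dec: "tensor_decomposition \<complex>[G'] twist.R n x y"
    and gh: "g \<in> carrier G" "h \<in> carrier G"
  shows "right_basis g h \<in> free.span (y ` {..<n})"
proof -
  let ?F = "\<lambda>v. idem (\<pi> g) \<otimes>\<^bsub>\<complex>[G']\<^esub> v \<otimes>\<^bsub>\<complex>[G']\<^esub> gvec (inv\<^bsub>G\<^esub> h)"
  let ?d = "(\<one>\<^bsub>G\<^esub>, \<one>\<^bsub>dual\<^esub>)"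
  have F: "linear_map ?F" by (intro linear_intros)
  have coeff: "Poly_Mapping.lookup (?F (left_basis g' h')) ?d =
      (if g' = g \<and> h' = h then 1 / N else 0)"
    if "g' \<in> carrier G" "h' \<in> carrier G" for g' h'
  proof -
    have "?F (left_basis g' h') =
        idem (\<pi> g) \<otimes>\<^bsub>\<complex>[G']\<^esub> idem (\<pi> g') \<otimes>\<^bsub>\<complex>[G']\<^esub> (gvec h' \<otimes>\<^bsub>\<complex>[G']\<^esub> gvec (inv\<^bsub>G\<^esub> h))"
      using gh that by (simp add: H.m_assoc del: mult_bvec)
    also have "\<dots> = (if g' = g then idem (\<pi> g) \<otimes>\<^bsub>\<complex>[G']\<^esub> gvec (h' \<otimes>\<^bsub>G\<^esub> inv\<^bsub>G\<^esub> h) else 0)"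
      using gh that by (auto simp: gvec_mult idem_idem simp del: mult_bvec)
    finally show ?thesis
      using gh that G.inv_equality[of h' "inv\<^bsub>G\<^esub> h"] by (auto simp: lookup_idem)
  qed
  have "slice_left ?F ?d twist.R =
      (\<Sum>g'\<in>carrier G. \<Sum>h'\<in>carrier G. smul (if g' = g \<and> h' = h then 1 / N else 0) (right_basis g' h'))"
    unfolding R_expansion slice_sum slice_left_tensor[OF F]
    by (intro sum.cong refl) (simp only: coeff)
  also have "\<dots> = smul (1 / N) (right_basis g h)"
    using gh by (rule double_delta_sum)
  finally have "smul (1 / N) (right_basis g h) \<in> free.span (y ` {..<n})"
    using slice_in_span(2)[OF dec F, of ?d] by simp
  from free.span_scale[OF this, of N] show ?thesis by simp
qed

text \<open>
  The products of idempotents and group elements span the group algebra, because the idempotents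
  span the group algebra of the dual (\<open>dual_expansion\<close>).
\<close>

lemma R_minimal: "minimal_quasitriangular_hopf_algebra (twisted \<complex>[G'] J) twist.R"
proof (rule twist.twisted_minimal)
  fix n and x y :: "nat \<Rightarrow> 'g \<times> ('a \<Rightarrow> complex) \<Rightarrow>\<^sub>0 complex"
  assume dec: "tensor_decomposition \<complex>[G'] twist.R n x y"
  show "free_space (carrier G') \<subseteq> free.span (x ` {..<n})"
  proof (rule free_space_subset_span)
    fix p assume "p \<in> carrier G'"
    then obtain h \<chi> where p: "p = (h, \<chi>)" and *: "h \<in> carrier G" "\<chi> \<in> carrier dual" by auto
    have "bvec p = (\<Sum>z\<in>carrier A. smul (1 / \<chi> z) (idem z)) \<otimes>\<^bsub>\<complex>[G']\<^esub> gvec h"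
      using * by (simp add: p emb_mult flip: dual_expansion)
    also have "\<dots> = (\<Sum>g\<in>carrier G. smul (1 / \<chi> (\<pi> g)) (left_basis g h))"
      by (simp only: sum_\<pi> mult_sum_left mult_smul_left)
    also have "\<dots> \<in> free.span (x ` {..<n})"
      using * by (intro free.span_sum free.span_scale left_basis_in_span[OF dec])
    finally show "bvec p \<in> free.span (x ` {..<n})" .
  qed
  show "free_space (carrier G') \<subseteq> free.span (y ` {..<n})"
  proof (rule free_space_subset_span)
    fix p assume "p \<in> carrier G'"
    then obtain g \<chi> where p: "p = (g, \<chi>)" and *: "g \<in> carrier G" "\<chi> \<in> carrier dual" by auto
    let ?\<chi> = "act (inv\<^bsub>G\<^esub> g) \<chi>"
    have "bvec p = gvec g \<otimes>\<^bsub>\<complex>[G']\<^esub> (\<Sum>z\<in>carrier A. smul (1 / ?\<chi> z) (idem z))"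
      using * by (simp only: p emb_mult act_inv act_closed G.inv_closed mult_bvec
          flip: dual_expansion)
    also have "\<dots> = (\<Sum>h\<in>carrier G. smul (1 / ?\<chi> (\<pi> h)) (right_basis (inv\<^bsub>G\<^esub> g) h))"
      using * by (simp only: sum_\<pi> mult_sum_right mult_smul_right G.inv_inv)
    also have "\<dots> \<in> free.span (y ` {..<n})"
      using * by (intro free.span_sum free.span_scale right_basis_in_span[OF dec] G.inv_closed)
    finally show "bvec p \<in> free.span (y ` {..<n})" .
  qed
qed

abbreviation "is_T T \<equiv>
  \<forall>x\<in>carrier A. \<pi>_inv (inv x) \<otimes>\<^bsub>G\<^esub> \<pi>_inv (T x) = \<one>\<^bsub>G\<^esub>"

text \<open>
  Solving for \<open>T\<close> in the group gives an explicit map, from which existence, uniqueness and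
  bijectivity follow.
\<close>

lemma is_T_iff:
  assumes "T \<in> carrier A \<rightarrow>\<^sub>E carrier A"
  shows "is_T T \<longleftrightarrow> T = (\<lambda>x\<in>carrier A. \<pi> (inv\<^bsub>G\<^esub> \<pi>_inv (inv x)))"
proof -
  have "\<pi>_inv (inv x) \<otimes>\<^bsub>G\<^esub> \<pi>_inv (T x) = \<one>\<^bsub>G\<^esub> \<longleftrightarrow> T x = \<pi> (inv\<^bsub>G\<^esub> \<pi>_inv (inv x))"
    if "x \<in> carrier A" for x
  proof -
    have "T x \<in> carrier A" using assms that by auto
    then show ?thesis
      using that G.inv_equality[of "\<pi>_inv (T x)" "\<pi>_inv (inv x)"]
        G.inv_comm[of "\<pi>_inv (inv x)" "\<pi>_inv (T x)"]
      by (metis G.inv_closed G.r_inv inv_closed \<pi>_inv_simps)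
  qed
  then show ?thesis
    using assms by (auto simp: fun_eq_iff PiE_def extensional_def)
qed

lemma T_bij: "bij_betw (\<lambda>x\<in>carrier A. \<pi> (inv\<^bsub>G\<^esub> \<pi>_inv (inv x))) (carrier A) (carrier A)"
  by (rule bij_betw_byWitness[where f' = "\<lambda>x. inv (\<pi> (inv\<^bsub>G\<^esub> \<pi>_inv x))"]) auto

lemma idem_inv:
  assumes "y \<in> carrier A"
  shows "idem (inv y) = smul (1 / N) (\<Sum>\<chi>\<in>carrier dual. smul (1 / \<chi> y) (dvec \<chi>))"
  unfolding idem_def using assms by (simp add: character_inv)

text \<open>
  Collecting the sums over \<open>x\<^sup>*\<close> and \<open>y\<^sup>*\<close> into idempotents turns the formula into \<open>R_expansion\<close>
  reindexed by \<open>g = p(y\<inverse>)\<close> and \<open>h = p(x)\<close>.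
\<close>

lemma R_formula:
  assumes T: "T \<in> carrier A \<rightarrow>\<^sub>E carrier A" "is_T T"
  shows "twist.R = cocycle_R_matrix G A \<rho> \<pi> T"
proof -
  have T_eq: "\<pi>_inv (T y) = inv\<^bsub>G\<^esub> \<pi>_inv (inv y)" if "y \<in> carrier A" for y
    using T is_T_iff[OF T(1)] that by simp
  have "cocycle_R_matrix G A \<rho> \<pi> T = (\<Sum>x\<in>carrier A. \<Sum>y\<in>carrier A.
      tensor (idem (inv y) \<otimes>\<^bsub>\<complex>[G']\<^esub> gvec (\<pi>_inv x))
        (gvec (\<pi>_inv (T y)) \<otimes>\<^bsub>\<complex>[G']\<^esub> idem x))"
    unfolding cocycle_R_matrix_def free.scale_sum_right
  proof (intro sum.cong refl)
    fix x y assume xy: "x \<in> carrier A" "y \<in> carrier A"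
    show "(\<Sum>\<chi>\<in>carrier dual. \<Sum>\<psi>\<in>carrier dual. smul (1 / N ^ 2) (smul (\<psi> x / \<chi> y)
        (tensor (bvec (emb_dual G \<chi> \<otimes>\<^bsub>G'\<^esub> emb_group A (\<pi>_inv x)))
          (bvec (emb_group A (\<pi>_inv (T y)) \<otimes>\<^bsub>G'\<^esub> emb_dual G \<psi>))))) =
      tensor (idem (inv y) \<otimes>\<^bsub>\<complex>[G']\<^esub> gvec (\<pi>_inv x))
        (gvec (\<pi>_inv (T y)) \<otimes>\<^bsub>\<complex>[G']\<^esub> idem x)"
      unfolding idem_inv[OF xy(2)] idem_def[of x]
      by (subst sum.swap)
        (simp add: mult_smul_left mult_smul_right mult_sum_left mult_sum_right tensor_smul_left
          tensor_smul_right tensor_sum_left tensor_sum_right free.scale_sum_right power2_eq_square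
          mult.commute mult.left_commute del: tensor_bvec)
  qed
  also have "\<dots> = (\<Sum>y\<in>carrier A. \<Sum>x\<in>carrier A.
      tensor (idem (inv y) \<otimes>\<^bsub>\<complex>[G']\<^esub> gvec (\<pi>_inv x))
        (gvec (\<pi>_inv (T y)) \<otimes>\<^bsub>\<complex>[G']\<^esub> idem x))"
    by (rule sum.swap)
  also have "\<dots> = (\<Sum>y\<in>carrier A. \<Sum>x\<in>carrier A.
      tensor (idem (inv y) \<otimes>\<^bsub>\<complex>[G']\<^esub> gvec (\<pi>_inv x))
        (gvec (inv\<^bsub>G\<^esub> \<pi>_inv (inv y)) \<otimes>\<^bsub>\<complex>[G']\<^esub> idem x))"
    by (intro sum.cong refl) (simp only: T_eq)
  also have "\<dots> = (\<Sum>z\<in>carrier A. \<Sum>x\<in>carrier A.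
      tensor (idem z \<otimes>\<^bsub>\<complex>[G']\<^esub> gvec (\<pi>_inv x))
        (gvec (inv\<^bsub>G\<^esub> \<pi>_inv z) \<otimes>\<^bsub>\<complex>[G']\<^esub> idem x))"
    by (rule sum.reindex_bij_witness[of _ "m_inv A" "m_inv A"]) simp_all
  also have "\<dots> = twist.R"
    unfolding R_expansion sum_\<pi> by (intro sum.cong refl) simp
  finally show ?thesis ..
qed

end

theorem theorem4p2:
  fixes G :: "('g, 'm) monoid_scheme" and A :: "('a, 'n) monoid_scheme"
    and \<rho> :: "'g \<Rightarrow> 'a \<Rightarrow> 'a" and \<pi> :: "'g \<Rightarrow> 'a"
  assumes "group G" and "finite (carrier G)"
    and "comm_group A" and "finite (carrier A)"
    and "\<rho> \<in> hom G (AutoGroup A)"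
    and "cocycle G A \<rho> \<pi>" and "bij_betw \<pi> (carrier G) (carrier A)"
  shows "let H = group_algebra (semidirect_dual G A \<rho>);
             J = cocycle_twist G A \<pi>;
             R = inv\<^bsub>tensor_sq H\<^esub> (tensor_flip J) \<otimes>\<^bsub>tensor_sq H\<^esub> J;
             is_T = (\<lambda>T. \<forall>x\<in>carrier A.
               inv_into (carrier G) \<pi> (inv\<^bsub>A\<^esub> x) \<otimes>\<^bsub>G\<^esub> inv_into (carrier G) \<pi> (T x) = \<one>\<^bsub>G\<^esub>)
         in hopf_algebra H \<and>
            is_twist H J \<and>
            triangular_hopf_algebra (twisted H J) R \<and>
            minimal_quasitriangular_hopf_algebra (twisted H J) R \<and>
            (\<exists>!T. T \<in> carrier A \<rightarrow>\<^sub>E carrier A \<and> is_T T) \<and>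
            (\<forall>T \<in> carrier A \<rightarrow>\<^sub>E carrier A. is_T T \<longrightarrow>
               bij_betw T (carrier A) (carrier A) \<and> R = cocycle_R_matrix G A \<rho> \<pi> T)"
proof -
  interpret bijective_cocycle A G \<rho> \<pi>
    using assms by (intro bijective_cocycle.intro finite_abelian_group.intro
        finite_abelian_group_axioms.intro bijective_cocycle_axioms.intro)
  let ?T = "\<lambda>x\<in>carrier A. \<pi> (inv\<^bsub>G\<^esub> \<pi>_inv (inv\<^bsub>A\<^esub> x))"
  have R: "inv\<^bsub>tensor_sq \<complex>[G']\<^esub> (tensor_flip J) \<otimes>\<^bsub>tensor_sq \<complex>[G']\<^esub> J = twist.R"
    by (simp add: tensor_flip_push)
  have T: "?T \<in> carrier A \<rightarrow>\<^sub>E carrier A" by auto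
  have unique: "\<exists>!T. T \<in> carrier A \<rightarrow>\<^sub>E carrier A \<and> is_T T"
  proof (rule ex1I[of _ ?T], intro conjI T)
    show "is_T ?T"
      using is_T_iff[OF T] by (rule iffD2) (rule refl)
    show "T = ?T" if "T \<in> carrier A \<rightarrow>\<^sub>E carrier A \<and> is_T T" for T
      by (rule iffD1[OF is_T_iff[OF conjunct1[OF that]] conjunct2[OF that]])
  qed
  have T_props: "bij_betw T (carrier A) (carrier A) \<and> twist.R = cocycle_R_matrix G A \<rho> \<pi> T"
    if "T \<in> carrier A \<rightarrow>\<^sub>E carrier A" "is_T T" for T
  proof
    show "bij_betw T (carrier A) (carrier A)"
      using T_bij iffD1[OF is_T_iff[OF that(1)] that(2)] by (simp only:)
    show "twist.R = cocycle_R_matrix G A \<rho> \<pi> T"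
      using that by (rule R_formula)
  qed
  show ?thesis
    unfolding Let_def R
    by (intro conjI S.hopf_group_algebra cocycle_twist_is_twist twist.twisted_triangular
        R_minimal unique ballI impI;
        (rule T_props[THEN conjunct1] T_props[THEN conjunct2], assumption, assumption))
qed

end
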